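(* For every $\omega$-category $C$, the canonical comparison map $\pi_C : \mathbb{H}^{\mathrm{sing}}(C) \to \mathbb{H}^{\mathrm{pol}}(C)$ induces isomorphisms $H^{\mathrm{sing}}_k(C) \simeq H^{\mathrm{pol}}_k(C)$ for $k \in \{0,1\}$.
   Context: $\omega$-categories. $\omega\mathbf{Cat}$ is the category of small strict globular $\omega$-categories $C$ (sets $C_n$ of $n$-cells, sources $s$, targets $t$, units $x\mapsto 1_x$, compositions $x*_k y$ of $n$-cells with $s_k(x)=t_k(y)$, $0\le k<n$, with the usual axioms) and $\omega$-functors. $\mathbb{D}_n$ is the $n$-globe (representing $C\mapsto C_n$), $\mathbb{S}_{n-1}\subset \mathbb{D}_n$ is obtained by removing its non-unit $n$-cell ($\mathbb{S}_{-1}=\emptyset$), $i_n:\mathbb{S}_{n-1}\to\mathbb{D}_n$ is the inclusion. $\mathbf{Ch}_{\ge0}$ is the category of non-negatively graded chain complexes of abelian groups, $\gamma^{\mathrm{Ch}}:\mathbf{Ch}_{\ge0}\to\mathrm{ho}(\mathbf{Ch}_{\ge0})$ its localization at quasi-isomorphisms. Abelianization. $\lambda:\omega\mathbf{Cat}\to\mathbf{Ch}_{\ge0}$: $\lambda_n(C)$ is $\mathbb{Z}C_n$ modulo the relations $x*_k y\sim x+y$ for $k$-composable $n$-cells, $k<n$, with differential induced by $\partial(x)=t(x)-s(x)$. Folk weak equivalences and polygraphic homology. $\sim_\omega$ is the largest relation on cells of $C$ such that $x\sim_\omega y$ ($x,y\in C_n$) implies that $x,y$ are parallel ($n=0$ or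 same source and target) and there are $(n+1)$-cells $r:x\to y$, $q:y\to x$ with $r*_nq\sim_\omega 1_y$, $q*_nr\sim_\omega1_x$. $F:C\to D$ is a folk weak equivalence (equivalence of $\omega$-categories) if every $y\in D_0$ satisfies $F(x)\sim_\omega y$ for some $x\in C_0$, and for all parallel $x,y\in C_n$ ($n\ge0$) and every $\beta:F(x)\to F(y)$ there is $\alpha:x\to y$ with $F(\alpha)\sim_\omega\beta$. These are the weak equivalences of the folk model structure on $\omega\mathbf{Cat}$, with generating cofibrations $\{i_n\mid n\geq 0\}$; $\lambda$ is left Quillen for it. $\gamma^{\mathrm{folk}}:\omega\mathbf{Cat}\to\mathrm{ho}(\omega\mathbf{Cat}^{\mathrm{folk}})$ is the localization. Polygraphic homology $\mathbb{H}^{\mathrm{pol}}:\mathrm{ho}(\omega\mathbf{Cat}^{\mathrm{folk}})\to\mathrm{ho}(\mathbf{Ch}_{\ge0})$ is the total left derived functor of $\lambda$, with its universal natural transformation $\alpha^{\mathrm{pol}}:\mathbb{H}^{\mathrm{pol}}\gamma^{\mathrm{folk}}\Rightarrow\gamma^{\mathrm{Ch}}\lambda$ (a right Kan extension of $\gamma^{\mathrm{Ch}}\lambda$ along $\gamma^{\mathrm{folk}}$); concretely $\mathbb{H}^{\mathrm{pol}}(C)=\lambda(P)$ for a folk-cofibrant replacement $P\to C$. $H_k^{\mathrm{pol}}(C)=H_k(\mathbb{H}^{\mathrm{pol}}(C))$. Thomason equivalences and singular homology. $\mathcal{O}_n$ is Street's $n$-th oriental. In Steiner's description: with $K$ the normalized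 chain complex of $\Delta_n$ ($K_k$ free on increasing sequences $\langle i_0<\dots<i_k\rangle$ in $\{0,\dots,n\}$, $\partial\langle i_0\dots i_k\rangle=\sum_j(-1)^j\langle i_0\dots\widehat{i_j}\dots i_k\rangle$, $e\langle i\rangle=1$) and $K_k^*$ the submonoid generated by the basis, an $m$-cell is a family $(x_k^-,x_k^+)_{0\le k\le m}$ with $x_k^\pm\in K_k^*$, $x_m^-=x_m^+$, $\partial x_k^\pm=x_{k-1}^+-x_{k-1}^-$, $e(x_0^\pm)=1$; the $k$-source (resp. $k$-target) truncates at level $k$ with both level-$k$ entries equal to $x_k^-$ (resp. $x_k^+$), units add zeros, $x*_k y=x+y-1^m_{s_k(x)}$. $N_\omega(C)=\mathrm{Hom}_{\omega\mathbf{Cat}}(\mathcal{O}_\bullet,C)$ is the nerve, with left adjoint $c_\omega$. $f$ is a Thomason equivalence if $N_\omega(f)$ is a (Kan–Quillen) weak equivalence of simplicial sets; $\gamma^{\mathrm{Th}}:\omega\mathbf{Cat}\to\mathrm{ho}(\omega\mathbf{Cat}^{\mathrm{Th}})$ is the localization. Every folk weak equivalence is a Thomason equivalence, so there is an induced functor $\mathcal{J}:\mathrm{ho}(\omega\mathbf{Cat}^{\mathrm{folk}})\to\mathrm{ho}(\omega\mathbf{Cat}^{\mathrm{Th}})$ with $\mathcal{J}\gamma^{\mathrm{folk}}=\gamma^{\mathrm{Th}}$. With $\kappa$ the normalized chain complex functor on simplicial sets, $\mathbb{H}^{\mathrm{sing}}:\mathrm{ho}(\omega\mathbf{Cat}^{\mathrm{Th}})\to\mathrm{ho}(\mathbf{Ch}_{\ge0})$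 is induced by $\kappa N_\omega$, and $H_k^{\mathrm{sing}}(C)=H_k(\kappa N_\omega(C))$. There is a canonical isomorphism $\lambda c_\omega\simeq\kappa$, and $\alpha^{\mathrm{sing}}:\mathbb{H}^{\mathrm{sing}}\gamma^{\mathrm{Th}}\Rightarrow\gamma^{\mathrm{Ch}}\lambda$ is induced by $\lambda$ applied to the co-unit: $\kappa N_\omega(C)\simeq\lambda c_\omega N_\omega(C)\to\lambda(C)$. Canonical comparison map. $\pi:\mathbb{H}^{\mathrm{sing}}\circ\mathcal{J}\Rightarrow\mathbb{H}^{\mathrm{pol}}$ is the unique natural transformation such that $\alpha^{\mathrm{sing}}=\alpha^{\mathrm{pol}}\circ(\pi\gamma^{\mathrm{folk}})$; its component at $C$ is $\pi_C:\mathbb{H}^{\mathrm{sing}}(C)\to\mathbb{H}^{\mathrm{pol}}(C)$. *)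

theory Defs
  imports "HOL-Homology.Homology"
begin

section \<open>Categories, localization, right Kan extensions\<close>

text \<open>Arrows are only meaningful relative to a given source and target, so the homs of a
  category need not be disjoint; \<open>Comp A X Y Z g f\<close> is the composite of
  \<open>f : X \<rightarrow> Y\<close> and \<open>g : Y \<rightarrow> Z\<close>.\<close>

record ('o, 'm) cat_data =
  Ob :: "'o set"
  Hom :: "'o \<Rightarrow> 'o \<Rightarrow> 'm set"
  Ident :: "'o \<Rightarrow> 'm"
  Comp :: "'o \<Rightarrow> 'o \<Rightarrow> 'o \<Rightarrow> 'm \<Rightarrow> 'm \<Rightarrow> 'm"

record ('o, 'm, 'p, 'n) fun_data =
  fob :: "'o \<Rightarrow> 'p"
  fmap :: "'o \<Rightarrow> 'o \<Rightarrow> 'm \<Rightarrow> 'n"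

definition is_functor ::
    "('o, 'm) cat_data \<Rightarrow> ('p, 'n) cat_data \<Rightarrow> ('o, 'm, 'p, 'n) fun_data \<Rightarrow> bool" where
  "is_functor A B F \<longleftrightarrow>
     (\<forall>X\<in>Ob A. fob F X \<in> Ob B \<and> fmap F X X (Ident A X) = Ident B (fob F X)) \<and>
     (\<forall>X\<in>Ob A. \<forall>Y\<in>Ob A. \<forall>f\<in>Hom A X Y. fmap F X Y f \<in> Hom B (fob F X) (fob F Y)) \<and>
     (\<forall>X\<in>Ob A. \<forall>Y\<in>Ob A. \<forall>Z\<in>Ob A. \<forall>f\<in>Hom A X Y. \<forall>g\<in>Hom A Y Z.
        fmap F X Z (Comp A X Y Z g f)
          = Comp B (fob F X) (fob F Y) (fob F Z) (fmap F Y Z g) (fmap F X Y f))"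

definition fun_comp ::
    "('p, 'n, 'q, 'l) fun_data \<Rightarrow> ('o, 'm, 'p, 'n) fun_data \<Rightarrow> ('o, 'm, 'q, 'l) fun_data"
    (infixl \<open>\<odot>\<close> 70) where
  "G \<odot> F = \<lparr> fob = (\<lambda>X. fob G (fob F X)),
             fmap = (\<lambda>X Y f. fmap G (fob F X) (fob F Y) (fmap F X Y f)) \<rparr>"

definition functor_eq ::
    "('o, 'm) cat_data \<Rightarrow> ('o, 'm, 'p, 'n) fun_data \<Rightarrow> ('o, 'm, 'p, 'n) fun_data \<Rightarrow> bool" where
  "functor_eq A F G \<longleftrightarrow>
     (\<forall>X\<in>Ob A. fob F X = fob G X) \<and>
     (\<forall>X\<in>Ob A. \<forall>Y\<in>Ob A. \<forall>f\<in>Hom A X Y. fmap F X Y f = fmap G X Y f)"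

definition nat_trans ::
    "('o, 'm) cat_data \<Rightarrow> ('p, 'n) cat_data \<Rightarrow> ('o, 'm, 'p, 'n) fun_data \<Rightarrow>
     ('o, 'm, 'p, 'n) fun_data \<Rightarrow> ('o \<Rightarrow> 'n) \<Rightarrow> bool" where
  "nat_trans A B F G \<eta> \<longleftrightarrow>
     (\<forall>X\<in>Ob A. \<eta> X \<in> Hom B (fob F X) (fob G X)) \<and>
     (\<forall>X\<in>Ob A. \<forall>Y\<in>Ob A. \<forall>f\<in>Hom A X Y.
        Comp B (fob F X) (fob F Y) (fob G Y) (\<eta> Y) (fmap F X Y f)
          = Comp B (fob F X) (fob G X) (fob G Y) (fmap G X Y f) (\<eta> X))"

text \<open>\<open>factors_through A E K T R \<epsilon> G \<beta> \<delta>\<close>: the transformation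
  \<open>\<beta> : G K \<Rightarrow> T\<close> is the composite of \<open>\<delta> K : G K \<Rightarrow> R K\<close> and
  \<open>\<epsilon> : R K \<Rightarrow> T\<close>.\<close>

definition factors_through ::
    "('o, 'm) cat_data \<Rightarrow> ('q, 'l) cat_data \<Rightarrow>
     ('o, 'm, 'p, 'n) fun_data \<Rightarrow> ('o, 'm, 'q, 'l) fun_data \<Rightarrow>
     ('p, 'n, 'q, 'l) fun_data \<Rightarrow> ('o \<Rightarrow> 'l) \<Rightarrow>
     ('p, 'n, 'q, 'l) fun_data \<Rightarrow> ('o \<Rightarrow> 'l) \<Rightarrow> ('p \<Rightarrow> 'l) \<Rightarrow> bool" where
  "factors_through A E K T R \<epsilon> G \<beta> \<delta> \<longleftrightarrow>
     (\<forall>X\<in>Ob A. \<beta> X = Comp E (fob G (fob K X)) (fob R (fob K X)) (fob T X) (\<epsilon> X) (\<delta> (fob K X)))"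

definition right_kan_extension ::
    "('o, 'm) cat_data \<Rightarrow> ('p, 'n) cat_data \<Rightarrow> ('q, 'l) cat_data \<Rightarrow>
     ('o, 'm, 'p, 'n) fun_data \<Rightarrow> ('o, 'm, 'q, 'l) fun_data \<Rightarrow>
     ('p, 'n, 'q, 'l) fun_data \<Rightarrow> ('o \<Rightarrow> 'l) \<Rightarrow> bool" where
  "right_kan_extension A B E K T R \<epsilon> \<longleftrightarrow>
     is_functor B E R \<and> nat_trans A E (R \<odot> K) T \<epsilon> \<and>
     (\<forall>G \<beta>. is_functor B E G \<longrightarrow> nat_trans A E (G \<odot> K) T \<beta> \<longrightarrow>
        (\<exists>\<delta>. nat_trans B E G R \<delta> \<and> factors_through A E K T R \<epsilon> G \<beta> \<delta>) \<and>
        (\<forall>\<delta> \<delta>'. nat_trans B E G R \<delta> \<longrightarrow> factors_through A E K T R \<epsilon> G \<beta> \<delta> \<longrightarrow>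
                nat_trans B E G R \<delta>' \<longrightarrow> factors_through A E K T R \<epsilon> G \<beta> \<delta>' \<longrightarrow>
                (\<forall>Y\<in>Ob B. \<delta> Y = \<delta>' Y)))"

text \<open>The localization at a class \<open>W\<close> of arrows, constructed by zigzags: the step
  \<open>Fwd X f Y\<close> is an arrow \<open>f : X \<rightarrow> Y\<close>, the step \<open>Bwd X w Y\<close> is the
  formal inverse of \<open>w : Y \<rightarrow> X\<close> in \<open>W\<close>.\<close>

datatype ('o, 'm) zstep = Fwd 'o 'm 'o | Bwd 'o 'm 'o

inductive zigzag ::
    "('o, 'm) cat_data \<Rightarrow> ('o \<Rightarrow> 'o \<Rightarrow> 'm \<Rightarrow> bool) \<Rightarrow>
     'o \<Rightarrow> ('o, 'm) zstep list \<Rightarrow> 'o \<Rightarrow> bool"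
  for A :: "('o, 'm) cat_data" and W :: "'o \<Rightarrow> 'o \<Rightarrow> 'm \<Rightarrow> bool" where
  zz_nil: "X \<in> Ob A \<Longrightarrow> zigzag A W X [] X"
| zz_fwd: "X \<in> Ob A \<Longrightarrow> f \<in> Hom A X Y \<Longrightarrow> zigzag A W Y zs Z \<Longrightarrow>
           zigzag A W X (Fwd X f Y # zs) Z"
| zz_bwd: "X \<in> Ob A \<Longrightarrow> w \<in> Hom A Y X \<Longrightarrow> W Y X w \<Longrightarrow> zigzag A W Y zs Z \<Longrightarrow>
           zigzag A W X (Bwd X w Y # zs) Z"

inductive zz_eq ::
    "('o, 'm) cat_data \<Rightarrow> ('o \<Rightarrow> 'o \<Rightarrow> 'm \<Rightarrow> bool) \<Rightarrow> 'o \<Rightarrow> 'o \<Rightarrow>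
     ('o, 'm) zstep list \<Rightarrow> ('o, 'm) zstep list \<Rightarrow> bool"
  for A :: "('o, 'm) cat_data" and W :: "'o \<Rightarrow> 'o \<Rightarrow> 'm \<Rightarrow> bool" where
  zz_refl: "zigzag A W X zs Y \<Longrightarrow> zz_eq A W X Y zs zs"
| zz_sym: "zz_eq A W X Y zs ws \<Longrightarrow> zz_eq A W X Y ws zs"
| zz_trans: "zz_eq A W X Y zs ws \<Longrightarrow> zz_eq A W X Y ws vs \<Longrightarrow> zz_eq A W X Y zs vs"
| zz_append: "zz_eq A W X Y zs zs' \<Longrightarrow> zz_eq A W Y Z ws ws' \<Longrightarrow>
              zz_eq A W X Z (zs @ ws) (zs' @ ws')"
| zz_ident: "X \<in> Ob A \<Longrightarrow> zz_eq A W X X [Fwd X (Ident A X) X] []"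
| zz_comp: "X \<in> Ob A \<Longrightarrow> Y \<in> Ob A \<Longrightarrow> Z \<in> Ob A \<Longrightarrow> f \<in> Hom A X Y \<Longrightarrow> g \<in> Hom A Y Z \<Longrightarrow>
            zz_eq A W X Z [Fwd X f Y, Fwd Y g Z] [Fwd X (Comp A X Y Z g f) Z]"
| zz_inv1: "X \<in> Ob A \<Longrightarrow> Y \<in> Ob A \<Longrightarrow> w \<in> Hom A X Y \<Longrightarrow> W X Y w \<Longrightarrow>
            zz_eq A W X X [Fwd X w Y, Bwd Y w X] []"
| zz_inv2: "X \<in> Ob A \<Longrightarrow> Y \<in> Ob A \<Longrightarrow> w \<in> Hom A X Y \<Longrightarrow> W X Y w \<Longrightarrow>
            zz_eq A W Y Y [Bwd Y w X, Fwd X w Y] []"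

definition zz_class ::
    "('o, 'm) cat_data \<Rightarrow> ('o \<Rightarrow> 'o \<Rightarrow> 'm \<Rightarrow> bool) \<Rightarrow> 'o \<Rightarrow> 'o \<Rightarrow>
     ('o, 'm) zstep list \<Rightarrow> ('o, 'm) zstep list set" where
  "zz_class A W X Y zs = {ws. zz_eq A W X Y zs ws}"

definition localization ::
    "('o, 'm) cat_data \<Rightarrow> ('o \<Rightarrow> 'o \<Rightarrow> 'm \<Rightarrow> bool) \<Rightarrow>
     ('o, ('o, 'm) zstep list set) cat_data" where
  "localization A W =
     \<lparr> Ob = Ob A,
       Hom = (\<lambda>X Y. {zz_class A W X Y zs | zs. zigzag A W X zs Y}),
       Ident = (\<lambda>X. zz_class A W X X []),
       Comp = (\<lambda>X Y Z b a. {vs. \<exists>zs\<in>a. \<exists>ws\<in>b. zz_eq A W X Z (zs @ ws) vs}) \<rparr>"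

definition loc_functor ::
    "('o, 'm) cat_data \<Rightarrow> ('o \<Rightarrow> 'o \<Rightarrow> 'm \<Rightarrow> bool) \<Rightarrow>
     ('o, 'm, 'o, ('o, 'm) zstep list set) fun_data" where
  "loc_functor A W = \<lparr> fob = (\<lambda>X. X), fmap = (\<lambda>X Y f. zz_class A W X Y [Fwd X f Y]) \<rparr>"


section \<open>Strict \<open>\<omega>\<close>-categories\<close>

text \<open>\<open>osrc C n\<close>, \<open>otgt C n\<close> map \<open>(n+1)\<close>-cells to \<open>n\<close>-cells,
  \<open>ounit C n\<close> maps \<open>n\<close>-cells to \<open>(n+1)\<close>-cells, and
  \<open>ocomp C n k x y\<close> is \<open>x *\<^sub>k y\<close> for \<open>n\<close>-cells \<open>x\<close>, \<open>y\<close>.\<close>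

record 'a ocat =
  cells :: "nat \<Rightarrow> 'a set"
  osrc :: "nat \<Rightarrow> 'a \<Rightarrow> 'a"
  otgt :: "nat \<Rightarrow> 'a \<Rightarrow> 'a"
  ounit :: "nat \<Rightarrow> 'a \<Rightarrow> 'a"
  ocomp :: "nat \<Rightarrow> nat \<Rightarrow> 'a \<Rightarrow> 'a \<Rightarrow> 'a"

text \<open>\<open>src_to C n k\<close> and \<open>tgt_to C n k\<close> are the iterated source and target from
  \<open>n\<close>-cells to \<open>k\<close>-cells, \<open>unit_to C k n\<close> is the iterated unit from
  \<open>k\<close>-cells to \<open>n\<close>-cells (\<open>k \<le> n\<close>).\<close>

primrec src_to :: "'a ocat \<Rightarrow> nat \<Rightarrow> nat \<Rightarrow> 'a \<Rightarrow> 'a" where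
  "src_to C 0 k x = x"
| "src_to C (Suc n) k x = (if Suc n \<le> k then x else src_to C n k (osrc C n x))"

primrec tgt_to :: "'a ocat \<Rightarrow> nat \<Rightarrow> nat \<Rightarrow> 'a \<Rightarrow> 'a" where
  "tgt_to C 0 k x = x"
| "tgt_to C (Suc n) k x = (if Suc n \<le> k then x else tgt_to C n k (otgt C n x))"

primrec unit_to :: "'a ocat \<Rightarrow> nat \<Rightarrow> nat \<Rightarrow> 'a \<Rightarrow> 'a" where
  "unit_to C k 0 x = x"
| "unit_to C k (Suc n) x = (if Suc n \<le> k then x else ounit C n (unit_to C k n x))"

definition composable :: "'a ocat \<Rightarrow> nat \<Rightarrow> nat \<Rightarrow> 'a \<Rightarrow> 'a \<Rightarrow> bool" where
  "composable C n k x y \<longleftrightarrow>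
     k < n \<and> x \<in> cells C n \<and> y \<in> cells C n \<and> src_to C n k x = tgt_to C n k y"

definition omega_category :: "'a ocat \<Rightarrow> bool" where
  "omega_category C \<longleftrightarrow>
     (\<forall>n. \<forall>x\<in>cells C (Suc n). osrc C n x \<in> cells C n \<and> otgt C n x \<in> cells C n) \<and>
     (\<forall>n. \<forall>x\<in>cells C (Suc (Suc n)).
        osrc C n (osrc C (Suc n) x) = osrc C n (otgt C (Suc n) x) \<and>
        otgt C n (osrc C (Suc n) x) = otgt C n (otgt C (Suc n) x)) \<and>
     (\<forall>n. \<forall>x\<in>cells C n. ounit C n x \<in> cells C (Suc n) \<and>
        osrc C n (ounit C n x) = x \<and> otgt C n (ounit C n x) = x) \<and>
     (\<forall>n k x y. composable C n k x y \<longrightarrow> ocomp C n k x y \<in> cells C n) \<and>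
     (\<forall>n x y. composable C (Suc n) n x y \<longrightarrow>
        osrc C n (ocomp C (Suc n) n x y) = osrc C n y \<and>
        otgt C n (ocomp C (Suc n) n x y) = otgt C n x) \<and>
     (\<forall>n k x y. k < n \<longrightarrow> composable C (Suc n) k x y \<longrightarrow>
        osrc C n (ocomp C (Suc n) k x y) = ocomp C n k (osrc C n x) (osrc C n y) \<and>
        otgt C n (ocomp C (Suc n) k x y) = ocomp C n k (otgt C n x) (otgt C n y)) \<and>
     (\<forall>n k x. k < n \<longrightarrow> x \<in> cells C n \<longrightarrow>
        ocomp C n k x (unit_to C k n (src_to C n k x)) = x \<and>
        ocomp C n k (unit_to C k n (tgt_to C n k x)) x = x) \<and>
     (\<forall>n k x y z. composable C n k x y \<longrightarrow> composable C n k y z \<longrightarrow>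
        ocomp C n k (ocomp C n k x y) z = ocomp C n k x (ocomp C n k y z)) \<and>
     (\<forall>n l k x y z w. k < l \<longrightarrow> composable C n l x y \<longrightarrow> composable C n l z w \<longrightarrow>
        composable C n k x z \<longrightarrow> composable C n k y w \<longrightarrow>
        ocomp C n k (ocomp C n l x y) (ocomp C n l z w)
          = ocomp C n l (ocomp C n k x z) (ocomp C n k y w)) \<and>
     (\<forall>n k x y. composable C n k x y \<longrightarrow>
        ounit C n (ocomp C n k x y) = ocomp C (Suc n) k (ounit C n x) (ounit C n y))"

text \<open>Functors are extensional, so that equality of functors is equality of the underlying
  functions.\<close>

definition omega_functor :: "'a ocat \<Rightarrow> 'b ocat \<Rightarrow> (nat \<Rightarrow> 'a \<Rightarrow> 'b) \<Rightarrow> bool" where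
  "omega_functor C D F \<longleftrightarrow>
     (\<forall>n. F n \<in> cells C n \<rightarrow>\<^sub>E cells D n) \<and>
     (\<forall>n. \<forall>x\<in>cells C (Suc n).
        F n (osrc C n x) = osrc D n (F (Suc n) x) \<and> F n (otgt C n x) = otgt D n (F (Suc n) x)) \<and>
     (\<forall>n. \<forall>x\<in>cells C n. F (Suc n) (ounit C n x) = ounit D n (F n x)) \<and>
     (\<forall>n k x y. composable C n k x y \<longrightarrow> F n (ocomp C n k x y) = ocomp D n k (F n x) (F n y))"

text \<open>The category of small \<open>\<omega>\<close>-categories; smallness means that the cells are elements
  of the type \<open>'a\<close>.\<close>

definition omega_Cat :: "('a ocat, nat \<Rightarrow> 'a \<Rightarrow> 'a) cat_data" where
  "omega_Cat =
     \<lparr> Ob = {C. omega_category C},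
       Hom = (\<lambda>C D. {F. omega_functor C D F}),
       Ident = (\<lambda>C n. restrict id (cells C n)),
       Comp = (\<lambda>C D E G F n. compose (cells C n) (G n) (F n)) \<rparr>"


section \<open>Folk weak equivalences\<close>

definition parallel :: "'a ocat \<Rightarrow> nat \<Rightarrow> 'a \<Rightarrow> 'a \<Rightarrow> bool" where
  "parallel C n x y \<longleftrightarrow> x \<in> cells C n \<and> y \<in> cells C n \<and>
     (\<forall>m. n = Suc m \<longrightarrow> osrc C m x = osrc C m y \<and> otgt C m x = otgt C m y)"

definition is_arrow :: "'a ocat \<Rightarrow> nat \<Rightarrow> 'a \<Rightarrow> 'a \<Rightarrow> 'a \<Rightarrow> bool" where
  "is_arrow C n r x y \<longleftrightarrow> r \<in> cells C (Suc n) \<and> osrc C n r = x \<and> otgt C n r = y"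

coinductive omega_equiv :: "'a ocat \<Rightarrow> nat \<Rightarrow> 'a \<Rightarrow> 'a \<Rightarrow> bool" for C :: "'a ocat" where
  "parallel C n x y \<Longrightarrow> is_arrow C n r x y \<Longrightarrow> is_arrow C n q y x \<Longrightarrow>
   omega_equiv C (Suc n) (ocomp C (Suc n) n r q) (ounit C n y) \<Longrightarrow>
   omega_equiv C (Suc n) (ocomp C (Suc n) n q r) (ounit C n x) \<Longrightarrow>
   omega_equiv C n x y"

definition folk_equivalence :: "'a ocat \<Rightarrow> 'b ocat \<Rightarrow> (nat \<Rightarrow> 'a \<Rightarrow> 'b) \<Rightarrow> bool" where
  "folk_equivalence C D F \<longleftrightarrow>
     omega_functor C D F \<and>
     (\<forall>y\<in>cells D 0. \<exists>x\<in>cells C 0. omega_equiv D 0 (F 0 x) y) \<and>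
     (\<forall>n x y \<beta>. parallel C n x y \<longrightarrow> is_arrow D n \<beta> (F n x) (F n y) \<longrightarrow>
        (\<exists>\<alpha>. is_arrow C n \<alpha> x y \<and> omega_equiv D (Suc n) (F (Suc n) \<alpha>) \<beta>))"


section \<open>Chain complexes\<close>

text \<open>Abelian groups are the (multiplicatively written) commutative groups of HOL-Algebra;
  \<open>cdiff K n\<close> is the differential from degree \<open>n + 1\<close> to degree \<open>n\<close>.\<close>

record 'e chcx =
  cgrp :: "nat \<Rightarrow> 'e monoid"
  cdiff :: "nat \<Rightarrow> 'e \<Rightarrow> 'e"

definition chain_complex :: "'e chcx \<Rightarrow> bool" where
  "chain_complex K \<longleftrightarrow>
     (\<forall>n. comm_group (cgrp K n)) \<and>
     (\<forall>n. cdiff K n \<in> hom (cgrp K (Suc n)) (cgrp K n)) \<and>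
     (\<forall>n. \<forall>x\<in>carrier (cgrp K (Suc (Suc n))). cdiff K n (cdiff K (Suc n) x) = \<one>\<^bsub>cgrp K n\<^esub>)"

definition chain_map :: "'e chcx \<Rightarrow> 'f chcx \<Rightarrow> (nat \<Rightarrow> 'e \<Rightarrow> 'f) \<Rightarrow> bool" where
  "chain_map K L f \<longleftrightarrow>
     (\<forall>n. f n \<in> hom (cgrp K n) (cgrp L n) \<inter> extensional (carrier (cgrp K n))) \<and>
     (\<forall>n. \<forall>x\<in>carrier (cgrp K (Suc n)). f n (cdiff K n x) = cdiff L n (f (Suc n) x))"

definition Ch :: "('e chcx, nat \<Rightarrow> 'e \<Rightarrow> 'e) cat_data" where
  "Ch =
     \<lparr> Ob = {K. chain_complex K},
       Hom = (\<lambda>K L. {f. chain_map K L f}),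
       Ident = (\<lambda>K n. restrict id (carrier (cgrp K n))),
       Comp = (\<lambda>K L M g f n. compose (carrier (cgrp K n)) (g n) (f n)) \<rparr>"

definition cycles :: "'e chcx \<Rightarrow> nat \<Rightarrow> 'e set" where
  "cycles K k = {x \<in> carrier (cgrp K k). \<forall>m. k = Suc m \<longrightarrow> cdiff K m x = \<one>\<^bsub>cgrp K m\<^esub>}"

definition boundaries :: "'e chcx \<Rightarrow> nat \<Rightarrow> 'e set" where
  "boundaries K k = cdiff K k ` carrier (cgrp K (Suc k))"

definition homology :: "nat \<Rightarrow> 'e chcx \<Rightarrow> 'e set monoid" where
  "homology k K = (cgrp K k)\<lparr>carrier := cycles K k\<rparr> Mod boundaries K k"

definition homology_map ::
    "nat \<Rightarrow> 'e chcx \<Rightarrow> 'f chcx \<Rightarrow> (nat \<Rightarrow> 'e \<Rightarrow> 'f) \<Rightarrow> 'e set \<Rightarrow> 'f set" where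
  "homology_map k K L f A = the_elem ((\<lambda>a. boundaries L k #>\<^bsub>cgrp L k\<^esub> f k a) ` A)"

definition quasi_iso :: "'e chcx \<Rightarrow> 'f chcx \<Rightarrow> (nat \<Rightarrow> 'e \<Rightarrow> 'f) \<Rightarrow> bool" where
  "quasi_iso K L f \<longleftrightarrow>
     chain_map K L f \<and> (\<forall>k. homology_map k K L f \<in> iso (homology k K) (homology k L))"

definition ho_Ch ::
    "('e chcx, ('e chcx, nat \<Rightarrow> 'e \<Rightarrow> 'e) zstep list set) cat_data" where
  "ho_Ch = localization Ch quasi_iso"

definition gamma_Ch ::
    "('e chcx, nat \<Rightarrow> 'e \<Rightarrow> 'e, 'e chcx, ('e chcx, nat \<Rightarrow> 'e \<Rightarrow> 'e) zstep list set) fun_data" where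
  "gamma_Ch = loc_functor Ch quasi_iso"

text \<open>The functor induced by the \<open>k\<close>-th homology on the localization, on arrows:
  formal inverses are sent to inverses, and the result does not depend on the zigzag chosen to
  represent an arrow.\<close>

fun step_homology :: "nat \<Rightarrow> ('e chcx, nat \<Rightarrow> 'e \<Rightarrow> 'e) zstep \<Rightarrow> 'e set \<Rightarrow> 'e set" where
  "step_homology k (Fwd K f L) = homology_map k K L f"
| "step_homology k (Bwd K w L) = inv_into (carrier (homology k L)) (homology_map k L K w)"

primrec zz_homology :: "nat \<Rightarrow> ('e chcx, nat \<Rightarrow> 'e \<Rightarrow> 'e) zstep list \<Rightarrow> 'e set \<Rightarrow> 'e set" where
  "zz_homology k [] = id"
| "zz_homology k (z # zs) = zz_homology k zs \<circ> step_homology k z"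

definition ho_homology ::
    "nat \<Rightarrow> ('e chcx, nat \<Rightarrow> 'e \<Rightarrow> 'e) zstep list set \<Rightarrow> 'e set \<Rightarrow> 'e set" where
  "ho_homology k \<phi> = zz_homology k (SOME zs. zs \<in> \<phi>)"


section \<open>Free abelian groups modulo relations\<close>

definition free_quot :: "'g set \<Rightarrow> ('g \<Rightarrow>\<^sub>0 int) set \<Rightarrow> ('g \<Rightarrow>\<^sub>0 int) set monoid" where
  "free_quot S R = free_Abelian_group S Mod generate (free_Abelian_group S) R"

text \<open>The homomorphism \<open>free_quot S R \<rightarrow> free_quot S' R'\<close> induced by a map
  \<open>\<phi>\<close> on generators.\<close>

definition free_quot_map ::
    "'g set \<Rightarrow> ('g \<Rightarrow>\<^sub>0 int) set \<Rightarrow> 'h set \<Rightarrow> ('h \<Rightarrow>\<^sub>0 int) set \<Rightarrow>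
     ('g \<Rightarrow> ('h \<Rightarrow>\<^sub>0 int)) \<Rightarrow> ('g \<Rightarrow>\<^sub>0 int) set \<Rightarrow> ('h \<Rightarrow>\<^sub>0 int) set" where
  "free_quot_map S R S' R' \<phi> =
     (\<lambda>A \<in> carrier (free_quot S R).
        the_elem ((\<lambda>a. generate (free_Abelian_group S') R'
                         #>\<^bsub>free_Abelian_group S'\<^esub> frag_extend \<phi> a) ` A))"


section \<open>Abelianization\<close>

text \<open>The complexes \<open>\<lambda>(C)\<close> and \<open>\<kappa>(X)\<close> below have to be objects of one category
  of complexes. Their generators are therefore taken in a sum type: \<open>Inl\<close> marks cells,
  \<open>Inr\<close> marks simplices.\<close>

definition lam_gens :: "'a ocat \<Rightarrow> nat \<Rightarrow> ('a + 's) set" where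
  "lam_gens C n = Inl ` cells C n"

definition lam_rels :: "'a ocat \<Rightarrow> nat \<Rightarrow> (('a + 's) \<Rightarrow>\<^sub>0 int) set" where
  "lam_rels C n =
     {frag_of (Inl (ocomp C n k x y)) - (frag_of (Inl x) + frag_of (Inl y)) | k x y.
        composable C n k x y}"

definition lam :: "'a ocat \<Rightarrow> (('a + 's) \<Rightarrow>\<^sub>0 int) set chcx" where
  "lam C =
     \<lparr> cgrp = (\<lambda>n. free_quot (lam_gens C n) (lam_rels C n)),
       cdiff = (\<lambda>n. free_quot_map (lam_gens C (Suc n)) (lam_rels C (Suc n))
                                  (lam_gens C n) (lam_rels C n)
                 (case_sum (\<lambda>x. frag_of (Inl (otgt C n x)) - frag_of (Inl (osrc C n x)))
                           (\<lambda>_. 0))) \<rparr>"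

definition lam_map ::
    "'a ocat \<Rightarrow> 'b ocat \<Rightarrow> (nat \<Rightarrow> 'a \<Rightarrow> 'b) \<Rightarrow>
     nat \<Rightarrow> (('a + 's) \<Rightarrow>\<^sub>0 int) set \<Rightarrow> (('b + 't) \<Rightarrow>\<^sub>0 int) set" where
  "lam_map C D F n = free_quot_map (lam_gens C n) (lam_rels C n) (lam_gens D n) (lam_rels D n)
                       (case_sum (\<lambda>x. frag_of (Inl (F n x))) (\<lambda>_. 0))"


section \<open>Simplicial sets\<close>

text \<open>Only the values on \<open>{..m}\<close> of a map \<open>[m] \<rightarrow> [n]\<close> matter;
  \<open>sact X m n \<phi> : X\<^sub>n \<rightarrow> X\<^sub>m\<close> is the action of \<open>\<phi> : [m] \<rightarrow> [n]\<close>.\<close>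

definition mono_map :: "nat \<Rightarrow> nat \<Rightarrow> (nat \<Rightarrow> nat) \<Rightarrow> bool" where
  "mono_map m n \<phi> \<longleftrightarrow> mono_on {..m} \<phi> \<and> \<phi> ` {..m} \<subseteq> {..n}"

record 's sset =
  simps :: "nat \<Rightarrow> 's set"
  sact :: "nat \<Rightarrow> nat \<Rightarrow> (nat \<Rightarrow> nat) \<Rightarrow> 's \<Rightarrow> 's"

definition coface :: "nat \<Rightarrow> nat \<Rightarrow> nat" where
  "coface i j = (if j < i then j else Suc j)"

definition degenerate :: "'s sset \<Rightarrow> nat \<Rightarrow> 's set" where
  "degenerate X n = {sact X n m \<sigma> y | m \<sigma> y. m < n \<and> mono_map n m \<sigma> \<and> y \<in> simps X m}"

definition kappa_gens :: "'s sset \<Rightarrow> nat \<Rightarrow> ('a + 's) set" where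
  "kappa_gens X n = Inr ` simps X n"

definition kappa_rels :: "'s sset \<Rightarrow> nat \<Rightarrow> (('a + 's) \<Rightarrow>\<^sub>0 int) set" where
  "kappa_rels X n = (\<lambda>x. frag_of (Inr x)) ` degenerate X n"

definition kappa :: "'s sset \<Rightarrow> (('a + 's) \<Rightarrow>\<^sub>0 int) set chcx" where
  "kappa X =
     \<lparr> cgrp = (\<lambda>n. free_quot (kappa_gens X n) (kappa_rels X n)),
       cdiff = (\<lambda>n. free_quot_map (kappa_gens X (Suc n)) (kappa_rels X (Suc n))
                                  (kappa_gens X n) (kappa_rels X n)
                 (case_sum (\<lambda>_. 0)
                    (\<lambda>x. \<Sum>i\<le>Suc n. frag_cmul ((-1) ^ i)
                           (frag_of (Inr (sact X n (Suc n) (coface i) x)))))) \<rparr>"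

definition kappa_map ::
    "'s sset \<Rightarrow> 't sset \<Rightarrow> (nat \<Rightarrow> 's \<Rightarrow> 't) \<Rightarrow>
     nat \<Rightarrow> (('a + 's) \<Rightarrow>\<^sub>0 int) set \<Rightarrow> (('b + 't) \<Rightarrow>\<^sub>0 int) set" where
  "kappa_map X Y f n =
     free_quot_map (kappa_gens X n) (kappa_rels X n) (kappa_gens Y n) (kappa_rels Y n)
       (case_sum (\<lambda>_. 0) (\<lambda>x. frag_of (Inr (f n x))))"


subsection \<open>Kan--Quillen weak equivalences\<close>

text \<open>The points of the geometric realization are the classes of triples \<open>(n, x, t)\<close> with
  \<open>x\<close> an \<open>n\<close>-simplex and \<open>t\<close> in the topological \<open>n\<close>-simplex, for the
  equivalence relation generated by \<open>(m, \<phi>\<^sup>* x, t) \<sim> (n, x, \<phi>\<^sub>* t)\<close>.\<close>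

definition push_simplex :: "nat \<Rightarrow> (nat \<Rightarrow> nat) \<Rightarrow> (nat \<Rightarrow> real) \<Rightarrow> nat \<Rightarrow> real" where
  "push_simplex m \<phi> t j = (\<Sum>i | i \<le> m \<and> \<phi> i = j. t i)"

definition real_points :: "'s sset \<Rightarrow> (nat \<times> 's \<times> (nat \<Rightarrow> real)) set" where
  "real_points X = {(n, x, t). x \<in> simps X n \<and> t \<in> standard_simplex n}"

definition real_glue :: "'s sset \<Rightarrow> (nat \<times> 's \<times> (nat \<Rightarrow> real)) rel" where
  "real_glue X = {((m, sact X m n \<phi> x, t), (n, x, push_simplex m \<phi> t)) | m n \<phi> x t.
                    mono_map m n \<phi> \<and> x \<in> simps X n \<and> t \<in> standard_simplex m}"

definition real_class ::
    "'s sset \<Rightarrow> nat \<times> 's \<times> (nat \<Rightarrow> real) \<Rightarrow> (nat \<times> 's \<times> (nat \<Rightarrow> real)) set" where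
  "real_class X p = (real_glue X \<union> (real_glue X)\<inverse>)\<^sup>* `` {p}"

definition realization :: "'s sset \<Rightarrow> (nat \<times> 's \<times> (nat \<Rightarrow> real)) set topology" where
  "realization X = topology (\<lambda>U.
     U \<subseteq> real_class X ` real_points X \<and>
     (\<forall>n. \<forall>x\<in>simps X n.
        openin (subtopology (powertop_real UNIV) (standard_simplex n))
               {t \<in> standard_simplex n. real_class X (n, x, t) \<in> U}))"

lemma istopology_realization:
  "istopology (\<lambda>U. U \<subseteq> real_class X ` real_points X \<and>
     (\<forall>n. \<forall>x\<in>simps X n.
        openin (subtopology (powertop_real UNIV) (standard_simplex n))
               {t \<in> standard_simplex n. real_class X (n, x, t) \<in> U}))"
  (is "istopology (\<lambda>U. U \<subseteq> _ \<and> (\<forall>n. \<forall>x\<in>simps X n. openin (?T n) (?P n x U)))")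
proof -
  have int: "?P n x (S \<inter> T) = ?P n x S \<inter> ?P n x T" and un: "?P n x (\<Union>K) = \<Union>(?P n x ` K)"
    for n x S T K by auto
  show ?thesis
    unfolding istopology_def int un
    by (intro conjI allI impI ballI openin_Int openin_Union) (simp_all, auto)
qed

definition realization_map ::
    "'s sset \<Rightarrow> 't sset \<Rightarrow> (nat \<Rightarrow> 's \<Rightarrow> 't) \<Rightarrow>
     (nat \<times> 's \<times> (nat \<Rightarrow> real)) set \<Rightarrow> (nat \<times> 't \<times> (nat \<Rightarrow> real)) set" where
  "realization_map X Y f P = the_elem ((\<lambda>(n, x, t). real_class Y (n, f n x, t)) ` P)"

definition kan_quillen_equivalence ::
    "'s sset \<Rightarrow> 't sset \<Rightarrow> (nat \<Rightarrow> 's \<Rightarrow> 't) \<Rightarrow> bool" where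
  "kan_quillen_equivalence X Y f \<longleftrightarrow>
     continuous_map (realization X) (realization Y) (realization_map X Y f) \<and>
     (\<exists>g. continuous_map (realization Y) (realization X) g \<and>
          homotopic_with (\<lambda>_. True) (realization X) (realization X)
            (g \<circ> realization_map X Y f) id \<and>
          homotopic_with (\<lambda>_. True) (realization Y) (realization Y)
            (realization_map X Y f \<circ> g) id)"


section \<open>Orientals and the nerve\<close>

text \<open>Basis elements \<open>\<langle>i\<^sub>0 < \<dots> < i\<^sub>k\<rangle>\<close> are strictly increasing lists. A cell
  \<open>x\<close> of an oriental is the family with \<open>x False k\<close> \<open>= x\<^sub>k\<^sup>-\<close> and
  \<open>x True k\<close> \<open>= x\<^sub>k\<^sup>+\<close>, extended by zero above its dimension; in this encoding
  the units are identities.\<close>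

type_synonym ocell = "bool \<Rightarrow> nat \<Rightarrow> (nat list \<Rightarrow>\<^sub>0 int)"

definition obasis :: "nat \<Rightarrow> nat \<Rightarrow> nat list set" where
  "obasis n k = {l. length l = Suc k \<and> sorted_wrt (<) l \<and> set l \<subseteq> {..n}}"

definition obdry :: "(nat list \<Rightarrow>\<^sub>0 int) \<Rightarrow> (nat list \<Rightarrow>\<^sub>0 int)" where
  "obdry = frag_extend (\<lambda>l. \<Sum>j<length l. frag_cmul ((-1) ^ j) (frag_of (take j l @ drop (Suc j) l)))"

definition oaug :: "(nat list \<Rightarrow>\<^sub>0 int) \<Rightarrow> int" where
  "oaug c = (\<Sum>l\<in>Poly_Mapping.keys c. Poly_Mapping.lookup c l)"

definition opositive :: "nat \<Rightarrow> nat \<Rightarrow> (nat list \<Rightarrow>\<^sub>0 int) set" where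
  "opositive n k = {c. Poly_Mapping.keys c \<subseteq> obasis n k \<and> (\<forall>l. 0 \<le> Poly_Mapping.lookup c l)}"

definition oriental_cells :: "nat \<Rightarrow> nat \<Rightarrow> ocell set" where
  "oriental_cells n m =
     {x. (\<forall>e. \<forall>k\<le>m. x e k \<in> opositive n k) \<and> (\<forall>e. \<forall>k>m. x e k = 0) \<and>
         x False m = x True m \<and>
         (\<forall>e. \<forall>k<m. obdry (x e (Suc k)) = x True k - x False k) \<and>
         (\<forall>e. oaug (x e 0) = 1)}"

text \<open>\<open>otrunc e m x\<close> is the \<open>m\<close>-source (\<open>e = False\<close>) or \<open>m\<close>-target
  (\<open>e = True\<close>) of \<open>x\<close>.\<close>

definition otrunc :: "bool \<Rightarrow> nat \<Rightarrow> ocell \<Rightarrow> ocell" where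
  "otrunc e m x = (\<lambda>d k. if k < m then x d k else if k = m then x e m else 0)"

definition oriental :: "nat \<Rightarrow> ocell ocat" where
  "oriental n =
     \<lparr> cells = oriental_cells n,
       osrc = (\<lambda>m x. otrunc False m x),
       otgt = (\<lambda>m x. otrunc True m x),
       ounit = (\<lambda>m x. x),
       ocomp = (\<lambda>m k x y d j. x d j + y d j - otrunc False k x d j) \<rparr>"

definition oriental_map :: "(nat \<Rightarrow> nat) \<Rightarrow> ocell \<Rightarrow> ocell" where
  "oriental_map \<phi> x =
     (\<lambda>e k. frag_extend (\<lambda>l. if sorted_wrt (<) (map \<phi> l) then frag_of (map \<phi> l) else 0) (x e k))"

text \<open>The principal cell of \<open>\<O>\<^sub>n\<close>: the basis element \<open>\<langle>0 < \<dots> < n\<rangle>\<close> in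
  degree \<open>n\<close>; going down, \<open>x\<^sub>k\<^sup>-\<close> is the negative part of
  \<open>\<partial> x\<^bsub>k+1\<^esub>\<^sup>-\<close> and \<open>x\<^sub>k\<^sup>+\<close> is the positive part of
  \<open>\<partial> x\<^bsub>k+1\<^esub>\<^sup>+\<close>. The last argument of \<open>principal_part\<close> is the codegree.\<close>

primrec principal_part :: "bool \<Rightarrow> nat \<Rightarrow> nat \<Rightarrow> (nat list \<Rightarrow>\<^sub>0 int)" where
  "principal_part e n 0 = frag_of [0..<Suc n]"
| "principal_part e n (Suc j) =
     Poly_Mapping.map (\<lambda>c. max 0 (if e then c else - c)) (obdry (principal_part e n j))"

definition principal_cell :: "nat \<Rightarrow> ocell" where
  "principal_cell n = (\<lambda>e k. if k \<le> n then principal_part e n (n - k) else 0)"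

type_synonym 'a osimplex = "nat \<Rightarrow> ocell \<Rightarrow> 'a"

definition nerve :: "'a ocat \<Rightarrow> 'a osimplex sset" where
  "nerve C =
     \<lparr> simps = (\<lambda>n. {x. omega_functor (oriental n) C x}),
       sact = (\<lambda>m n \<phi> x k. restrict (x k \<circ> oriental_map \<phi>) (oriental_cells m k)) \<rparr>"

definition nerve_map :: "(nat \<Rightarrow> 'a \<Rightarrow> 'b) \<Rightarrow> nat \<Rightarrow> 'a osimplex \<Rightarrow> 'b osimplex" where
  "nerve_map F n x = (\<lambda>k. restrict (F k \<circ> x k) (oriental_cells n k))"

definition thomason_equivalence :: "'a ocat \<Rightarrow> 'b ocat \<Rightarrow> (nat \<Rightarrow> 'a \<Rightarrow> 'b) \<Rightarrow> bool" where
  "thomason_equivalence C D F \<longleftrightarrow>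
     omega_functor C D F \<and> kan_quillen_equivalence (nerve C) (nerve D) (nerve_map F)"


section \<open>Homotopy categories and homology theories\<close>

type_synonym 'a omor = "nat \<Rightarrow> 'a \<Rightarrow> 'a"
type_synonym 'a homor = "('a ocat, 'a omor) zstep list set"
type_synonym 'a chains = "(('a + 'a osimplex) \<Rightarrow>\<^sub>0 int) set"
type_synonym 'a chmor = "nat \<Rightarrow> 'a chains \<Rightarrow> 'a chains"
type_synonym 'a hochmor = "('a chains chcx, 'a chmor) zstep list set"

definition ho_folk :: "('a ocat, 'a homor) cat_data" where
  "ho_folk = localization omega_Cat folk_equivalence"

definition gamma_folk :: "('a ocat, 'a omor, 'a ocat, 'a homor) fun_data" where
  "gamma_folk = loc_functor omega_Cat folk_equivalence"

definition ho_Th :: "('a ocat, 'a homor) cat_data" where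
  "ho_Th = localization omega_Cat thomason_equivalence"

definition gamma_Th :: "('a ocat, 'a omor, 'a ocat, 'a homor) fun_data" where
  "gamma_Th = loc_functor omega_Cat thomason_equivalence"

definition Lam :: "('a ocat, 'a omor, 'a chains chcx, 'a chmor) fun_data" where
  "Lam = \<lparr> fob = lam, fmap = lam_map \<rparr>"

definition Kappa_nerve :: "('a ocat, 'a omor, 'a chains chcx, 'a chmor) fun_data" where
  "Kappa_nerve = \<lparr> fob = (\<lambda>C. kappa (nerve C)),
                   fmap = (\<lambda>C D F. kappa_map (nerve C) (nerve D) (nerve_map F)) \<rparr>"

text \<open>Polygraphic homology is the total left derived functor of \<open>\<lambda>\<close> for the folk weak
  equivalences. The functors \<open>J\<close>, \<open>Hsing\<close> and \<open>Hpol\<close> are thus given by their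
  universal properties, which determine the first two uniquely and the last one up to a unique
  isomorphism.\<close>

definition is_induced_J :: "('a ocat, 'a homor, 'a ocat, 'a homor) fun_data \<Rightarrow> bool" where
  "is_induced_J J \<longleftrightarrow>
     is_functor ho_folk ho_Th J \<and> functor_eq omega_Cat (J \<odot> gamma_folk) gamma_Th"

definition is_singular_homology ::
    "('a ocat, 'a homor, 'a chains chcx, 'a hochmor) fun_data \<Rightarrow> bool" where
  "is_singular_homology Hsing \<longleftrightarrow>
     is_functor ho_Th ho_Ch Hsing \<and>
     functor_eq omega_Cat (Hsing \<odot> gamma_Th) (gamma_Ch \<odot> Kappa_nerve)"

definition is_polygraphic_homology ::
    "('a ocat, 'a homor, 'a chains chcx, 'a hochmor) fun_data \<Rightarrow>
     ('a ocat \<Rightarrow> 'a hochmor) \<Rightarrow> bool" where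
  "is_polygraphic_homology Hpol \<alpha>pol \<longleftrightarrow>
     right_kan_extension omega_Cat ho_folk ho_Ch gamma_folk (gamma_Ch \<odot> Lam) Hpol \<alpha>pol"

text \<open>For a simplicial set \<open>X\<close>, an \<open>\<omega>\<close>-category \<open>E\<close> and a simplicial map
  \<open>\<eta>\<close> from \<open>X\<close> to the nerve of \<open>E\<close>, \<open>kappa_to_lam\<close> is the map
  \<open>\<kappa>(X) \<rightarrow> \<lambda>(E)\<close> that on each \<open>n\<close>-simplex is the composite
  \<open>\<kappa>(\<Delta>\<^sub>n) \<simeq> \<lambda>(\<O>\<^sub>n) \<rightarrow> \<lambda>(E)\<close>; the isomorphism sends the fundamental
  simplex to the class of the principal cell. If \<open>E\<close> is \<open>c\<^sub>\<omega>(X)\<close> and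
  \<open>\<eta>\<close> the unit of the adjunction, this is the canonical isomorphism
  \<open>\<kappa>(X) \<simeq> \<lambda>(c\<^sub>\<omega>(X))\<close>.\<close>

definition kappa_to_lam ::
    "'s sset \<Rightarrow> 'a ocat \<Rightarrow> (nat \<Rightarrow> 's \<Rightarrow> 'a osimplex) \<Rightarrow>
     nat \<Rightarrow> (('b + 's) \<Rightarrow>\<^sub>0 int) set \<Rightarrow> (('a + 't) \<Rightarrow>\<^sub>0 int) set" where
  "kappa_to_lam X E \<eta> n =
     free_quot_map (kappa_gens X n) (kappa_rels X n) (lam_gens E n) (lam_rels E n)
       (case_sum (\<lambda>_. 0) (\<lambda>x. frag_of (Inl (\<eta> n x n (principal_cell n)))))"

text \<open>The composite of \<open>\<kappa>(N C) \<simeq> \<lambda>(c\<^sub>\<omega>(N C))\<close> with \<open>\<lambda>\<close> of the co-unit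
  \<open>\<epsilon> : c\<^sub>\<omega>(N C) \<rightarrow> C\<close>. It sends an \<open>n\<close>-simplex \<open>x\<close> to the class of
  \<open>\<epsilon>(\<eta>(x)(\<theta>\<^sub>n)) = x(\<theta>\<^sub>n)\<close>, \<open>\<theta>\<^sub>n\<close> the principal cell, by the triangle
  identity \<open>N(\<epsilon>) \<circ> \<eta> = id\<close>; hence it is \<open>kappa_to_lam\<close> of the identity of
  \<open>N C\<close>.\<close>

definition alpha_sing_map :: "'a ocat \<Rightarrow> 'a chmor" where
  "alpha_sing_map C = kappa_to_lam (nerve C) C (\<lambda>n x. x)"

definition alpha_sing :: "'a ocat \<Rightarrow> 'a hochmor" where
  "alpha_sing C = fmap gamma_Ch (kappa (nerve C)) (lam C) (alpha_sing_map C)"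

definition is_comparison_map ::
    "('a ocat, 'a homor, 'a chains chcx, 'a hochmor) fun_data \<Rightarrow>
     ('a ocat, 'a homor, 'a ocat, 'a homor) fun_data \<Rightarrow>
     ('a ocat, 'a homor, 'a chains chcx, 'a hochmor) fun_data \<Rightarrow>
     ('a ocat \<Rightarrow> 'a hochmor) \<Rightarrow> ('a ocat \<Rightarrow> 'a hochmor) \<Rightarrow> bool" where
  "is_comparison_map Hsing J Hpol \<alpha>pol \<pi> \<longleftrightarrow>
     nat_trans ho_folk ho_Ch (Hsing \<odot> J) Hpol \<pi> \<and>
     factors_through omega_Cat ho_Ch gamma_folk (gamma_Ch \<odot> Lam) Hpol \<alpha>pol
       (Hsing \<odot> J) alpha_sing \<pi>"

end

theory Submission
  imports Defs
begin

text \<open>The comparison \<open>\<alpha>\<^sup>s\<^sup>i\<^sup>n\<^sup>g : \<kappa>(N C) \<rightarrow> \<lambda>(C)\<close> is an isomorphism on \<open>H\<^sub>0\<close> and \<open>H\<^sub>1\<close> for every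
  \<open>C\<close>, cofibrant or not: 0- and 1-simplices of the nerve are the 0- and 1-cells of \<open>C\<close>, and a 2-simplex
  is a 2-cell from a 1-cell to a composite of two 1-cells, so that the 2-simplices impose on 1-cycles the
  same relations as the compositions and the 2-cells do in \<open>\<lambda>(C)\<close>. Since
  \<open>\<alpha>\<^sup>s\<^sup>i\<^sup>n\<^sup>g = \<alpha>\<^sup>p\<^sup>o\<^sup>l \<circ> \<pi>\<close>, the map \<open>\<pi>\<close> is injective on \<open>H\<^sub>0\<close> and \<open>H\<^sub>1\<close>, and surjectivity follows
  from the uniqueness part of the universal property of \<open>\<alpha>\<^sup>p\<^sup>o\<^sup>l\<close>, tested on free complexes concentrated
  in one degree. No cofibrant replacement is used.\<close>

section \<open>Localizations\<close>

text \<open>Surjectivity of \<pi> means that the endomorphism of \<open>H_k(Hpol X)\<close> obtained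
  by applying \<alpha>pol, inverting \<alpha>sing and applying \<pi> is the identity. The obstacle
  is that this endomorphism exists on homology groups only, while the uniqueness clause concerns
  transformations with values in \<open>ho_Ch\<close>. The remedy is a functor X |-> T X on the
  localization such that arrows from T X to a complex Y are arbitrary families of classes in H_k(Y)
  indexed by the set \<open>H_k(Hpol X)\<close>; a natural map of these sets then becomes a
  transformation in \<open>ho_Ch\<close>. The free group on that set has to be coded in the type of
  chains, which is why the cells are taken in an infinite type. That \<lambda>(C) and \<kappa>(N C)
  are complexes and that \<alpha>sing is a chain map is read off from the universal properties: an
  arrow of the localization is a nonempty class, so a forward step that represents one is a genuine
  arrow.\<close>

definition composition_closed :: "('o, 'm) cat_data \<Rightarrow> bool" where
  "composition_closed A \<longleftrightarrow>
     (\<forall>X\<in>Ob A. Ident A X \<in> Hom A X X) \<and>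
     (\<forall>X\<in>Ob A. \<forall>Y\<in>Ob A. \<forall>Z\<in>Ob A. \<forall>f\<in>Hom A X Y. \<forall>g\<in>Hom A Y Z. Comp A X Y Z g f \<in> Hom A X Z)"

lemma zigzag_Ob: "zigzag A W X zs Y \<Longrightarrow> X \<in> Ob A \<and> Y \<in> Ob A"
  by (induction rule: zigzag.induct) auto

lemma zigzag_append: "zigzag A W X zs Y \<Longrightarrow> zigzag A W Y ws Z \<Longrightarrow> zigzag A W X (zs @ ws) Z"
  by (induction rule: zigzag.induct) (auto intro: zigzag.intros)

lemma zigzag_Fwd_iff:
  "zigzag A W X [Fwd X f Y] Y \<longleftrightarrow> X \<in> Ob A \<and> Y \<in> Ob A \<and> f \<in> Hom A X Y"
proof
  assume "zigzag A W X [Fwd X f Y] Y"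
  then show "X \<in> Ob A \<and> Y \<in> Ob A \<and> f \<in> Hom A X Y"
    by (cases rule: zigzag.cases) (auto dest: zigzag_Ob)
qed (auto intro: zigzag.intros)

lemma zigzag_Bwd:
  "X \<in> Ob A \<Longrightarrow> Y \<in> Ob A \<Longrightarrow> w \<in> Hom A Y X \<Longrightarrow> W Y X w \<Longrightarrow> zigzag A W X [Bwd X w Y] Y"
  by (auto intro: zigzag.intros)

text \<open>The generating equations are typed by their own premises, except that
  \<open>zz_ident\<close> and \<open>zz_comp\<close> create a step carrying an identity or a
  composite; closure of the homs under these is what \<open>composition_closed\<close> supplies. It
  lets a zigzag be recovered from mere membership in a class.\<close>

lemma zz_eq_zigzag:
  assumes "composition_closed A" "zz_eq A W X Y zs ws"
  shows "zigzag A W X zs Y \<and> zigzag A W X ws Y"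
  using assms(2)
proof (induction rule: zz_eq.induct)
  case (zz_ident X)
  then show ?case
    using assms(1) by (auto simp: composition_closed_def intro!: zigzag.intros)
next
  case (zz_comp X Y Z f g)
  then show ?case
    using assms(1) by (auto simp: composition_closed_def intro!: zigzag.intros)
next
  case (zz_inv1 X Y w)
  then show ?case by (auto intro!: zigzag.intros)
next
  case (zz_inv2 X Y w)
  then show ?case by (auto intro!: zigzag.intros)
qed (auto intro: zigzag_append)

lemma zz_class_eqI: "zz_eq A W X Y zs ws \<Longrightarrow> zz_class A W X Y zs = zz_class A W X Y ws"
  unfolding zz_class_def by (auto intro: zz_sym zz_trans)

lemma zz_class_self: "zigzag A W X zs Y \<Longrightarrow> zs \<in> zz_class A W X Y zs"
  by (simp add: zz_class_def zz_refl)

lemma zigzag_of_mem_zz_class: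
  "composition_closed A \<Longrightarrow> ws \<in> zz_class A W X Y zs \<Longrightarrow> zigzag A W X zs Y"
  by (simp add: zz_class_def zz_eq_zigzag)

lemma localization_sel [simp]:
  "Ob (localization A W) = Ob A"
  "Hom (localization A W) X Y = {zz_class A W X Y zs | zs. zigzag A W X zs Y}"
  "Ident (localization A W) X = zz_class A W X X []"
  by (simp_all add: localization_def)

lemma loc_functor_sel [simp]:
  "fob (loc_functor A W) X = X"
  "fmap (loc_functor A W) X Y f = zz_class A W X Y [Fwd X f Y]"
  by (simp_all add: loc_functor_def)

lemma fun_comp_sel [simp]:
  "fob (G \<odot> F) X = fob G (fob F X)"
  "fmap (G \<odot> F) X Y f = fmap G (fob F X) (fob F Y) (fmap F X Y f)"
  by (simp_all add: fun_comp_def)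

lemma Comp_localization:
  assumes "zigzag A W X zs Y" "zigzag A W Y ws Z"
  shows "Comp (localization A W) X Y Z (zz_class A W Y Z ws) (zz_class A W X Y zs)
       = zz_class A W X Z (zs @ ws)"
proof -
  have "zz_eq A W X Z (zs @ ws) vs"
    if "zz_eq A W X Y zs zs'" "zz_eq A W Y Z ws ws'" "zz_eq A W X Z (zs' @ ws') vs" for zs' ws' vs
    using that by (blast intro: zz_trans zz_append)
  then show ?thesis
    using assms by (auto simp: localization_def zz_class_def intro: zz_refl)
qed

lemma localization_Comp_closed:
  assumes "a \<in> Hom (localization A W) X Y" "b \<in> Hom (localization A W) Y Z"
  shows "Comp (localization A W) X Y Z b a \<in> Hom (localization A W) X Z"
proof -
  obtain zs ws where "zigzag A W X zs Y" "zigzag A W Y ws Z"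
    "a = zz_class A W X Y zs" "b = zz_class A W Y Z ws"
    using assms by auto
  then show ?thesis
    using Comp_localization[of A W X zs Y ws Z] zigzag_append by fastforce
qed

lemma Fwd_in_localization:
  "X \<in> Ob A \<Longrightarrow> Y \<in> Ob A \<Longrightarrow> f \<in> Hom A X Y \<Longrightarrow>
   zz_class A W X Y [Fwd X f Y] \<in> Hom (localization A W) X Y"
  by (auto simp: zigzag_Fwd_iff)

text \<open>The class of a list of steps that is not a zigzag is empty.\<close>

lemma Hom_of_Fwd_in_localization:
  assumes "composition_closed A" "zz_class A W X Y [Fwd X f Y] \<in> Hom (localization A W) X Y"
  shows "X \<in> Ob A" "Y \<in> Ob A" "f \<in> Hom A X Y"
proof -
  obtain zs where "zigzag A W X zs Y" "zz_class A W X Y [Fwd X f Y] = zz_class A W X Y zs"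
    using assms(2) by auto
  then have "zs \<in> zz_class A W X Y [Fwd X f Y]"
    by (simp add: zz_class_self)
  then have "zigzag A W X [Fwd X f Y] Y"
    using assms(1) zigzag_of_mem_zz_class by metis
  then show "X \<in> Ob A" "Y \<in> Ob A" "f \<in> Hom A X Y"
    by (auto simp: zigzag_Fwd_iff)
qed

text \<open>A backward step represents the two-sided inverse of the class of its forward arrow.
  Hence a property of arrows of the localization needs checking only on ordinary arrows, provided
  that it is stable under composition and under passing to an inverse; naturality of a family of
  maps is of this kind.\<close>

lemma localization_induct [consumes 1, case_names Fwd Ident Comp Inv]:
  assumes a: "a \<in> Hom (localization A W) X Y"
    and Fwd: "\<And>X Y f. X \<in> Ob A \<Longrightarrow> Y \<in> Ob A \<Longrightarrow> f \<in> Hom A X Y \<Longrightarrow>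
      P X Y (zz_class A W X Y [Fwd X f Y])"
    and Id: "\<And>X. X \<in> Ob A \<Longrightarrow> P X X (Ident (localization A W) X)"
    and Comp: "\<And>X Y Z a b. X \<in> Ob A \<Longrightarrow> Y \<in> Ob A \<Longrightarrow> Z \<in> Ob A \<Longrightarrow>
      a \<in> Hom (localization A W) X Y \<Longrightarrow> b \<in> Hom (localization A W) Y Z \<Longrightarrow>
      P X Y a \<Longrightarrow> P Y Z b \<Longrightarrow> P X Z (Comp (localization A W) X Y Z b a)"
    and Inv: "\<And>X Y a b. X \<in> Ob A \<Longrightarrow> Y \<in> Ob A \<Longrightarrow>
      a \<in> Hom (localization A W) X Y \<Longrightarrow> b \<in> Hom (localization A W) Y X \<Longrightarrow>
      Comp (localization A W) X Y X b a = Ident (localization A W) X \<Longrightarrow>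
      Comp (localization A W) Y X Y a b = Ident (localization A W) Y \<Longrightarrow>
      P X Y a \<Longrightarrow> P Y X b"
  shows "P X Y a"
proof -
  obtain zs where "zigzag A W X zs Y" and a_eq: "a = zz_class A W X Y zs"
    using a by auto
  from \<open>zigzag A W X zs Y\<close> have "P X Y (zz_class A W X Y zs)"
  proof (induction rule: zigzag.induct)
    case (zz_nil X)
    then show ?case using Id by simp
  next
    case (zz_fwd X f Y zs Z)
    then have Ob: "Y \<in> Ob A" "Z \<in> Ob A" by (auto dest: zigzag_Ob)
    have z: "zigzag A W X [Fwd X f Y] Y" using zz_fwd Ob by (simp add: zigzag_Fwd_iff)
    have "P X Z (Comp (localization A W) X Y Z (zz_class A W Y Z zs) (zz_class A W X Y [Fwd X f Y]))"
      by (rule Comp) (use zz_fwd Ob z Fwd in auto)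
    then show ?case using Comp_localization[OF z zz_fwd(3)] by simp
  next
    case (zz_bwd X w Y zs Z)
    then have Ob: "Y \<in> Ob A" "Z \<in> Ob A" by (auto dest: zigzag_Ob)
    have z: "zigzag A W X [Bwd X w Y] Y" and z': "zigzag A W Y [Fwd Y w X] X"
      using zz_bwd Ob by (auto intro!: zigzag_Bwd simp: zigzag_Fwd_iff)
    have "P X Y (zz_class A W X Y [Bwd X w Y])"
    proof (rule Inv[of Y X "zz_class A W Y X [Fwd Y w X]"])
      show "Comp (localization A W) Y X Y (zz_class A W X Y [Bwd X w Y]) (zz_class A W Y X [Fwd Y w X])
          = Ident (localization A W) Y"
        using Comp_localization[OF z' z] zz_bwd Ob by (auto intro!: zz_class_eqI zz_inv1)
      show "Comp (localization A W) X Y X (zz_class A W Y X [Fwd Y w X]) (zz_class A W X Y [Bwd X w Y])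
          = Ident (localization A W) X"
        using Comp_localization[OF z z'] zz_bwd Ob by (auto intro!: zz_class_eqI zz_inv2)
    qed (use zz_bwd Ob z z' Fwd in auto)
    then have "P X Z (Comp (localization A W) X Y Z (zz_class A W Y Z zs) (zz_class A W X Y [Bwd X w Y]))"
      by (intro Comp) (use zz_bwd Ob z in auto)
    then show ?case using Comp_localization[OF z zz_bwd(4)] by simp
  qed
  then show ?thesis by (simp add: a_eq)
qed


section \<open>Homology\<close>

definition hclass :: "'e chcx \<Rightarrow> nat \<Rightarrow> 'e \<Rightarrow> 'e set" where
  "hclass K k z = boundaries K k #>\<^bsub>cgrp K k\<^esub> z"

lemma chain_complexD:
  assumes "chain_complex K"
  shows "comm_group (cgrp K n)" "group (cgrp K n)" "cdiff K n \<in> hom (cgrp K (Suc n)) (cgrp K n)"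
    "x \<in> carrier (cgrp K (Suc (Suc n))) \<Longrightarrow> cdiff K n (cdiff K (Suc n) x) = \<one>\<^bsub>cgrp K n\<^esub>"
    "x \<in> carrier (cgrp K (Suc n)) \<Longrightarrow> cdiff K n x \<in> carrier (cgrp K n)"
  using assms by (auto simp: chain_complex_def comm_group_def hom_def)

lemma cdiff_group_hom: "chain_complex K \<Longrightarrow> group_hom (cgrp K (Suc n)) (cgrp K n) (cdiff K n)"
  by (simp add: group_hom_def group_hom_axioms_def chain_complexD)

lemma chain_map_group_hom:
  "chain_complex K \<Longrightarrow> chain_complex L \<Longrightarrow> chain_map K L f \<Longrightarrow> group_hom (cgrp K n) (cgrp L n) (f n)"
  by (simp add: group_hom_def group_hom_axioms_def chain_complexD chain_map_def)

lemma cycles_carrier: "z \<in> cycles K k \<Longrightarrow> z \<in> carrier (cgrp K k)"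
  by (simp add: cycles_def)

lemma subgroup_cycles:
  assumes "chain_complex K" shows "subgroup (cycles K k) (cgrp K k)"
proof (cases k)
  case 0
  then have "cycles K k = carrier (cgrp K k)" by (auto simp: cycles_def)
  then show ?thesis
    using assms by (simp add: chain_complexD group.subgroup_self)
next
  case (Suc m)
  interpret group_hom "cgrp K (Suc m)" "cgrp K m" "cdiff K m"
    using assms by (rule cdiff_group_hom)
  have "cycles K k = kernel (cgrp K (Suc m)) (cgrp K m) (cdiff K m)"
    by (auto simp: cycles_def Suc kernel_def)
  then show ?thesis using subgroup_kernel Suc by simp
qed

lemma subgroup_boundaries:
  assumes "chain_complex K" shows "subgroup (boundaries K k) (cgrp K k)"
  unfolding boundaries_def
  using group_hom.img_is_subgroup[OF cdiff_group_hom[OF assms]] .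

lemma boundaries_subset_cycles:
  "chain_complex K \<Longrightarrow> boundaries K k \<subseteq> cycles K k"
  by (auto simp: boundaries_def cycles_def chain_complexD)

lemma cycles_comm_group:
  assumes "chain_complex K" shows "comm_group ((cgrp K k)\<lparr>carrier := cycles K k\<rparr>)"
proof -
  interpret comm_group "cgrp K k" using assms by (rule chain_complexD)
  interpret sub: group "(cgrp K k)\<lparr>carrier := cycles K k\<rparr>"
    using subgroup_cycles[OF assms] subgroup_imp_group by blast
  show ?thesis
    by unfold_locales (simp add: cycles_carrier m_comm)
qed

lemma boundaries_subgroup_cycles:
  assumes "chain_complex K"
  shows "subgroup (boundaries K k) ((cgrp K k)\<lparr>carrier := cycles K k\<rparr>)"
  using assms group.subgroup_incl[OF chain_complexD(2) subgroup_boundaries subgroup_cycles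
      boundaries_subset_cycles] by blast

lemma homology_comm_group: "chain_complex K \<Longrightarrow> comm_group (homology k K)"
  unfolding homology_def
  by (intro comm_group.abelian_FactGroup cycles_comm_group boundaries_subgroup_cycles)

lemma homology_group: "chain_complex K \<Longrightarrow> group (homology k K)"
  using homology_comm_group comm_group_def by blast

lemma carrier_homology: "carrier (homology k K) = hclass K k ` cycles K k"
  by (simp add: homology_def carrier_FactGroup hclass_def r_coset_def)

lemma hclass_mult:
  assumes "chain_complex K" "a \<in> cycles K k" "b \<in> cycles K k"
  shows "hclass K k a \<otimes>\<^bsub>homology k K\<^esub> hclass K k b = hclass K k (a \<otimes>\<^bsub>cgrp K k\<^esub> b)"
proof -
  interpret normal "boundaries K k" "(cgrp K k)\<lparr>carrier := cycles K k\<rparr>"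
    using comm_group.subgroup_imp_normal[OF cycles_comm_group boundaries_subgroup_cycles] assms(1)
    by blast
  show ?thesis
    using rcos_sum[of a b] assms by (simp add: homology_def hclass_def r_coset_def set_mult_def)
qed

lemma hclass_self:
  assumes "chain_complex K" "z \<in> cycles K k" shows "z \<in> hclass K k z"
  unfolding hclass_def
  using group.rcos_self[OF chain_complexD(2) cycles_carrier subgroup_boundaries] assms by metis

lemma hclass_subset_cycles:
  assumes "chain_complex K" "z \<in> cycles K k" shows "hclass K k z \<subseteq> cycles K k"
  using assms boundaries_subset_cycles[OF assms(1), of k] subgroup.m_closed[OF subgroup_cycles]
  by (fastforce simp: hclass_def r_coset_def)

lemma hclass_eqI:
  assumes "chain_complex K" "z \<in> cycles K k" "z' \<in> hclass K k z"
  shows "hclass K k z' = hclass K k z"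
  using group.repr_independence[OF chain_complexD(2) _ cycles_carrier subgroup_boundaries] assms
  unfolding hclass_def by metis

lemma hclass_eq_iff:
  assumes "chain_complex K" "a \<in> cycles K k" "b \<in> cycles K k"
  shows "hclass K k a = hclass K k b \<longleftrightarrow>
    (\<exists>w\<in>carrier (cgrp K (Suc k)). a = cdiff K k w \<otimes>\<^bsub>cgrp K k\<^esub> b)"
proof -
  have "hclass K k a = hclass K k b \<longleftrightarrow> a \<in> hclass K k b"
    using assms hclass_eqI hclass_self by metis
  then show ?thesis by (auto simp: hclass_def r_coset_def boundaries_def)
qed

lemma hclass_eq_one_iff:
  assumes "chain_complex K" "a \<in> cycles K k"
  shows "hclass K k a = \<one>\<^bsub>homology k K\<^esub> \<longleftrightarrow> a \<in> boundaries K k"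
proof -
  have "hclass K k a = boundaries K k \<longleftrightarrow> a \<in> boundaries K k"
    using assms group.coset_join2[OF chain_complexD(2) cycles_carrier subgroup_boundaries]
      hclass_self[OF assms] unfolding hclass_def by metis
  then show ?thesis by (simp add: homology_def)
qed

lemma homology_repr:
  assumes "chain_complex K" "h \<in> carrier (homology k K)"
  shows "(SOME z. z \<in> h) \<in> cycles K k" "hclass K k (SOME z. z \<in> h) = h"
proof -
  obtain z where z: "z \<in> cycles K k" "h = hclass K k z"
    using assms by (auto simp: carrier_homology)
  have "(SOME z. z \<in> h) \<in> h"
    using hclass_self[OF assms(1) z(1)] z(2) by (metis someI)
  then show "(SOME z. z \<in> h) \<in> cycles K k" "hclass K k (SOME z. z \<in> h) = h"
    using hclass_subset_cycles[OF assms(1) z(1)] hclass_eqI[OF assms(1) z(1)] z(2) by auto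
qed

lemma chain_map_carrier:
  "chain_map K L f \<Longrightarrow> x \<in> carrier (cgrp K n) \<Longrightarrow> f n x \<in> carrier (cgrp L n)"
  by (auto simp: chain_map_def hom_def)

lemma chain_map_cycles:
  assumes "chain_complex K" "chain_complex L" "chain_map K L f" "z \<in> cycles K k"
  shows "f k z \<in> cycles L k"
proof (cases k)
  case 0
  then show ?thesis using assms by (simp add: cycles_def chain_map_carrier)
next
  case (Suc m)
  then have "z \<in> carrier (cgrp K (Suc m))" "cdiff K m z = \<one>\<^bsub>cgrp K m\<^esub>"
    using assms(4) by (auto simp: cycles_def)
  then have "cdiff L m (f k z) = f m \<one>\<^bsub>cgrp K m\<^esub>"
    using assms(3) Suc unfolding chain_map_def by metis
  also have "\<dots> = \<one>\<^bsub>cgrp L m\<^esub>"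
    using group_hom.hom_one[OF chain_map_group_hom[OF assms(1-3)]] .
  finally show ?thesis
    using assms Suc by (simp add: cycles_def chain_map_carrier)
qed

text \<open>\<open>homology_map\<close> is the \<open>the_elem\<close> of an image. The image is a
  singleton because two representatives differ by a boundary, and f sends boundaries to
  boundaries.\<close>

lemma homology_map_hclass:
  assumes "chain_complex K" "chain_complex L" "chain_map K L f" "z \<in> cycles K k"
  shows "homology_map k K L f (hclass K k z) = hclass L k (f k z)"
proof -
  have "hclass L k (f k z') = hclass L k (f k z)" if z': "z' \<in> hclass K k z" for z'
  proof -
    have "hclass K k z' = hclass K k z" "z' \<in> cycles K k"
      using hclass_eqI[OF assms(1,4) z'] hclass_subset_cycles[OF assms(1,4)] z' by auto
    then obtain w where w: "w \<in> carrier (cgrp K (Suc k))" "z' = cdiff K k w \<otimes>\<^bsub>cgrp K k\<^esub> z"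
      using hclass_eq_iff assms by metis
    have "f k z' = f k (cdiff K k w) \<otimes>\<^bsub>cgrp L k\<^esub> f k z"
      unfolding w(2)
      using group_hom.hom_mult[OF chain_map_group_hom[OF assms(1-3)]]
        chain_complexD(5)[OF assms(1) w(1)] cycles_carrier[OF assms(4)] by blast
    also have "f k (cdiff K k w) = cdiff L k (f (Suc k) w)"
      using assms(3) w(1) by (simp add: chain_map_def)
    finally show ?thesis
      using hclass_eq_iff[OF assms(2) chain_map_cycles[OF assms(1-3) \<open>z' \<in> cycles K k\<close>]
          chain_map_cycles[OF assms]] chain_map_carrier[OF assms(3) w(1)] by blast
  qed
  then have "(\<lambda>a. hclass L k (f k a)) ` hclass K k z = {hclass L k (f k z)}"
    using hclass_self[OF assms(1,4)] by (intro equalityI subsetI) (blast, blast)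
  then show ?thesis by (simp add: homology_map_def hclass_def)
qed

lemma homology_map_hom:
  assumes "chain_complex K" "chain_complex L" "chain_map K L f"
  shows "homology_map k K L f \<in> hom (homology k K) (homology k L)"
proof (rule homI)
  fix x assume "x \<in> carrier (homology k K)"
  then show "homology_map k K L f x \<in> carrier (homology k L)"
    using assms by (auto simp: carrier_homology homology_map_hclass chain_map_cycles)
next
  fix x y assume "x \<in> carrier (homology k K)" "y \<in> carrier (homology k K)"
  then obtain a b where ab: "a \<in> cycles K k" "b \<in> cycles K k" "x = hclass K k a" "y = hclass K k b"
    by (auto simp: carrier_homology)
  then show "homology_map k K L f (x \<otimes>\<^bsub>homology k K\<^esub> y)
      = homology_map k K L f x \<otimes>\<^bsub>homology k L\<^esub> homology_map k K L f y"
    using assms group_hom.hom_mult[OF chain_map_group_hom[OF assms]]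
    by (simp add: hclass_mult homology_map_hclass chain_map_cycles cycles_carrier
        subgroup.m_closed[OF subgroup_cycles])
qed

lemma Ch_sel [simp]:
  "Ob Ch = {K. chain_complex K}" "Hom Ch K L = {f. chain_map K L f}"
  "Ident Ch K = (\<lambda>n. restrict id (carrier (cgrp K n)))"
  "Comp Ch K L M g f = (\<lambda>n. compose (carrier (cgrp K n)) (g n) (f n))"
  by (simp_all add: Ch_def)

lemma chain_map_id: "chain_complex K \<Longrightarrow> chain_map K K (\<lambda>n. restrict id (carrier (cgrp K n)))"
  by (auto simp: chain_map_def chain_complexD(2,5) hom_def group.is_monoid monoid.m_closed)

lemma chain_map_compose:
  assumes "chain_complex K" "chain_map K L f" "chain_map L M g"
  shows "chain_map K M (\<lambda>n. compose (carrier (cgrp K n)) (g n) (f n))"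
  using assms chain_map_carrier[OF assms(2)] chain_map_carrier[OF assms(3)] chain_complexD(2,5)[OF assms(1)]
  unfolding chain_map_def by (auto simp: compose_eq hom_def group.is_monoid monoid.m_closed)

lemma Ch_composition_closed: "composition_closed Ch"
  by (simp add: composition_closed_def chain_map_id chain_map_compose)

section \<open>Homology of zigzags of chain complexes\<close>

lemma step_homology_hom:
  assumes "zigzag Ch quasi_iso X [s] Y"
  shows "step_homology k s \<in> hom (homology k X) (homology k Y)"
  using assms
proof (cases rule: zigzag.cases)
  case (zz_fwd f Y')
  then have "Y' = Y" "chain_complex Y" by (auto elim: zigzag.cases dest: zigzag_Ob)
  then show ?thesis using zz_fwd by (simp add: homology_map_hom)
next
  case (zz_bwd w Y')
  then have Y: "Y' = Y" "chain_complex Y" by (auto elim: zigzag.cases dest: zigzag_Ob)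
  then have "homology_map k Y X w \<in> iso (homology k Y) (homology k X)"
    using zz_bwd by (simp add: quasi_iso_def)
  then have "inv_into (carrier (homology k Y)) (homology_map k Y X w) \<in> iso (homology k X) (homology k Y)"
    using group.iso_set_sym homology_group Y by blast
  then show ?thesis using zz_bwd Y by (simp add: iso_def)
qed

lemma zigzag_Cons:
  assumes "zigzag A W X (s # zs) Z"
  obtains Y where "zigzag A W X [s] Y" "zigzag A W Y zs Z"
  using assms
proof (cases rule: zigzag.cases)
  case (zz_fwd f Y)
  then show thesis using that[of Y] zigzag_Ob[OF zz_fwd(4)] by (simp add: zigzag_Fwd_iff)
next
  case (zz_bwd w Y)
  then show thesis using that[of Y] zigzag_Ob[OF zz_bwd(5)] by (simp add: zigzag_Bwd)
qed

lemma zz_homology_append: "zz_homology k (zs @ ws) = zz_homology k ws \<circ> zz_homology k zs"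
  by (induction zs) (auto simp: fun_eq_iff)

lemma zz_homology_hom:
  "zigzag Ch quasi_iso X zs Y \<Longrightarrow> zz_homology k zs \<in> hom (homology k X) (homology k Y)"
proof (induction zs arbitrary: X)
  case Nil
  then show ?case by (auto elim: zigzag.cases simp: hom_def)
next
  case (Cons s zs)
  obtain X' where X': "zigzag Ch quasi_iso X [s] X'" "zigzag Ch quasi_iso X' zs Y"
    using Cons.prems by (rule zigzag_Cons)
  show ?case
    using hom_compose[OF step_homology_hom[OF X'(1)] Cons.IH[OF X'(2)]] by (simp add: comp_def)
qed

text \<open>Equality can be asked on the carrier only, because \<open>inv_into\<close> inverts a
  homology map only there. This is why the case of concatenation first checks that the image under
  the first zigzag is again a homology class.\<close>

lemma zz_eq_homology:
  assumes "zz_eq Ch quasi_iso X Y zs ws" "h \<in> carrier (homology k X)"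
  shows "zz_homology k zs h = zz_homology k ws h"
  using assms
proof (induction arbitrary: h rule: zz_eq.induct)
  case (zz_append X Y zs zs' Z ws ws')
  have "zigzag Ch quasi_iso X zs Y"
    using zz_append zz_eq_zigzag Ch_composition_closed by metis
  then have "zz_homology k zs h \<in> carrier (homology k Y)"
    using zz_homology_hom zz_append.prems by (metis hom_in_carrier)
  then show ?case
    using zz_append by (simp add: zz_homology_append)
next
  case (zz_ident X)
  then obtain z where "z \<in> cycles X k" "h = hclass X k z" by (auto simp: carrier_homology)
  then show ?case
    using zz_ident by (simp add: homology_map_hclass chain_map_id cycles_carrier)
next
  case (zz_comp X Y Z f g)
  then obtain z where "z \<in> cycles X k" "h = hclass X k z" by (auto simp: carrier_homology)
  then show ?case
    using zz_comp chain_map_compose[of X Y f Z g]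
    by (simp add: homology_map_hclass cycles_carrier chain_map_cycles compose_eq)
next
  case (zz_inv1 X Y w)
  then have "homology_map k X Y w \<in> iso (homology k X) (homology k Y)"
    by (simp add: quasi_iso_def)
  then show ?case
    using zz_inv1.prems by (simp add: iso_def bij_betw_def)
next
  case (zz_inv2 X Y w)
  then have "homology_map k X Y w \<in> iso (homology k X) (homology k Y)"
    by (simp add: quasi_iso_def)
  then have "h \<in> homology_map k X Y w ` carrier (homology k X)"
    using zz_inv2.prems by (simp add: iso_def bij_betw_def)
  then show ?case
    by (simp add: f_inv_into_f)
qed auto

lemma ho_homology_zz_class:
  assumes "zigzag Ch quasi_iso X zs Y" "h \<in> carrier (homology k X)"
  shows "ho_homology k (zz_class Ch quasi_iso X Y zs) h = zz_homology k zs h"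
proof -
  have "(SOME ws. ws \<in> zz_class Ch quasi_iso X Y zs) \<in> zz_class Ch quasi_iso X Y zs"
    using zz_class_self[OF assms(1)] by (rule someI)
  then show ?thesis
    using assms(2) zz_eq_homology unfolding ho_homology_def zz_class_def by fastforce
qed

lemma ho_homology_closed:
  assumes "\<phi> \<in> Hom ho_Ch X Y" "h \<in> carrier (homology k X)"
  shows "ho_homology k \<phi> h \<in> carrier (homology k Y)"
proof -
  obtain zs where "zigzag Ch quasi_iso X zs Y" "\<phi> = zz_class Ch quasi_iso X Y zs"
    using assms(1) by (auto simp: ho_Ch_def)
  then show ?thesis
    using assms(2) zz_homology_hom by (metis ho_homology_zz_class hom_in_carrier)
qed

lemma ho_homology_hom:
  assumes "chain_complex X" "\<phi> \<in> Hom ho_Ch X Y"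
  shows "ho_homology k \<phi> \<in> hom (homology k X) (homology k Y)"
proof -
  obtain zs where zs: "zigzag Ch quasi_iso X zs Y" "\<phi> = zz_class Ch quasi_iso X Y zs"
    using assms(2) by (auto simp: ho_Ch_def)
  show ?thesis
  proof (rule homI)
    fix x y assume "x \<in> carrier (homology k X)" "y \<in> carrier (homology k X)"
    then show "ho_homology k \<phi> (x \<otimes>\<^bsub>homology k X\<^esub> y)
        = ho_homology k \<phi> x \<otimes>\<^bsub>homology k Y\<^esub> ho_homology k \<phi> y"
      using zs hom_mult[OF zz_homology_hom[OF zs(1), of k]] homology_group[OF assms(1), of k]
      by (simp add: ho_homology_zz_class group.is_monoid monoid.m_closed)
  qed (use ho_homology_closed[OF assms(2)] in auto)
qed

lemma ho_homology_Comp: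
  assumes "a \<in> Hom ho_Ch X Y" "b \<in> Hom ho_Ch Y Z" "h \<in> carrier (homology k X)"
  shows "ho_homology k (Comp ho_Ch X Y Z b a) h = ho_homology k b (ho_homology k a h)"
proof -
  obtain zs ws where z: "zigzag Ch quasi_iso X zs Y" "a = zz_class Ch quasi_iso X Y zs"
    "zigzag Ch quasi_iso Y ws Z" "b = zz_class Ch quasi_iso Y Z ws"
    using assms(1,2) by (auto simp: ho_Ch_def)
  moreover have "zz_homology k zs h \<in> carrier (homology k Y)"
    using z zz_homology_hom assms(3) by (metis hom_in_carrier)
  ultimately show ?thesis
    using assms(3)
    by (simp add: ho_Ch_def Comp_localization ho_homology_zz_class zigzag_append zz_homology_append)
qed

lemma ho_homology_Ident:
  assumes "chain_complex X" "h \<in> carrier (homology k X)"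
  shows "ho_homology k (Ident ho_Ch X) h = h"
  using assms by (simp add: ho_Ch_def ho_homology_zz_class zz_nil)

lemma ho_homology_gamma_Ch:
  assumes "chain_complex X" "chain_complex Y" "chain_map X Y f" "h \<in> carrier (homology k X)"
  shows "ho_homology k (fmap gamma_Ch X Y f) h = homology_map k X Y f h"
  using assms by (simp add: gamma_Ch_def ho_homology_zz_class zigzag_Fwd_iff)

lemma gamma_Ch_Hom:
  "chain_complex X \<Longrightarrow> chain_complex Y \<Longrightarrow> chain_map X Y f \<Longrightarrow> fmap gamma_Ch X Y f \<in> Hom ho_Ch X Y"
  by (auto simp: gamma_Ch_def ho_Ch_def zigzag_Fwd_iff)

section \<open>Free complexes concentrated in one degree\<close>

text \<open>All groups of a \<open>chcx\<close> share one element type. An injection j of the type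
  of G into that type transports products and free groups there.\<close>

definition coded_group :: "('b \<Rightarrow> 'e) \<Rightarrow> 'b monoid \<Rightarrow> 'e monoid" where
  "coded_group j G =
     \<lparr> carrier = j ` carrier G, mult = (\<lambda>x y. j (inv_into UNIV j x \<otimes>\<^bsub>G\<^esub> inv_into UNIV j y)), one = j \<one>\<^bsub>G\<^esub> \<rparr>"

lemma coded_group_sel [simp]:
  "carrier (coded_group j G) = j ` carrier G"
  "\<one>\<^bsub>coded_group j G\<^esub> = j \<one>\<^bsub>G\<^esub>"
  "inj j \<Longrightarrow> j a \<otimes>\<^bsub>coded_group j G\<^esub> j b = j (a \<otimes>\<^bsub>G\<^esub> b)"
  by (simp_all add: coded_group_def)

lemma comm_group_coded_group:
  assumes "inj j" "comm_group G" shows "comm_group (coded_group j G)"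
proof -
  interpret comm_group G by fact
  show ?thesis
    using assms(1) by (intro comm_groupI) (auto simp: m_ac, metis inv_closed r_inv)
qed

definition concentrated :: "nat \<Rightarrow> 'e monoid \<Rightarrow> 'e chcx" where
  "concentrated k M =
     \<lparr> cgrp = (\<lambda>n. if n = k then M else M\<lparr>carrier := {\<one>\<^bsub>M\<^esub>}\<rparr>), cdiff = (\<lambda>n x. \<one>\<^bsub>M\<^esub>) \<rparr>"

text \<open>The tensor product of M in degree k with the interval, in adapted coordinates. In the
  usual basis the differential is x |-> (-x, x) and the ends are (x, 0) and (0, x); after (a, b) |->
  (a + b, b) the differential is x |-> (0, x), the ends are (x, 0) and (x, x), and the projection is
  the first coordinate. The function c codes pairs in the type of M.\<close>

definition cylinder :: "('e \<times> 'e \<Rightarrow> 'e) \<Rightarrow> nat \<Rightarrow> 'e monoid \<Rightarrow> 'e chcx" where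
  "cylinder c k M =
     \<lparr> cgrp = (\<lambda>n. if n = k then coded_group c (M \<times>\<times> M) else if n = Suc k then M
                   else M\<lparr>carrier := {\<one>\<^bsub>M\<^esub>}\<rparr>),
       cdiff = (\<lambda>n x. if n = k then c (\<one>\<^bsub>M\<^esub>, x) else \<one>\<^bsub>M\<^esub>) \<rparr>"

lemma concentrated_sel [simp]:
  "cgrp (concentrated k M) k = M"
  "n \<noteq> k \<Longrightarrow> cgrp (concentrated k M) n = M\<lparr>carrier := {\<one>\<^bsub>M\<^esub>}\<rparr>"
  "cdiff (concentrated k M) n x = \<one>\<^bsub>M\<^esub>"
  "\<one>\<^bsub>cgrp (concentrated k M) n\<^esub> = \<one>\<^bsub>M\<^esub>"
  by (simp_all add: concentrated_def)

lemma cylinder_sel [simp]: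
  "cgrp (cylinder c k M) k = coded_group c (M \<times>\<times> M)"
  "cgrp (cylinder c k M) (Suc k) = M"
  "n \<noteq> k \<Longrightarrow> n \<noteq> Suc k \<Longrightarrow> cgrp (cylinder c k M) n = M\<lparr>carrier := {\<one>\<^bsub>M\<^esub>}\<rparr>"
  "n \<noteq> k \<Longrightarrow> cdiff (cylinder c k M) n x = \<one>\<^bsub>M\<^esub>"
  "cdiff (cylinder c k M) k x = c (\<one>\<^bsub>M\<^esub>, x)"
  by (simp_all add: cylinder_def)

lemma comm_group_DirProd: "comm_group M \<Longrightarrow> comm_group N \<Longrightarrow> comm_group (M \<times>\<times> N)"
proof -
  assume "comm_group M" "comm_group N"
  then interpret M: comm_group M + N: comm_group N by simp_all
  interpret group "M \<times>\<times> N" by (intro DirProd_group M.is_group N.is_group)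
  show ?thesis by unfold_locales (auto simp: M.m_comm N.m_comm)
qed

lemma comm_group_trivial:
  assumes "comm_group M" shows "comm_group (M\<lparr>carrier := {\<one>\<^bsub>M\<^esub>}\<rparr>)"
proof -
  interpret comm_group M by fact
  show ?thesis by (intro comm_groupI) auto
qed

section \<open>The cylinder of a group concentrated in one degree\<close>

locale cylinder_object = comm_group M for M :: "'e monoid" (structure) +
  fixes k :: nat and c :: "'e \<times> 'e \<Rightarrow> 'e"
  assumes inj_c: "inj c"
begin

abbreviation A where "A \<equiv> concentrated k M"
abbreviation Cyl where "Cyl \<equiv> cylinder c k M"

lemma code_eq [simp]: "c p = c q \<longleftrightarrow> p = q"
  using inj_c by (simp add: inj_eq)

lemma inv_code [simp]: "inv_into UNIV c (c p) = p"
  using inj_c by simp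

lemma mult_code [simp]:
  "c (a, a') \<otimes>\<^bsub>coded_group c (M \<times>\<times> M)\<^esub> c (b, b') = c (a \<otimes> b, a' \<otimes> b')"
  using inj_c by simp

lemma cycles_A: "cycles A k = carrier M"
  by (auto simp: cycles_def)

lemma chain_complex_A: "chain_complex A"
proof -
  have "comm_group (cgrp A n)" for n
    using comm_group_trivial comm_group_axioms by (cases "n = k") auto
  moreover have "cdiff A n \<in> hom (cgrp A (Suc n)) (cgrp A n)" for n
    by (cases "n = k"; cases "Suc n = k") (auto simp: hom_def)
  ultimately show ?thesis by (simp add: chain_complex_def)
qed

lemma chain_complex_Cyl: "chain_complex Cyl"
proof -
  have "comm_group (cgrp Cyl n)" for n
    using comm_group_trivial comm_group_axioms comm_group_coded_group[OF inj_c comm_group_DirProd]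
    by (cases "n = k"; cases "n = Suc k") auto
  moreover have "cdiff Cyl n \<in> hom (cgrp Cyl (Suc n)) (cgrp Cyl n)" for n
    by (cases "n = k"; cases "n = Suc k"; cases "Suc n = k") (auto simp: hom_def)
  moreover have "cdiff Cyl n (cdiff Cyl (Suc n) x) = \<one>\<^bsub>cgrp Cyl n\<^esub>" for n x
    by (cases "n = k"; cases "n = Suc k") auto
  ultimately show ?thesis by (simp add: chain_complex_def)
qed

definition proj :: "nat \<Rightarrow> 'e \<Rightarrow> 'e" where
  "proj n = (\<lambda>x\<in>carrier (cgrp Cyl n). if n = k then fst (inv_into UNIV c x) else \<one>)"

text \<open>The parameter u treats both ends of the cylinder at once: the trivial endomorphism gives
  x |-> (x, 1), the identity gives x |-> (x, x).\<close>

definition incl :: "('e \<Rightarrow> 'e) \<Rightarrow> nat \<Rightarrow> 'e \<Rightarrow> 'e" where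
  "incl u n = (\<lambda>x\<in>carrier (cgrp A n). if n = k then c (x, u x) else \<one>)"

lemma chain_map_proj: "chain_map Cyl A proj"
proof -
  have "proj n \<in> hom (cgrp Cyl n) (cgrp A n)" for n
    by (cases "n = k"; cases "n = Suc k") (auto simp: hom_def proj_def)
  moreover have "proj n (cdiff Cyl n x) = cdiff A n (proj (Suc n) x)"
    if "x \<in> carrier (cgrp Cyl (Suc n))" for n x
    using that by (cases "n = k"; cases "n = Suc k") (auto simp: proj_def)
  ultimately show ?thesis by (auto simp: chain_map_def proj_def)
qed

lemma chain_map_incl:
  assumes "u \<in> hom M M" shows "chain_map A Cyl (incl u)"
proof -
  have u: "u x \<in> carrier M" "u (x \<otimes> y) = u x \<otimes> u y" if "x \<in> carrier M" "y \<in> carrier M" for x y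
    using assms that by (auto simp: hom_def)
  have u1: "u \<one> = \<one>" using assms hom_one is_group by blast
  have "incl u n \<in> hom (cgrp A n) (cgrp Cyl n)" for n
    using u by (cases "n = k"; cases "n = Suc k") (auto simp: hom_def incl_def)
  moreover have "incl u n (cdiff A n x) = cdiff Cyl n (incl u (Suc n) x)"
    if "x \<in> carrier (cgrp A (Suc n))" for n x
    using u1 that by (cases "n = k"; cases "Suc n = k") (auto simp: incl_def)
  ultimately show ?thesis by (auto simp: chain_map_def incl_def)
qed

lemma proj_incl:
  "u \<in> hom M M \<Longrightarrow> Comp Ch A Cyl A proj (incl u) = Ident Ch A"
proof -
  assume "u \<in> hom M M"
  then have "u x \<in> carrier M" if "x \<in> carrier M" for x using that by (auto simp: hom_def)
  then have "proj n (incl u n x) = x" if "x \<in> carrier (cgrp A n)" for n x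
    using that by (cases "n = k"; cases "n = Suc k") (auto simp: incl_def proj_def)
  then show ?thesis by (auto simp: fun_eq_iff compose_def restrict_def)
qed

lemma boundaries_A: "boundaries A n = {\<one>}"
  using chain_complexD(2)[OF chain_complex_A, of "Suc n"] group.is_monoid monoid.one_closed
  by (fastforce simp: boundaries_def)

text \<open>Surjectivity on homology comes from the section \<open>incl\<close>. For injectivity, an
  element of degree k killed by the projection is a pair (1, b), which is the boundary of b; in
  degree k + 1 the differential is injective, so there are no nontrivial cycles.\<close>

lemma quasi_iso_proj: "quasi_iso Cyl A proj"
proof -
  have "homology_map n Cyl A proj \<in> iso (homology n Cyl) (homology n A)" for n
  proof -
    have id: "(\<lambda>x. \<one>) \<in> hom M M" by (auto simp: hom_def)
    interpret h: group_hom "homology n Cyl" "homology n A" "homology_map n Cyl A proj"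
      by (simp add: group_hom_def group_hom_axioms_def homology_group chain_complex_A chain_complex_Cyl
          homology_map_hom chain_map_proj)
    have "y \<in> homology_map n Cyl A proj ` carrier (homology n Cyl)" if y: "y \<in> carrier (homology n A)" for y
    proof -
      obtain z where z: "z \<in> cycles A n" "y = hclass A n z"
        using y by (auto simp: carrier_homology)
      let ?z = "incl (\<lambda>x. \<one>) n z"
      have 1: "?z \<in> cycles Cyl n"
        using chain_map_cycles[OF chain_complex_A chain_complex_Cyl chain_map_incl[OF id] z(1)] .
      have "proj n ?z = z"
        using fun_cong[OF fun_cong[OF proj_incl[OF id], of n], of z] cycles_carrier[OF z(1)]
        by (simp add: compose_eq)
      then have "y = homology_map n Cyl A proj (hclass Cyl n ?z)"
        using 1 z by (simp add: homology_map_hclass chain_complex_A chain_complex_Cyl chain_map_proj)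
      then show ?thesis using 1 by (auto simp: carrier_homology)
    qed
    moreover have "x = \<one>\<^bsub>homology n Cyl\<^esub>"
      if x: "x \<in> carrier (homology n Cyl)" "homology_map n Cyl A proj x = \<one>\<^bsub>homology n A\<^esub>" for x
    proof -
      obtain z where z: "z \<in> cycles Cyl n" "x = hclass Cyl n z"
        using x by (auto simp: carrier_homology)
      then have "proj n z \<in> boundaries A n"
        using x(2) chain_map_cycles[OF chain_complex_Cyl chain_complex_A chain_map_proj]
        by (simp add: homology_map_hclass chain_complex_A chain_complex_Cyl chain_map_proj hclass_eq_one_iff)
      then have p: "proj n z = \<one>" by (simp add: boundaries_A)
      have "z \<in> boundaries Cyl n"
      proof (cases "n = k")
        case True
        then obtain a b where ab: "z = c (a, b)" "a \<in> carrier M" "b \<in> carrier M"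
          using cycles_carrier[OF z(1)] by auto
        then have "a = \<one>" using p True by (simp add: proj_def)
        then have "z = cdiff Cyl n b" using ab True by simp
        then show ?thesis using ab True by (auto simp: boundaries_def)
      next
        case False
        then have "z = \<one>\<^bsub>cgrp Cyl n\<^esub>"
          using z(1) by (cases "n = Suc k") (auto simp: cycles_def)
        then show ?thesis
          using subgroup.one_closed[OF subgroup_boundaries[OF chain_complex_Cyl]] by simp
      qed
      then show ?thesis using z by (simp add: hclass_eq_one_iff chain_complex_Cyl)
    qed
    ultimately show ?thesis unfolding h.iso_iff by blast
  qed
  then show ?thesis by (simp add: quasi_iso_def chain_map_proj)
qed

text \<open>Both inclusions into the cylinder are sections of the projection, hence equal in the
  localization; a chain homotopy is an arrow out of the cylinder.\<close>

lemma zz_eq_homotopic: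
  assumes Y: "chain_complex Y" and f: "chain_map A Y f" and g: "chain_map A Y g"
    and b: "b \<in> hom M (cgrp Y (Suc k))"
    and fg: "\<And>m. m \<in> carrier M \<Longrightarrow> f k m = g k m \<otimes>\<^bsub>cgrp Y k\<^esub> cdiff Y k (b m)"
  shows "zz_eq Ch quasi_iso A Y [Fwd A f Y] [Fwd A g Y]"
proof -
  note cx = chain_complex_A chain_complex_Cyl Y
  interpret Yk: comm_group "cgrp Y n" for n using Y by (rule chain_complexD)
  interpret d: group_hom "cgrp Y (Suc n)" "cgrp Y n" "cdiff Y n" for n using Y by (rule cdiff_group_hom)
  interpret g: group_hom "cgrp A n" "cgrp Y n" "g n" for n
    using cx(1,3) g by (rule chain_map_group_hom)
  interpret b: group_hom M "cgrp Y (Suc k)" b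
    using b by unfold_locales
  have gk [simp]: "g k m \<in> carrier (cgrp Y k)" if "m \<in> carrier M" for m
    using g.hom_closed[of m k] that by simp
  have gmult [simp]: "g k (m \<otimes> m') = g k m \<otimes>\<^bsub>cgrp Y k\<^esub> g k m'" if "m \<in> carrier M" "m' \<in> carrier M" for m m'
    using g.hom_mult[of m k m'] that by simp
  have g1 [simp]: "g n \<one> = \<one>\<^bsub>cgrp Y n\<^esub>" for n using g.hom_one[of n] by simp
  have gcyc: "cdiff Y m (g (Suc m) x) = \<one>\<^bsub>cgrp Y m\<^esub>" if "x \<in> carrier M" "Suc m = k" for m x
    using chain_map_cycles[OF cx(1,3) g, of x k] that by (auto simp: cycles_A cycles_def)
  \<comment> \<open>The homotopy as a map out of the cylinder. Written additively, it is (a, a') |->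
    g a + d (b a') in degree k and b in degree k + 1. On the end (x, 0) it restricts to g, on the
    end (x, x) to g + d b, which is f.\<close>
  define H where "H n = (\<lambda>x\<in>carrier (cgrp Cyl n). if n = k
      then g k (fst (inv_into UNIV c x)) \<otimes>\<^bsub>cgrp Y k\<^esub> cdiff Y k (b (snd (inv_into UNIV c x)))
      else if n = Suc k then b x else \<one>\<^bsub>cgrp Y n\<^esub>)" for n
  have H: "chain_map Cyl Y H"
  proof -
    have "H n \<in> hom (cgrp Cyl n) (cgrp Y n)" for n
      by (cases "n = k"; cases "n = Suc k") (auto simp: hom_def H_def Yk.m_ac)
    moreover have "H n (cdiff Cyl n x) = cdiff Y n (H (Suc n) x)"
      if x0: "x \<in> carrier (cgrp Cyl (Suc n))" for n x
    proof (cases "Suc n = k")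
      case True
      then obtain a a' where x: "x = c (a, a')" "a \<in> carrier M" "a' \<in> carrier M"
        using x0 by auto
      have "cdiff Y n (g k a \<otimes>\<^bsub>cgrp Y k\<^esub> cdiff Y k (b a'))
          = cdiff Y n (g k a) \<otimes>\<^bsub>cgrp Y n\<^esub> cdiff Y n (cdiff Y k (b a'))"
        using d.hom_mult[of "g k a" n "cdiff Y k (b a')"] gk[OF x(2)] b.hom_closed[OF x(3)]
        by (simp add: True chain_complexD(5)[OF Y])
      also have "\<dots> = \<one>\<^bsub>cgrp Y n\<^esub>"
        using gcyc[OF x(2) True] chain_complexD(4)[OF Y, of "b a'" n] b.hom_closed[OF x(3)]
        by (simp add: True)
      finally show ?thesis
        using x True by (auto simp: H_def)
    next
      case False
      then show ?thesis using x0 by (cases "n = k"; cases "n = Suc k") (auto simp: H_def)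
    qed
    ultimately show ?thesis by (auto simp: chain_map_def H_def)
  qed
  have homs: "(\<lambda>x. \<one>) \<in> hom M M" "(\<lambda>x. x) \<in> hom M M" by (auto simp: hom_def)
  note incl = chain_map_incl[OF homs(1)] chain_map_incl[OF homs(2)]
  have trivial: "h n x = \<one>\<^bsub>cgrp Y n\<^esub>" if "chain_map A Y h" "n \<noteq> k" "x \<in> carrier (cgrp A n)" for h n x
    using group_hom.hom_one[OF chain_map_group_hom[OF cx(1,3) that(1)], of n] that by simp
  \<comment> \<open>Arrows of \<open>Ch\<close> are equal as total functions, so the values outside
    the carriers, all \<open>undefined\<close>, must be compared as well.\<close>
  have undef: "h n x = undefined" if "chain_map A Y h" "x \<notin> carrier (cgrp A n)" for h n x
    using that by (auto simp: chain_map_def extensional_def)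
  have Hg: "Comp Ch A Cyl Y H (incl (\<lambda>x. \<one>)) = g"
  proof (intro ext)
    fix n x show "Comp Ch A Cyl Y H (incl (\<lambda>x. \<one>)) n x = g n x"
      using trivial[OF g] undef[OF g]
      by (cases "n = k"; cases "n = Suc k"; cases "x \<in> carrier (cgrp A n)")
        (auto simp: compose_def incl_def H_def)
  qed
  have Hf: "Comp Ch A Cyl Y H (incl (\<lambda>x. x)) = f"
  proof (intro ext)
    fix n x show "Comp Ch A Cyl Y H (incl (\<lambda>x. x)) n x = f n x"
      using trivial[OF f] undef[OF f] fg
      by (cases "n = k"; cases "n = Suc k"; cases "x \<in> carrier (cgrp A n)")
        (auto simp: compose_def incl_def H_def)
  qed
  let ?E = "zz_eq Ch quasi_iso"
  \<comment> \<open>Since \<open>proj\<close> is inverted and has \<open>incl u\<close> as a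
    section, \<open>incl u\<close> represents the formal inverse of \<open>proj\<close>, whatever u
    is.\<close>
  have inv: "?E A Cyl [Fwd A (incl u) Cyl] [Bwd A proj Cyl]" if u: "u \<in> hom M M" for u
  proof -
    let ?i = "Fwd A (incl u) Cyl" and ?p = "Fwd Cyl proj A" and ?q = "Bwd A proj Cyl"
    note mor = cx chain_map_incl[OF u] chain_map_proj quasi_iso_proj
    have "?E Cyl Cyl [?p, ?q] []" by (rule zz_inv1) (use mor in auto)
    then have 1: "?E A Cyl ([?i] @ [?p, ?q]) ([?i] @ [])"
      by (intro zz_append zz_refl) (use mor in \<open>auto simp: zigzag_Fwd_iff\<close>)
    have "?E A A [?i, ?p] [Fwd A (Ident Ch A) A]"
      unfolding proj_incl[OF u, symmetric] by (rule zz_comp) (use mor in auto)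
    then have "?E A A [?i, ?p] []" by (rule zz_trans) (rule zz_ident, use mor in auto)
    then have "?E A Cyl ([?i, ?p] @ [?q]) ([] @ [?q])"
      by (intro zz_append zz_refl) (use mor in \<open>auto intro!: zigzag_Bwd\<close>)
    then show ?thesis using zz_trans[OF zz_sym[OF 1]] by simp
  qed
  have "?E A Cyl [Fwd A (incl (\<lambda>x. x)) Cyl] [Fwd A (incl (\<lambda>x. \<one>)) Cyl]"
    using inv[OF homs(2)] zz_sym[OF inv[OF homs(1)]] by (rule zz_trans)
  then have 1: "?E A Y ([Fwd A (incl (\<lambda>x. x)) Cyl] @ [Fwd Cyl H Y]) ([Fwd A (incl (\<lambda>x. \<one>)) Cyl] @ [Fwd Cyl H Y])"
    by (intro zz_append zz_refl) (use cx H in \<open>auto simp: zigzag_Fwd_iff\<close>)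
  have 2: "?E A Y ([Fwd A (incl (\<lambda>x. x)) Cyl] @ [Fwd Cyl H Y]) [Fwd A f Y]"
    unfolding Hf[symmetric] append.simps by (rule zz_comp) (use cx H incl in auto)
  have 3: "?E A Y ([Fwd A (incl (\<lambda>x. \<one>)) Cyl] @ [Fwd Cyl H Y]) [Fwd A g Y]"
    unfolding Hg[symmetric] append.simps by (rule zz_comp) (use cx H incl in auto)
  show ?thesis by (rule zz_trans[OF zz_trans[OF zz_sym[OF 2] 1] 3])
qed

end

text \<open>Finitely supported integer functions on an infinite type are no more numerous than its
  elements, so the free abelian group on any S can be coded in the type of S itself. The remaining
  conclusions are its freeness: homomorphisms may be prescribed on S, and an assertion that defines
  a subgroup need only be checked on the generators.\<close>

lemma ex_free_comm_group:
  fixes S :: "'e set"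
  assumes "infinite (UNIV :: 'e set)"
  obtains M :: "'e monoid" and g :: "'e \<Rightarrow> 'e" where
    "comm_group M" "g ` S \<subseteq> carrier M"
    "\<And>U. subgroup U M \<Longrightarrow> g ` S \<subseteq> U \<Longrightarrow> carrier M \<subseteq> U"
    "\<And>(N :: 'e monoid) v. comm_group N \<Longrightarrow> v ` S \<subseteq> carrier N \<Longrightarrow> \<exists>h\<in>hom M N. \<forall>s\<in>S. h (g s) = v s"
proof -
  have "carrier (free_Abelian_group (UNIV :: 'e set)) \<approx> (UNIV :: 'e set)"
    using assms by (rule eqpoll_free_Abelian_group_infinite)
  moreover have "carrier (free_Abelian_group (UNIV :: 'e set)) = UNIV"
    by (auto simp: carrier_free_Abelian_group_iff)
  ultimately obtain j :: "('e \<Rightarrow>\<^sub>0 int) \<Rightarrow> 'e" where j: "inj j"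
    by (auto simp: eqpoll_def bij_betw_def)
  define M where "M = coded_group j (free_Abelian_group S)"
  have M: "comm_group M"
    unfolding M_def by (intro comm_group_coded_group j abelian_free_Abelian_group)
  then interpret M: comm_group M .
  have jM: "j a \<in> carrier M \<longleftrightarrow> Poly_Mapping.keys a \<subseteq> S" for a
    using j by (auto simp: M_def inj_image_mem_iff carrier_free_Abelian_group_iff)
  have jmult: "j a \<otimes>\<^bsub>M\<^esub> j b = j (a + b)" and jone: "\<one>\<^bsub>M\<^esub> = j 0" for a b
    using j by (simp_all add: M_def)
  have jdiff: "j (a - b) = j a \<otimes>\<^bsub>M\<^esub> inv\<^bsub>M\<^esub> j b"
    if "Poly_Mapping.keys a \<subseteq> S" "Poly_Mapping.keys b \<subseteq> S" for a b
  proof -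
    have "Poly_Mapping.keys (a - b) \<subseteq> S" using that keys_diff[of a b] by auto
    then have "j (a - b) \<in> carrier M" "j b \<in> carrier M" "j a = j (a - b) \<otimes>\<^bsub>M\<^esub> j b"
      using that by (simp_all add: jM jmult)
    then show ?thesis by (simp add: M.m_assoc)
  qed
  show thesis
  proof (rule that[of M "\<lambda>s. j (frag_of s)"])
    show "comm_group M" by fact
    show "(\<lambda>s. j (frag_of s)) ` S \<subseteq> carrier M"
      by (auto simp: jM)
  next
    fix U assume U: "subgroup U M" "(\<lambda>s. j (frag_of s)) ` S \<subseteq> U"
    \<comment> \<open>\<open>frag_induction\<close> gives no support bound for the two terms of a
      difference, so the bound is carried in the statement.\<close>
    have *: "Poly_Mapping.keys a \<subseteq> S \<and> j a \<in> U" if "Poly_Mapping.keys a \<subseteq> S" for a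
      using that
    proof (induction a rule: frag_induction)
      case zero
      then show ?case using subgroup.one_closed[OF U(1)] by (simp add: jone)
    next
      case (one x)
      then show ?case using U(2) by auto
    next
      case (diff a b)
      then show ?case
        using keys_diff[of a b] by (auto simp: jdiff intro!: subgroup.m_closed[OF U(1)] subgroup.m_inv_closed[OF U(1)])
    qed
    have "a \<in> U" if "a \<in> carrier M" for a
      using that * by (force simp: M_def carrier_free_Abelian_group_iff)
    then show "carrier M \<subseteq> U" by blast
  next
    fix N :: "'e monoid" and v assume "comm_group N" "v ` S \<subseteq> carrier N"
    then interpret N: comm_group N by simp
    obtain h where h: "h \<in> hom (free_Abelian_group S) N" "\<And>s. s \<in> S \<Longrightarrow> h (frag_of s) = v s"
      using N.free_Abelian_group_universal[of v S] \<open>v ` S \<subseteq> carrier N\<close> by metis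
    have "h \<circ> inv_into UNIV j \<in> hom M N"
      using h(1) j by (auto simp: hom_def M_def)
    moreover have "(h \<circ> inv_into UNIV j) (j (frag_of s)) = v s" if "s \<in> S" for s
      using h(2) that j by simp
    ultimately show "\<exists>h\<in>hom M N. \<forall>s\<in>S. h (j (frag_of s)) = v s"
      by blast
  qed
qed

text \<open>On the homotopy category, A represents the functor sending Y to all families of classes
  in H_k(Y) indexed by I, with g the universal family. No linearity is asked of v: the index set is
  a bare set, and later it is the underlying set of a homology group.\<close>

definition corepresents :: "nat \<Rightarrow> 'i set \<Rightarrow> 'e chcx \<Rightarrow> ('i \<Rightarrow> 'e set) \<Rightarrow> bool" where
  "corepresents k I A g \<longleftrightarrow> chain_complex A \<and> g ` I \<subseteq> carrier (homology k A) \<and>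
     (\<forall>Y v. chain_complex Y \<longrightarrow> v ` I \<subseteq> carrier (homology k Y) \<longrightarrow>
        (\<exists>!\<phi>. \<phi> \<in> Hom ho_Ch A Y \<and> (\<forall>i\<in>I. ho_homology k \<phi> (g i) = v i)))"

lemma corepresentsD:
  assumes "corepresents k I A g" "chain_complex Y" "v ` I \<subseteq> carrier (homology k Y)"
  shows "\<exists>!\<phi>. \<phi> \<in> Hom ho_Ch A Y \<and> (\<forall>i\<in>I. ho_homology k \<phi> (g i) = v i)"
  using assms unfolding corepresents_def by simp

section \<open>Arrows out of a free group placed in one degree\<close>

context cylinder_object
begin

text \<open>The only compatibility with content is the one for the differential leaving degree k,
  and it holds because h takes values in cycles.\<close>

lemma chain_map_of_hom:
  assumes Y: "chain_complex Y" and h: "h \<in> hom M (cgrp Y k)" "h ` carrier M \<subseteq> cycles Y k"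
  shows "chain_map A Y (\<lambda>n. \<lambda>x\<in>carrier (cgrp A n). if n = k then h x else \<one>\<^bsub>cgrp Y n\<^esub>)"
    (is "chain_map A Y ?f")
proof -
  interpret Yn: comm_group "cgrp Y n" for n using Y by (rule chain_complexD)
  interpret h: group_hom M "cgrp Y k" h using h(1) by unfold_locales
  have 1: "?f n \<in> hom (cgrp A n) (cgrp Y n)" for n
    using h(1) by (cases "n = k") (auto simp: hom_def)
  have 2: "?f n (cdiff A n x) = cdiff Y n (?f (Suc n) x)"
    if x: "x \<in> carrier (cgrp A (Suc n))" for n x
  proof -
    have "cdiff Y n \<one>\<^bsub>cgrp Y (Suc n)\<^esub> = \<one>\<^bsub>cgrp Y n\<^esub>"
      using group_hom.hom_one[OF cdiff_group_hom[OF Y]] .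
    then show ?thesis
      using x h(2) by (cases "n = k"; cases "Suc n = k") (auto simp: cycles_def)
  qed
  show ?thesis
    unfolding chain_map_def by (intro conjI allI ballI IntI 1 2 restrict_extensional)
qed

text \<open>Every arrow of \<open>ho_Ch\<close> out of A is represented by a single chain map.
  Forward steps are absorbed by composition. For a backward step w : Y -> X, surjectivity of w on
  H_k lifts the classes of the generators to Y; freeness turns the lifts into a chain map u, and w u
  is homotopic to the given map since both agree in homology on generators. Uniqueness rests on the
  same remark: maps out of A are determined up to homotopy by the classes of the images of the
  generators.\<close>

lemma corepresents_concentrated:
  assumes gM: "g ` S \<subseteq> carrier M"
    and gen: "\<And>U. subgroup U M \<Longrightarrow> g ` S \<subseteq> U \<Longrightarrow> carrier M \<subseteq> U"
    and free: "\<And>(N :: 'e monoid) v. comm_group N \<Longrightarrow> v ` S \<subseteq> carrier N \<Longrightarrow>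
      \<exists>h\<in>hom M N. \<forall>s\<in>S. h (g s) = v s"
  shows "corepresents k S A (\<lambda>s. hclass A k (g s))"
proof -
  let ?E = "zz_eq Ch quasi_iso"
  have gA: "g s \<in> cycles A k" if "s \<in> S" for s
    using gM that by (auto simp: cycles_A)
  have realize: "\<exists>f. chain_map A Y f \<and> (\<forall>s\<in>S. f k (g s) = v s)"
    if Y: "chain_complex Y" and v: "v ` S \<subseteq> cycles Y k" for Y :: "'e chcx" and v
  proof -
    obtain h where h: "h \<in> hom M ((cgrp Y k)\<lparr>carrier := cycles Y k\<rparr>)" "\<forall>s\<in>S. h (g s) = v s"
      using free[OF cycles_comm_group[OF Y], of v k] v by auto
    have "h \<in> hom M (cgrp Y k)" "h ` carrier M \<subseteq> cycles Y k"
      using h(1) cycles_carrier[of _ Y k] by (auto simp: hom_def)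
    note f = chain_map_of_hom[OF Y this]
    show ?thesis
      by (rule exI, rule conjI, rule f) (use h(2) gM in auto)
  qed
  have homotopic: "?E A Y [Fwd A f Y] [Fwd A f' Y]"
    if Y: "chain_complex Y" and f: "chain_map A Y f" and f': "chain_map A Y f'"
      and eq: "\<forall>s\<in>S. hclass Y k (f k (g s)) = hclass Y k (f' k (g s))" for Y f f'
  proof -
    interpret Yn: comm_group "cgrp Y n" for n using Y by (rule chain_complexD)
    interpret d: group_hom "cgrp Y (Suc k)" "cgrp Y k" "cdiff Y k" using Y by (rule cdiff_group_hom)
    interpret f: group_hom M "cgrp Y k" "f k"
      using chain_map_group_hom[OF chain_complex_A Y f, of k] by simp
    interpret f': group_hom M "cgrp Y k" "f' k"
      using chain_map_group_hom[OF chain_complex_A Y f', of k] by simp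
    have "\<exists>w\<in>carrier (cgrp Y (Suc k)). f k (g s) = cdiff Y k w \<otimes>\<^bsub>cgrp Y k\<^esub> f' k (g s)"
      if "s \<in> S" for s
      using eq that hclass_eq_iff[OF Y chain_map_cycles[OF chain_complex_A Y f gA]
        chain_map_cycles[OF chain_complex_A Y f' gA]] by blast
    then obtain w where w: "\<And>s. s \<in> S \<Longrightarrow> w s \<in> carrier (cgrp Y (Suc k))"
      "\<And>s. s \<in> S \<Longrightarrow> f k (g s) = cdiff Y k (w s) \<otimes>\<^bsub>cgrp Y k\<^esub> f' k (g s)"
      by metis
    then obtain b where b: "b \<in> hom M (cgrp Y (Suc k))" "\<forall>s\<in>S. b (g s) = w s"
      using free[OF Yn.comm_group_axioms, of w "Suc k"] by blast
    interpret b: group_hom M "cgrp Y (Suc k)" b using b(1) by unfold_locales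
    \<comment> \<open>The equation asked of a homotopy holds on a subgroup, so it follows from its
      validity on the generators, where b was chosen to bound the difference.\<close>
    let ?U = "{m \<in> carrier M. f k m = f' k m \<otimes>\<^bsub>cgrp Y k\<^esub> cdiff Y k (b m)}"
    have "subgroup ?U M"
    proof (rule subgroupI)
      show "?U \<noteq> {}" by (auto intro!: exI[of _ \<one>])
    next
      fix x assume "x \<in> ?U"
      then show "inv x \<in> ?U" by (simp add: Yn.inv_mult)
    qed (auto simp: Yn.m_ac)
    moreover have "g ` S \<subseteq> ?U"
      using w b(2) gM by (auto simp: Yn.m_comm)
    ultimately have "carrier M \<subseteq> ?U" by (rule gen)
    then show ?thesis
      using zz_eq_homotopic[OF Y f f' b(1)] by blast
  qed
  have straighten: "\<exists>f'. chain_map A Y f' \<and> ?E A Y ([Fwd A f X] @ zs) [Fwd A f' Y]"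
    if "zigzag Ch quasi_iso X zs Y" "chain_map A X f" for X Y zs f
    using that
  proof (induction arbitrary: f rule: zigzag.induct)
    case (zz_nil X)
    then show ?case using chain_complex_A by (auto intro!: zz_refl simp: zigzag_Fwd_iff)
  next
    case (zz_fwd X h Y zs Z)
    let ?hf = "Comp Ch A X Y h f"
    have Y: "chain_complex Y" using zigzag_Ob[OF zz_fwd.hyps(3)] by simp
    have hf: "chain_map A Y ?hf"
      using chain_map_compose[OF chain_complex_A zz_fwd.prems] zz_fwd.hyps(2) by simp
    have "?E A Y [Fwd A f X, Fwd X h Y] [Fwd A ?hf Y]"
      by (rule zz_comp) (use zz_fwd Y chain_complex_A in auto)
    then have 1: "?E A Z ([Fwd A f X, Fwd X h Y] @ zs) ([Fwd A ?hf Y] @ zs)"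
      using zz_fwd.hyps(3) by (blast intro: zz_append zz_refl)
    obtain f' where "chain_map A Z f'" "?E A Z ([Fwd A ?hf Y] @ zs) [Fwd A f' Z]"
      using zz_fwd.IH[OF hf] by blast
    then show ?case using zz_trans[OF 1] by auto
  next
    case (zz_bwd X w Y zs Z)
    have X: "chain_complex X" and Y: "chain_complex Y" and w: "chain_map Y X w"
      using zigzag_Ob[OF zz_bwd.hyps(4)] zz_bwd by auto
    have onto: "homology_map k Y X w ` carrier (homology k Y) = carrier (homology k X)"
      using zz_bwd.hyps(3) by (simp add: quasi_iso_def iso_def bij_betw_def)
    have "\<exists>y\<in>cycles Y k. hclass X k (f k (g s)) = hclass X k (w k y)" if "s \<in> S" for s
    proof -
      have "hclass X k (f k (g s)) \<in> homology_map k Y X w ` carrier (homology k Y)"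
        using chain_map_cycles[OF chain_complex_A X zz_bwd.prems gA[OF that]]
        unfolding onto by (simp add: carrier_homology)
      then show ?thesis
        using homology_map_hclass[OF Y X w, of _ k] unfolding carrier_homology by blast
    qed
    then obtain v where v: "\<And>s. s \<in> S \<Longrightarrow> v s \<in> cycles Y k"
      "\<And>s. s \<in> S \<Longrightarrow> hclass X k (f k (g s)) = hclass X k (w k (v s))"
      by metis
    then obtain u where u: "chain_map A Y u" "\<forall>s\<in>S. u k (g s) = v s"
      using realize[OF Y, of v] by blast
    let ?wu = "Comp Ch A Y X w u"
    have wu: "chain_map A X ?wu"
      using chain_map_compose[OF chain_complex_A u(1) w] by simp
    have "\<forall>s\<in>S. hclass X k (f k (g s)) = hclass X k (?wu k (g s))"
      using v(2) u(2) gM by (auto simp: compose_eq)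
    then have 1: "?E A X [Fwd A f X] [Fwd A ?wu X]"
      by (rule homotopic[OF X zz_bwd.prems wu])
    have 2: "?E A X [Fwd A u Y, Fwd Y w X] [Fwd A ?wu X]"
      by (rule zz_comp) (use u w X Y chain_complex_A in auto)
    have 3: "?E A X [Fwd A f X] [Fwd A u Y, Fwd Y w X]"
      by (rule zz_trans[OF 1 zz_sym[OF 2]])
    have b: "zigzag Ch quasi_iso X [Bwd X w Y] Y"
      using zz_bwd X Y by (auto intro!: zigzag_Bwd)
    have 4: "?E A Y ([Fwd A f X] @ [Bwd X w Y]) ([Fwd A u Y, Fwd Y w X] @ [Bwd X w Y])"
      by (rule zz_append[OF 3 zz_refl[OF b]])
    \<comment> \<open>The lift u enters so that w and its formal inverse become adjacent and
      cancel.\<close>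
    have 5: "?E A Y ([Fwd A u Y] @ [Fwd Y w X, Bwd X w Y]) ([Fwd A u Y] @ [])"
      by (rule zz_append[OF zz_refl zz_inv1]) (use u w X Y chain_complex_A zz_bwd.hyps in \<open>auto simp: zigzag_Fwd_iff\<close>)
    have 6: "?E A Y ([Fwd A f X] @ [Bwd X w Y]) [Fwd A u Y]"
      using zz_trans[OF 4] 5 by simp
    have 7: "?E A Z (([Fwd A f X] @ [Bwd X w Y]) @ zs) ([Fwd A u Y] @ zs)"
      using 6 zz_bwd.hyps(4) by (blast intro: zz_append zz_refl)
    obtain f' where "chain_map A Z f'" "?E A Z ([Fwd A u Y] @ zs) [Fwd A f' Z]"
      using zz_bwd.IH[OF u(1)] by blast
    then show ?case using zz_trans[OF 7] by auto
  qed
  have as_chain_map: "\<exists>f. chain_map A Y f \<and> \<phi> = fmap gamma_Ch A Y f" if \<phi>: "\<phi> \<in> Hom ho_Ch A Y" for \<phi> Y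
  proof -
    obtain zs where zs: "zigzag Ch quasi_iso A zs Y" "\<phi> = zz_class Ch quasi_iso A Y zs"
      using \<phi> by (auto simp: ho_Ch_def)
    obtain f where f: "chain_map A Y f" "?E A Y ([Fwd A (Ident Ch A) A] @ zs) [Fwd A f Y]"
      using straighten[OF zs(1), of "Ident Ch A"] chain_map_id[OF chain_complex_A] by auto
    have "?E A Y ([Fwd A (Ident Ch A) A] @ zs) ([] @ zs)"
      by (rule zz_append[OF zz_ident zz_refl[OF zs(1)]]) (simp add: chain_complex_A)
    then have "?E A Y zs [Fwd A f Y]"
      using zz_trans[OF zz_sym f(2)] by simp
    then have "\<phi> = fmap gamma_Ch A Y f"
      by (simp add: zs(2) gamma_Ch_def zz_class_eqI)
    then show ?thesis using f(1) by blast
  qed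
  have ev: "ho_homology k (fmap gamma_Ch A Y f) (hclass A k (g s)) = hclass Y k (f k (g s))"
    if "chain_complex Y" "chain_map A Y f" "s \<in> S" for Y f s
    using that gA by (auto simp: ho_homology_gamma_Ch chain_complex_A homology_map_hclass carrier_homology)
  have "\<exists>!\<phi>. \<phi> \<in> Hom ho_Ch A Y \<and> (\<forall>s\<in>S. ho_homology k \<phi> (hclass A k (g s)) = v s)"
    if Y: "chain_complex Y" and v: "v ` S \<subseteq> carrier (homology k Y)" for Y :: "'e chcx" and v
  proof (rule ex_ex1I)
    obtain f where f: "chain_map A Y f" "\<forall>s\<in>S. f k (g s) = (SOME z. z \<in> v s)"
      using realize[OF Y, of "\<lambda>s. SOME z. z \<in> v s"] homology_repr(1)[OF Y] v by blast
    then have "ho_homology k (fmap gamma_Ch A Y f) (hclass A k (g s)) = v s" if "s \<in> S" for s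
      using that ev[OF Y f(1) that] homology_repr(2)[OF Y, of "v s"] v by auto
    then show "\<exists>\<phi>. \<phi> \<in> Hom ho_Ch A Y \<and> (\<forall>s\<in>S. ho_homology k \<phi> (hclass A k (g s)) = v s)"
      using gamma_Ch_Hom[OF chain_complex_A Y f(1)] by blast
  next
    fix \<phi> \<psi>
    assume *: "\<phi> \<in> Hom ho_Ch A Y \<and> (\<forall>s\<in>S. ho_homology k \<phi> (hclass A k (g s)) = v s)"
      "\<psi> \<in> Hom ho_Ch A Y \<and> (\<forall>s\<in>S. ho_homology k \<psi> (hclass A k (g s)) = v s)"
    obtain f where f: "chain_map A Y f" "\<phi> = fmap gamma_Ch A Y f"
      using as_chain_map * by blast
    obtain f' where f': "chain_map A Y f'" "\<psi> = fmap gamma_Ch A Y f'"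
      using as_chain_map * by blast
    have "\<forall>s\<in>S. hclass Y k (f k (g s)) = hclass Y k (f' k (g s))"
      using * ev[OF Y f(1)] ev[OF Y f'(1)] f(2) f'(2) by metis
    from homotopic[OF Y f(1) f'(1) this] show "\<phi> = \<psi>"
      by (simp add: f(2) f'(2) gamma_Ch_def zz_class_eqI)
  qed
  then show ?thesis
    using gA by (auto simp: corepresents_def chain_complex_A carrier_homology)
qed

end

text \<open>The free group is generated by elements of the type \<open>'e\<close>, whereas homology
  classes are subsets of it. Choosing one cycle in each class gives an injective renaming r of the
  index set, along which the universal property is transported.\<close>

lemma ex_corepresents_homology:
  fixes X :: "'e chcx"
  assumes inf: "infinite (UNIV :: 'e set)" and X: "chain_complex X"
  shows "\<exists>(A :: 'e chcx) g. corepresents k (carrier (homology k X)) A g"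
proof -
  define r where "r = (\<lambda>h :: 'e set. SOME z. z \<in> h)"
  define S where "S = r ` carrier (homology k X)"
  obtain M :: "'e monoid" and g :: "'e \<Rightarrow> 'e" where M: "comm_group M" and g: "g ` S \<subseteq> carrier M"
    "\<And>U. subgroup U M \<Longrightarrow> g ` S \<subseteq> U \<Longrightarrow> carrier M \<subseteq> U"
    "\<And>(N :: 'e monoid) v. comm_group N \<Longrightarrow> v ` S \<subseteq> carrier N \<Longrightarrow> \<exists>h\<in>hom M N. \<forall>s\<in>S. h (g s) = v s"
    by (rule ex_free_comm_group[OF inf, of S]) blast
  obtain c :: "'e \<times> 'e \<Rightarrow> 'e" where "inj c"
    using Times_same_infinite_bij_betw_types[OF inf] by (auto simp: bij_def)
  interpret cylinder_object M k c
    using M \<open>inj c\<close> by (simp add: cylinder_object_def cylinder_object_axioms_def)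
  have co: "corepresents k S A (\<lambda>s. hclass A k (g s))"
    by (rule corepresents_concentrated[OF g])
  have inj: "inj_on r (carrier (homology k X))"
    using homology_repr(2)[OF X] by (intro inj_on_inverseI[of _ "hclass X k"]) (simp add: r_def)
  have "corepresents k (carrier (homology k X)) A (\<lambda>h. hclass A k (g (r h)))"
    unfolding corepresents_def
  proof (intro conjI allI impI)
    show "chain_complex A" by (rule chain_complex_A)
    show "(\<lambda>h. hclass A k (g (r h))) ` carrier (homology k X) \<subseteq> carrier (homology k A)"
      using co by (auto simp: corepresents_def S_def)
  next
    fix Y :: "'e chcx" and v assume Y: "chain_complex Y" "v ` carrier (homology k X) \<subseteq> carrier (homology k Y)"
    let ?v = "\<lambda>s. v (inv_into (carrier (homology k X)) r s)"
    have "?v ` S \<subseteq> carrier (homology k Y)"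
      using Y(2) inj by (auto simp: S_def inv_into_into)
    from corepresentsD[OF co Y(1) this] show "\<exists>!\<phi>. \<phi> \<in> Hom ho_Ch A Y \<and>
        (\<forall>h\<in>carrier (homology k X). ho_homology k \<phi> (hclass A k (g (r h))) = v h)"
      using inj by (simp add: S_def)
  qed
  then show ?thesis by blast
qed

section \<open>Right Kan extensions and homology\<close>

lemma Ob_ho_Ch [simp]: "Ob ho_Ch = {X. chain_complex X}"
  by (simp add: ho_Ch_def)

lemma ho_Ch_Comp_closed:
  "a \<in> Hom ho_Ch X Y \<Longrightarrow> b \<in> Hom ho_Ch Y Z \<Longrightarrow> Comp ho_Ch X Y Z b a \<in> Hom ho_Ch X Z"
  unfolding ho_Ch_def by (rule localization_Comp_closed)

lemma ho_Ch_Ident: "chain_complex X \<Longrightarrow> Ident ho_Ch X \<in> Hom ho_Ch X X"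
  by (auto simp: ho_Ch_def intro!: zz_nil)

lemma is_functorD:
  assumes "is_functor A B F" "X \<in> Ob A"
  shows "fob F X \<in> Ob B" "fmap F X X (Ident A X) = Ident B (fob F X)"
    "Y \<in> Ob A \<Longrightarrow> f \<in> Hom A X Y \<Longrightarrow> fmap F X Y f \<in> Hom B (fob F X) (fob F Y)"
    "Y \<in> Ob A \<Longrightarrow> Z \<in> Ob A \<Longrightarrow> f \<in> Hom A X Y \<Longrightarrow> g \<in> Hom A Y Z \<Longrightarrow>
      fmap F X Z (Comp A X Y Z g f)
        = Comp B (fob F X) (fob F Y) (fob F Z) (fmap F Y Z g) (fmap F X Y f)"
  using assms unfolding is_functor_def by blast+

lemma Hom_localization_Ob:
  "a \<in> Hom (localization A W) X Y \<Longrightarrow> X \<in> Ob A \<and> Y \<in> Ob A"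
  by (auto dest: zigzag_Ob)

text \<open>Surjectivity is the point: the two transformations to \<open>R\<close> from the free complex on the set \<open>H\<^sub>k(R X)\<close>, one tautological, the other
  induced by \<open>e = \<pi> \<beta>\<^sup>-\<^sup>1 \<epsilon>\<close>, agree after composition with \<open>\<epsilon>\<close>, so they are equal and
  every class \<open>h = e h\<close> is in the image of \<open>\<pi>\<close>.\<close>

lemma right_kan_extension_homology_iso:
  fixes L :: "('o, 'm, 'e chcx, nat \<Rightarrow> 'e \<Rightarrow> 'e) fun_data"
  assumes inf: "infinite (UNIV :: 'e set)"
    and kan: "right_kan_extension A (localization A W) ho_Ch (loc_functor A W) (gamma_Ch \<odot> L) R \<epsilon>"
    and G: "is_functor (localization A W) ho_Ch G"
    and nat_\<pi>: "nat_trans (localization A W) ho_Ch G R \<pi>"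
    and \<beta>: "factors_through A ho_Ch (loc_functor A W) (gamma_Ch \<odot> L) R \<epsilon> G \<beta> \<pi>"
    and iso: "\<And>X. X \<in> Ob A \<Longrightarrow> bij_betw (ho_homology k (\<beta> X))
      (carrier (homology k (fob G X))) (carrier (homology k (fob L X)))"
    and X: "X \<in> Ob A"
  shows "ho_homology k (\<pi> X) \<in> Group.iso (homology k (fob G X)) (homology k (fob R X))"
proof -
  define B where "B = localization A W"
  define \<gamma> where "\<gamma> X Y f = zz_class A W X Y [Fwd X f Y]" for X Y f
  let ?H = "\<lambda>X. carrier (homology k (fob R X))"
  have Ob_B [simp]: "Ob B = Ob A" by (simp add: B_def)
  have R: "is_functor B ho_Ch R" and nat_\<epsilon>: "nat_trans A ho_Ch (R \<odot> loc_functor A W) (gamma_Ch \<odot> L) \<epsilon>"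
    using kan by (auto simp: right_kan_extension_def B_def)
  note G = G[folded B_def] and nat_\<pi> = nat_\<pi>[folded B_def]
  have \<gamma>_Hom: "\<gamma> X Y f \<in> Hom B X Y" if "X \<in> Ob A" "Y \<in> Ob A" "f \<in> Hom A X Y" for X Y f
    unfolding \<gamma>_def B_def using that by (rule Fwd_in_localization)
  have cR: "chain_complex (fob R X)" and cG: "chain_complex (fob G X)" if "X \<in> Ob A" for X
    using is_functorD(1)[OF R] is_functorD(1)[OF G] that by auto
  have R_Hom: "fmap R X Y a \<in> Hom ho_Ch (fob R X) (fob R Y)"
    and G_Hom: "fmap G X Y a \<in> Hom ho_Ch (fob G X) (fob G Y)"
    if "X \<in> Ob A" "Y \<in> Ob A" "a \<in> Hom B X Y" for X Y a
    using is_functorD(3)[OF R] is_functorD(3)[OF G] that by auto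
  have \<epsilon>_Hom: "\<epsilon> X \<in> Hom ho_Ch (fob R X) (fob L X)" if "X \<in> Ob A" for X
    using nat_\<epsilon> that by (auto simp: nat_trans_def gamma_Ch_def)
  have \<pi>_Hom: "\<pi> X \<in> Hom ho_Ch (fob G X) (fob R X)" if "X \<in> Ob A" for X
    using nat_\<pi> that by (auto simp: nat_trans_def)
  have \<epsilon>_nat: "Comp ho_Ch (fob R X) (fob R Y) (fob L Y) (\<epsilon> Y) (fmap R X Y (\<gamma> X Y f))
      = Comp ho_Ch (fob R X) (fob L X) (fob L Y) (fmap (gamma_Ch \<odot> L) X Y f) (\<epsilon> X)"
    if "X \<in> Ob A" "Y \<in> Ob A" "f \<in> Hom A X Y" for X Y f
    using nat_\<epsilon> that by (simp add: nat_trans_def \<gamma>_def gamma_Ch_def)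
  have L_Hom: "fmap (gamma_Ch \<odot> L) X Y f \<in> Hom ho_Ch (fob L X) (fob L Y)"
    if XY: "X \<in> Ob A" "Y \<in> Ob A" "f \<in> Hom A X Y" for X Y f
  proof -
    have "Comp ho_Ch (fob R X) (fob R Y) (fob L Y) (\<epsilon> Y) (fmap R X Y (\<gamma> X Y f))
        \<in> Hom ho_Ch (fob R X) (fob L Y)"
      by (rule ho_Ch_Comp_closed[OF R_Hom \<epsilon>_Hom]) (use XY \<gamma>_Hom in auto)
    then obtain zs where "zigzag Ch quasi_iso (fob R X) zs (fob L Y)"
      "Comp ho_Ch (fob R X) (fob L X) (fob L Y) (fmap (gamma_Ch \<odot> L) X Y f) (\<epsilon> X)
        = zz_class Ch quasi_iso (fob R X) (fob L Y) zs"
      using \<epsilon>_nat[OF XY] by (auto simp: ho_Ch_def)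
    \<comment> \<open>A composite in the localization is nonempty only if both factors are. Hence
      the class of the single step \<open>fmap L X Y f\<close> is nonempty, and that step is a
      genuine chain map between complexes.\<close>
    then have "zs \<in> Comp ho_Ch (fob R X) (fob L X) (fob L Y) (fmap (gamma_Ch \<odot> L) X Y f) (\<epsilon> X)"
      by (simp add: zz_class_self)
    then obtain ws where "ws \<in> fmap (gamma_Ch \<odot> L) X Y f"
      by (auto simp: ho_Ch_def localization_def)
    then have "zigzag Ch quasi_iso (fob L X) [Fwd (fob L X) (fmap L X Y f) (fob L Y)] (fob L Y)"
      unfolding gamma_Ch_def fun_comp_sel loc_functor_sel
      by (rule zigzag_of_mem_zz_class[OF Ch_composition_closed])
    then show ?thesis by (auto simp: gamma_Ch_def ho_Ch_def)
  qed
  have \<beta>_def: "\<beta> X = Comp ho_Ch (fob G X) (fob R X) (fob L X) (\<epsilon> X) (\<pi> X)" if "X \<in> Ob A" for X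
    using \<beta> that by (simp add: factors_through_def gamma_Ch_def)
  have h\<beta>: "ho_homology k (\<beta> X) y = ho_homology k (\<epsilon> X) (ho_homology k (\<pi> X) y)"
    if "X \<in> Ob A" "y \<in> carrier (homology k (fob G X))" for X y
    using that by (simp add: \<beta>_def ho_homology_Comp[OF \<pi>_Hom \<epsilon>_Hom])
  have h\<epsilon>: "ho_homology k (\<epsilon> Y) (ho_homology k (fmap R X Y (\<gamma> X Y f)) h)
      = ho_homology k (fmap (gamma_Ch \<odot> L) X Y f) (ho_homology k (\<epsilon> X) h)"
    if XY: "X \<in> Ob A" "Y \<in> Ob A" "f \<in> Hom A X Y" and h: "h \<in> ?H X" for X Y f h
    using \<epsilon>_nat[OF XY] ho_homology_Comp[OF R_Hom \<epsilon>_Hom h, of Y "\<gamma> X Y f"]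
      ho_homology_Comp[OF \<epsilon>_Hom L_Hom h] XY \<gamma>_Hom by metis
  have h\<pi>: "ho_homology k (\<pi> Y) (ho_homology k (fmap G X Y a) y)
      = ho_homology k (fmap R X Y a) (ho_homology k (\<pi> X) y)"
    if XY: "X \<in> Ob A" "Y \<in> Ob A" "a \<in> Hom B X Y" and y: "y \<in> carrier (homology k (fob G X))" for X Y a y
  proof -
    have "Comp ho_Ch (fob G X) (fob G Y) (fob R Y) (\<pi> Y) (fmap G X Y a)
        = Comp ho_Ch (fob G X) (fob R X) (fob R Y) (fmap R X Y a) (\<pi> X)"
      using nat_\<pi> XY by (simp add: nat_trans_def)
    then show ?thesis
      using ho_homology_Comp[OF G_Hom[OF XY] \<pi>_Hom y] ho_homology_Comp[OF \<pi>_Hom R_Hom[OF XY] y] XY by metis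
  qed
  have hR_Comp: "ho_homology k (fmap R X Z (Comp B X Y Z b a)) h
      = ho_homology k (fmap R Y Z b) (ho_homology k (fmap R X Y a) h)"
    if XY: "X \<in> Ob A" "Y \<in> Ob A" "Z \<in> Ob A" "a \<in> Hom B X Y" "b \<in> Hom B Y Z" and h: "h \<in> ?H X"
    for X Y Z a b h
    using XY ho_homology_Comp[OF R_Hom R_Hom h] is_functorD(4)[OF R, of X Y Z a b] by simp
  have hR_Id: "ho_homology k (fmap R X X (Ident B X)) h = h" if "X \<in> Ob A" "h \<in> ?H X" for X h
    using that is_functorD(2)[OF R, of X] by (simp add: ho_homology_Ident cR)
  have hR_closed: "ho_homology k (fmap R X Y a) h \<in> ?H Y"
    if "X \<in> Ob A" "Y \<in> Ob A" "a \<in> Hom B X Y" "h \<in> ?H X" for X Y a h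
    using that ho_homology_closed[OF R_Hom] by simp

  define e where "e X h = ho_homology k (\<pi> X)
    (inv_into (carrier (homology k (fob G X))) (ho_homology k (\<beta> X)) (ho_homology k (\<epsilon> X) h))" for X h
  have ex_e: "\<exists>y\<in>carrier (homology k (fob G X)). ho_homology k (\<beta> X) y = ho_homology k (\<epsilon> X) h
      \<and> e X h = ho_homology k (\<pi> X) y" if "X \<in> Ob A" "h \<in> ?H X" for X h
  proof -
    have "ho_homology k (\<epsilon> X) h \<in> ho_homology k (\<beta> X) ` carrier (homology k (fob G X))"
      using iso[OF that(1)] ho_homology_closed[OF \<epsilon>_Hom that(2)] that(1) by (simp add: bij_betw_def)
    then show ?thesis
      unfolding e_def by (intro bexI[OF _ inv_into_into]) (auto simp: f_inv_into_f)
  qed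
  have e_eqI: "e X h = ho_homology k (\<pi> X) y"
    if "X \<in> Ob A" "y \<in> carrier (homology k (fob G X))" "ho_homology k (\<beta> X) y = ho_homology k (\<epsilon> X) h" for X y h
    using iso[OF that(1)] that(2) unfolding e_def that(3)[symmetric] by (simp add: bij_betw_def)
  have e_closed: "e X h \<in> ?H X" if "X \<in> Ob A" "h \<in> ?H X" for X h
    using ex_e[OF that] ho_homology_closed[OF \<pi>_Hom] that(1) by auto
  have \<epsilon>_e: "ho_homology k (\<epsilon> X) (e X h) = ho_homology k (\<epsilon> X) h" if "X \<in> Ob A" "h \<in> ?H X" for X h
    using ex_e[OF that] h\<beta>[OF that(1)] by auto
  \<comment> \<open>Naturality of \<epsilon> is available only along arrows of A, so naturality of e
    is proved there first and then extended over formal inverses.\<close>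
  have e_nat: "\<forall>h\<in>?H X. e Y (ho_homology k (fmap R X Y a) h) = ho_homology k (fmap R X Y a) (e X h)"
    if "a \<in> Hom B X Y" for X Y a
    using that unfolding B_def
  proof (induction rule: localization_induct)
    case (Fwd X Y f)
    show ?case
    proof
      fix h assume h: "h \<in> ?H X"
      note f = \<gamma>_Hom[OF Fwd]
      obtain y where y: "y \<in> carrier (homology k (fob G X))"
        "ho_homology k (\<beta> X) y = ho_homology k (\<epsilon> X) h" "e X h = ho_homology k (\<pi> X) y"
        using ex_e[OF Fwd(1) h] by blast
      let ?y = "ho_homology k (fmap G X Y (\<gamma> X Y f)) y"
      have y': "?y \<in> carrier (homology k (fob G Y))"
        using ho_homology_closed[OF G_Hom[OF Fwd(1,2) f] y(1)] .
      have \<pi>y: "ho_homology k (\<pi> X) y \<in> ?H X"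
        using ho_homology_closed[OF \<pi>_Hom[OF Fwd(1)] y(1)] .
      \<comment> \<open>By naturality of \<pi> and \<epsilon>, the image of y under G f is a
        \<beta>-preimage of \<epsilon> applied to R f h; since \<beta> is bijective on homology,
        this preimage may be used to compute e.\<close>
      have "ho_homology k (\<beta> Y) ?y = ho_homology k (\<epsilon> Y) (ho_homology k (fmap R X Y (\<gamma> X Y f)) h)"
        by (simp add: h\<beta>[OF Fwd(2) y'] h\<pi>[OF Fwd(1,2) f y(1)] h\<epsilon>[OF Fwd \<pi>y] h\<epsilon>[OF Fwd h]
            flip: y(2) h\<beta>[OF Fwd(1) y(1)])
      from e_eqI[OF Fwd(2) y' this]
      show "e Y (ho_homology k (fmap R X Y (zz_class A W X Y [Fwd X f Y])) h)
          = ho_homology k (fmap R X Y (zz_class A W X Y [Fwd X f Y])) (e X h)"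
        unfolding \<gamma>_def[symmetric] by (simp add: h\<pi>[OF Fwd(1,2) f y(1)] y(3))
    qed
  next
    case (Ident X)
    then show ?case
      using hR_Id[unfolded B_def] e_closed by simp
  next
    case (Comp X Y Z a b)
    note ab = Comp(1-5)[folded B_def]
    show ?case
      using Comp(6,7) hR_Comp[OF ab] hR_closed[OF ab(1,2,4)] e_closed[OF ab(1)]
      unfolding B_def by simp
  next
    case (Inv X Y a b)
    note ab = Inv(1-4)[folded B_def]
    show ?case
    proof
      fix h assume h: "h \<in> ?H Y"
      let ?h = "ho_homology k (fmap R Y X b) h"
      have h': "?h \<in> ?H X" using hR_closed[OF ab(2,1,4) h] .
      have "h = ho_homology k (fmap R X Y a) ?h"
        using hR_Comp[OF ab(2,1,2,4,3) h] hR_Id[OF ab(2) h] Inv(6) unfolding B_def by simp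
      then have "e Y h = ho_homology k (fmap R X Y a) (e X ?h)"
        using Inv(7) h' by metis
      then have "ho_homology k (fmap R Y X b) (e Y h) = e X ?h"
        using hR_Comp[OF ab(1,2,1,3,4) e_closed[OF ab(1) h']] hR_Id[OF ab(1) e_closed[OF ab(1) h']] Inv(5)
        unfolding B_def by simp
      then show "e X ?h = ho_homology k (fmap R Y X b) (e Y h)" by simp
    qed
  qed

  have "\<exists>(T :: 'e chcx) g. corepresents k (?H X) T g" if "X \<in> Ob A" for X
    by (rule ex_corepresents_homology[OF inf cR[OF that]])
  then obtain T :: "'o \<Rightarrow> 'e chcx" and g where co: "\<And>X. X \<in> Ob A \<Longrightarrow> corepresents k (?H X) (T X) (g X)"
    by metis
  have cT: "chain_complex (T X)" and g_closed: "h \<in> ?H X \<Longrightarrow> g X h \<in> carrier (homology k (T X))"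
    if "X \<in> Ob A" for X h
    using co[OF that] by (auto simp: corepresents_def)
  have det: "\<phi> = \<psi>" if "X \<in> Ob A" "\<phi> \<in> Hom ho_Ch (T X) Y" "\<psi> \<in> Hom ho_Ch (T X) Y"
    "\<And>h. h \<in> ?H X \<Longrightarrow> ho_homology k \<phi> (g X h) = ho_homology k \<psi> (g X h)" for X Y \<phi> \<psi>
  proof -
    have Y: "chain_complex Y" using Hom_localization_Ob that(2) unfolding ho_Ch_def by fastforce
    have v: "(\<lambda>h. ho_homology k \<phi> (g X h)) ` ?H X \<subseteq> carrier (homology k Y)"
      using ho_homology_closed[OF that(2)] g_closed[OF that(1)] by blast
    show ?thesis
      using corepresentsD[OF co[OF that(1)] Y v] that(2-4) by metis
  qed
  define arr where "arr X Y v = (THE \<phi>. \<phi> \<in> Hom ho_Ch (T X) Y \<and> (\<forall>h\<in>?H X. ho_homology k \<phi> (g X h) = v h))" for X Y v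
  have arr: "arr X Y v \<in> Hom ho_Ch (T X) Y" "h \<in> ?H X \<Longrightarrow> ho_homology k (arr X Y v) (g X h) = v h"
    if "X \<in> Ob A" "chain_complex Y" "v ` ?H X \<subseteq> carrier (homology k Y)" for X Y v h
    using theI'[OF corepresentsD[OF co[OF that(1)] that(2,3)]] unfolding arr_def by blast+

  \<comment> \<open>The arrow F a is prescribed on universal classes: the one indexed by h goes to
    the one indexed by the image of h under R a. Functoriality of F thus reduces to functoriality of
    the index sets.\<close>
  define F where "F = \<lparr> fob = T, fmap = (\<lambda>X Y a. arr X (T Y) (\<lambda>h. g Y (ho_homology k (fmap R X Y a) h))) \<rparr>"
  define \<delta> where "\<delta> X = arr X (fob R X) (\<lambda>h. h)" for X
  define \<delta>' where "\<delta>' X = arr X (fob R X) (e X)" for X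
  \<comment> \<open>\<theta> is the transformation to be factored. Both \<delta> and \<delta>'
    factor it, because \<epsilon> e = \<epsilon> on homology.\<close>
  define \<theta> where "\<theta> X = Comp ho_Ch (T X) (fob R X) (fob L X) (\<epsilon> X) (\<delta> X)" for X
  have F_sel [simp]: "fob F X = T X" for X by (simp add: F_def)
  have F_Hom: "fmap F X Y a \<in> Hom ho_Ch (T X) (T Y)"
    and F_ev: "h \<in> ?H X \<Longrightarrow> ho_homology k (fmap F X Y a) (g X h) = g Y (ho_homology k (fmap R X Y a) h)"
    if XY: "X \<in> Ob A" "Y \<in> Ob A" "a \<in> Hom B X Y" for X Y a h
    using arr[OF XY(1) cT[OF XY(2)], of "\<lambda>h. g Y (ho_homology k (fmap R X Y a) h)"]
      g_closed[OF XY(2)] hR_closed[OF XY] by (auto simp: F_def)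
  have \<delta>_Hom: "\<delta> X \<in> Hom ho_Ch (T X) (fob R X)" and \<delta>_ev: "h \<in> ?H X \<Longrightarrow> ho_homology k (\<delta> X) (g X h) = h"
    if "X \<in> Ob A" for X h
    using arr[OF that cR[OF that], of "\<lambda>h. h"] by (auto simp: \<delta>_def)
  have \<delta>'_Hom: "\<delta>' X \<in> Hom ho_Ch (T X) (fob R X)" and \<delta>'_ev: "h \<in> ?H X \<Longrightarrow> ho_homology k (\<delta>' X) (g X h) = e X h"
    if "X \<in> Ob A" for X h
    using arr[OF that cR[OF that], of "e X"] e_closed[OF that] by (auto simp: \<delta>'_def)
  have \<theta>_Hom: "\<theta> X \<in> Hom ho_Ch (T X) (fob L X)"
    and \<theta>_ev: "h \<in> ?H X \<Longrightarrow> ho_homology k (\<theta> X) (g X h) = ho_homology k (\<epsilon> X) h" if "X \<in> Ob A" for X h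
    using that ho_Ch_Comp_closed[OF \<delta>_Hom \<epsilon>_Hom] ho_homology_Comp[OF \<delta>_Hom \<epsilon>_Hom g_closed]
    by (auto simp: \<theta>_def \<delta>_ev)
  have F: "is_functor B ho_Ch F"
    unfolding is_functor_def
  proof (intro conjI ballI)
    fix X assume "X \<in> Ob B"
    then have X: "X \<in> Ob A" by simp
    then show "fob F X \<in> Ob ho_Ch" by (simp add: cT)
    have Id: "Ident B X \<in> Hom B X X" using X by (auto simp: B_def intro!: zz_nil)
    show "fmap F X X (Ident B X) = Ident ho_Ch (fob F X)"
      by (rule det[OF X])
        (use F_Hom[OF X X Id] ho_Ch_Ident[OF cT[OF X]] in
          \<open>simp_all add: F_ev[OF X X Id] hR_Id[OF X] ho_homology_Ident[OF cT[OF X] g_closed[OF X]]\<close>)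
  next
    fix X Y a assume "X \<in> Ob B" "Y \<in> Ob B" "a \<in> Hom B X Y"
    then show "fmap F X Y a \<in> Hom ho_Ch (fob F X) (fob F Y)" by (simp add: F_Hom)
  next
    fix X Y Z a b assume "X \<in> Ob B" "Y \<in> Ob B" "Z \<in> Ob B" and a: "a \<in> Hom B X Y" and b: "b \<in> Hom B Y Z"
    then have Ob: "X \<in> Ob A" "Y \<in> Ob A" "Z \<in> Ob A" by simp_all
    have ba: "Comp B X Y Z b a \<in> Hom B X Z"
      using a b unfolding B_def by (rule localization_Comp_closed)
    note Fa = F_Hom[OF Ob(1,2) a] and Fb = F_Hom[OF Ob(2,3) b]
    show "fmap F X Z (Comp B X Y Z b a)
        = Comp ho_Ch (fob F X) (fob F Y) (fob F Z) (fmap F Y Z b) (fmap F X Y a)"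
      unfolding F_sel
    proof (rule det[OF Ob(1) F_Hom[OF Ob(1,3) ba] ho_Ch_Comp_closed[OF Fa Fb]])
      fix h assume h: "h \<in> ?H X"
      show "ho_homology k (fmap F X Z (Comp B X Y Z b a)) (g X h)
          = ho_homology k (Comp ho_Ch (T X) (T Y) (T Z) (fmap F Y Z b) (fmap F X Y a)) (g X h)"
        by (simp add: F_ev[OF Ob(1,3) ba h] ho_homology_Comp[OF Fa Fb g_closed[OF Ob(1) h]]
            F_ev[OF Ob(1,2) a h] F_ev[OF Ob(2,3) b hR_closed[OF Ob(1,2) a h]] hR_Comp[OF Ob a b h])
    qed
  qed
  have nat: "nat_trans B ho_Ch F R d"
    if d: "\<And>X. X \<in> Ob A \<Longrightarrow> d X \<in> Hom ho_Ch (T X) (fob R X)"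
      "\<And>X h. X \<in> Ob A \<Longrightarrow> h \<in> ?H X \<Longrightarrow> ho_homology k (d X) (g X h) = u X h"
      "\<And>X Y a h. a \<in> Hom B X Y \<Longrightarrow> h \<in> ?H X \<Longrightarrow>
        u Y (ho_homology k (fmap R X Y a) h) = ho_homology k (fmap R X Y a) (u X h)" for d u
    unfolding nat_trans_def F_sel
  proof (intro conjI ballI)
    fix X assume "X \<in> Ob B" then show "d X \<in> Hom ho_Ch (T X) (fob R X)" using d(1) by simp
  next
    fix X Y a assume "X \<in> Ob B" "Y \<in> Ob B" and a: "a \<in> Hom B X Y"
    then have Ob: "X \<in> Ob A" "Y \<in> Ob A" by simp_all
    note m = F_Hom[OF Ob a] d(1)[OF Ob(2)] d(1)[OF Ob(1)] R_Hom[OF Ob a]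
    show "Comp ho_Ch (T X) (T Y) (fob R Y) (d Y) (fmap F X Y a)
        = Comp ho_Ch (T X) (fob R X) (fob R Y) (fmap R X Y a) (d X)"
    proof (rule det[OF Ob(1) ho_Ch_Comp_closed[OF m(1,2)] ho_Ch_Comp_closed[OF m(3,4)]])
      fix h assume h: "h \<in> ?H X"
      note gh = g_closed[OF Ob(1) h]
      show "ho_homology k (Comp ho_Ch (T X) (T Y) (fob R Y) (d Y) (fmap F X Y a)) (g X h)
          = ho_homology k (Comp ho_Ch (T X) (fob R X) (fob R Y) (fmap R X Y a) (d X)) (g X h)"
        by (simp add: ho_homology_Comp[OF m(1,2) gh] ho_homology_Comp[OF m(3,4) gh] F_ev[OF Ob a h]
            d(2)[OF Ob(2) hR_closed[OF Ob a h]] d(2)[OF Ob(1) h] d(3)[OF a h])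
    qed
  qed
  have nat_\<delta>: "nat_trans B ho_Ch F R \<delta>" and nat_\<delta>': "nat_trans B ho_Ch F R \<delta>'"
    using nat[OF \<delta>_Hom \<delta>_ev] nat[OF \<delta>'_Hom \<delta>'_ev] e_nat by blast+
  have nat_\<theta>: "nat_trans A ho_Ch (F \<odot> loc_functor A W) (gamma_Ch \<odot> L) \<theta>"
    unfolding nat_trans_def
  proof (intro conjI ballI)
    fix X assume "X \<in> Ob A"
    then show "\<theta> X \<in> Hom ho_Ch (fob (F \<odot> loc_functor A W) X) (fob (gamma_Ch \<odot> L) X)"
      using \<theta>_Hom by (simp add: gamma_Ch_def)
  next
    fix X Y f assume Ob: "X \<in> Ob A" "Y \<in> Ob A" and f: "f \<in> Hom A X Y"
    note f' = \<gamma>_Hom[OF Ob f]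
    note m = F_Hom[OF Ob f'] \<theta>_Hom[OF Ob(2)] \<theta>_Hom[OF Ob(1)] L_Hom[OF Ob f]
    have "Comp ho_Ch (T X) (T Y) (fob L Y) (\<theta> Y) (fmap F X Y (\<gamma> X Y f))
        = Comp ho_Ch (T X) (fob L X) (fob L Y) (fmap (gamma_Ch \<odot> L) X Y f) (\<theta> X)"
    proof (rule det[OF Ob(1) ho_Ch_Comp_closed[OF m(1,2)] ho_Ch_Comp_closed[OF m(3,4)]])
      fix h assume h: "h \<in> ?H X"
      note gh = g_closed[OF Ob(1) h]
      show "ho_homology k (Comp ho_Ch (T X) (T Y) (fob L Y) (\<theta> Y) (fmap F X Y (\<gamma> X Y f))) (g X h)
          = ho_homology k (Comp ho_Ch (T X) (fob L X) (fob L Y) (fmap (gamma_Ch \<odot> L) X Y f) (\<theta> X)) (g X h)"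
        by (simp only: ho_homology_Comp[OF m(1,2) gh] ho_homology_Comp[OF m(3,4) gh] F_ev[OF Ob f' h]
            \<theta>_ev[OF Ob(2) hR_closed[OF Ob f' h]] \<theta>_ev[OF Ob(1) h] h\<epsilon>[OF Ob f h])
    qed
    then show "Comp ho_Ch (fob (F \<odot> loc_functor A W) X) (fob (F \<odot> loc_functor A W) Y)
          (fob (gamma_Ch \<odot> L) Y) (\<theta> Y) (fmap (F \<odot> loc_functor A W) X Y f)
        = Comp ho_Ch (fob (F \<odot> loc_functor A W) X) (fob (gamma_Ch \<odot> L) X)
          (fob (gamma_Ch \<odot> L) Y) (fmap (gamma_Ch \<odot> L) X Y f) (\<theta> X)"
      by (simp add: \<gamma>_def gamma_Ch_def)
  qed
  have f\<delta>: "factors_through A ho_Ch (loc_functor A W) (gamma_Ch \<odot> L) R \<epsilon> F \<theta> \<delta>"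
    by (simp add: factors_through_def \<theta>_def gamma_Ch_def)
  have f\<delta>': "factors_through A ho_Ch (loc_functor A W) (gamma_Ch \<odot> L) R \<epsilon> F \<theta> \<delta>'"
    unfolding factors_through_def
  proof
    fix X assume X: "X \<in> Ob A"
    have "\<theta> X = Comp ho_Ch (T X) (fob R X) (fob L X) (\<epsilon> X) (\<delta>' X)"
    proof (rule det[OF X \<theta>_Hom[OF X] ho_Ch_Comp_closed[OF \<delta>'_Hom[OF X] \<epsilon>_Hom[OF X]]])
      fix h assume h: "h \<in> ?H X"
      show "ho_homology k (\<theta> X) (g X h)
          = ho_homology k (Comp ho_Ch (T X) (fob R X) (fob L X) (\<epsilon> X) (\<delta>' X)) (g X h)"
        by (simp add: \<theta>_ev[OF X h] ho_homology_Comp[OF \<delta>'_Hom[OF X] \<epsilon>_Hom[OF X] g_closed[OF X h]]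
            \<delta>'_ev[OF X h] \<epsilon>_e[OF X h])
    qed
    then show "\<theta> X = Comp ho_Ch (fob F (fob (loc_functor A W) X)) (fob R (fob (loc_functor A W) X))
        (fob (gamma_Ch \<odot> L) X) (\<epsilon> X) (\<delta>' (fob (loc_functor A W) X))"
      by (simp add: gamma_Ch_def)
  qed
  have "\<forall>Y\<in>Ob B. \<delta> Y = \<delta>' Y"
    using kan F nat_\<theta> nat_\<delta> nat_\<delta>' f\<delta> f\<delta>' unfolding right_kan_extension_def B_def[symmetric] by blast
  then have \<delta>_eq: "\<delta> X = \<delta>' X" using X by simp
  have surj: "\<exists>y\<in>carrier (homology k (fob G X)). h = ho_homology k (\<pi> X) y" if h: "h \<in> ?H X" for h
  proof -
    have "h = e X h" using \<delta>_ev[OF X h] \<delta>'_ev[OF X h] \<delta>_eq by simp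
    then show ?thesis using ex_e[OF X h] by metis
  qed
  have "inj_on (ho_homology k (\<pi> X)) (carrier (homology k (fob G X)))"
    using iso[OF X] h\<beta>[OF X] unfolding bij_betw_def inj_on_def by metis
  then have "bij_betw (ho_homology k (\<pi> X)) (carrier (homology k (fob G X))) (?H X)"
    using surj ho_homology_closed[OF \<pi>_Hom[OF X]] unfolding bij_betw_def by blast
  then show ?thesis
    using ho_homology_hom[OF cG[OF X] \<pi>_Hom[OF X]] by (simp add: iso_def)
qed

section \<open>Orientals\<close>

lemma oriental_sel [simp]:
  "cells (oriental n) = oriental_cells n" "osrc (oriental n) m x = otrunc False m x"
  "otgt (oriental n) m x = otrunc True m x" "ounit (oriental n) m x = x"
  "ocomp (oriental n) m k x y = (\<lambda>d j. x d j + y d j - otrunc False k x d j)"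
  by (simp_all add: oriental_def)

lemma otrunc_otrunc: "k < m \<Longrightarrow> otrunc e k (otrunc d m x) = otrunc e k x"
  by (auto simp: otrunc_def fun_eq_iff)

lemma otrunc_otrunc_same: "otrunc e k (otrunc d k x) = otrunc d k x"
  by (auto simp: otrunc_def fun_eq_iff)

lemma src_to_oriental: "k < m \<Longrightarrow> src_to (oriental n) m k x = otrunc False k x"
proof (induction m arbitrary: x)
  case (Suc m)
  then show ?case
    by (cases "k = m"; cases m) (auto simp: otrunc_otrunc)
qed simp

lemma tgt_to_oriental: "k < m \<Longrightarrow> tgt_to (oriental n) m k x = otrunc True k x"
proof (induction m arbitrary: x)
  case (Suc m)
  then show ?case
    by (cases "k = m"; cases m) (auto simp: otrunc_otrunc)
qed simp

lemma composable_oriental: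
  "composable (oriental n) m k x y \<longleftrightarrow> k < m \<and> x \<in> oriental_cells n m \<and> y \<in> oriental_cells n m \<and>
     otrunc False k x = otrunc True k y"
  by (auto simp: composable_def src_to_oriental tgt_to_oriental)

lemma opositive_add: "a \<in> opositive n k \<Longrightarrow> b \<in> opositive n k \<Longrightarrow> a + b \<in> opositive n k"
  using keys_add[of a b] by (auto simp: opositive_def lookup_add)

lemma zero_opositive [simp]: "0 \<in> opositive n k"
  by (simp add: opositive_def)

lemma obdry_add: "obdry (a + b) = obdry a + obdry b"
  and obdry_diff: "obdry (a - b) = obdry a - obdry b"
  and obdry_zero [simp]: "obdry 0 = 0"
  by (simp_all add: obdry_def frag_extend_add frag_extend_diff)

text \<open>Cells are extended by zero above their dimension m, so the defining conditions persist
  in every degree; the boundary condition in degree m says 0 = \<open>x True m - x False m\<close>,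
  which is the equality of the two top entries.\<close>

lemma oriental_cellsD:
  assumes "x \<in> oriental_cells n m"
  shows "x e k \<in> opositive n k" "m < k \<Longrightarrow> x e k = 0" "x False m = x True m"
    "obdry (x e (Suc k)) = x True k - x False k" "oaug (x e 0) = 1"
proof -
  show "m < k \<Longrightarrow> x e k = 0" "x False m = x True m" "oaug (x e 0) = 1"
    using assms by (auto simp: oriental_cells_def)
  show "x e k \<in> opositive n k"
    using assms by (cases "k \<le> m") (auto simp: oriental_cells_def)
  show "obdry (x e (Suc k)) = x True k - x False k"
    using assms by (cases k m rule: linorder_cases) (auto simp: oriental_cells_def)
qed

lemma oriental_cellsI:
  assumes "\<And>e k. k \<le> m \<Longrightarrow> x e k \<in> opositive n k" "\<And>e k. m < k \<Longrightarrow> x e k = 0" "x False m = x True m"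
    "\<And>e k. k < m \<Longrightarrow> obdry (x e (Suc k)) = x True k - x False k" "\<And>e. oaug (x e 0) = 1"
  shows "x \<in> oriental_cells n m"
  using assms by (auto simp: oriental_cells_def)

lemma oriental_cells_Suc: "x \<in> oriental_cells n m \<Longrightarrow> x \<in> oriental_cells n (Suc m)"
  by (rule oriental_cellsI) (auto simp: oriental_cellsD)

lemma oriental_cells_mono: "m \<le> m' \<Longrightarrow> x \<in> oriental_cells n m \<Longrightarrow> x \<in> oriental_cells n m'"
  by (induction m' rule: dec_induct) (auto intro: oriental_cells_Suc)

lemma obasis_mono: "n \<le> n' \<Longrightarrow> obasis n k \<subseteq> obasis n' k"
  by (auto simp: obasis_def)

lemma oriental_cells_subset: "n \<le> n' \<Longrightarrow> oriental_cells n m \<subseteq> oriental_cells n' m"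
  using obasis_mono[of n n'] by (fastforce simp: oriental_cells_def opositive_def)

lemma otrunc_cells:
  assumes "x \<in> oriental_cells n m" "k \<le> m" shows "otrunc e k x \<in> oriental_cells n k"
proof (rule oriental_cellsI)
  fix d j assume "j < k"
  then show "obdry (otrunc e k x d (Suc j)) = otrunc e k x True j - otrunc e k x False j"
    using oriental_cellsD(4)[OF assms(1), of _ j] by (cases "Suc j = k") (auto simp: otrunc_def)
qed (use oriental_cellsD[OF assms(1)] in \<open>auto simp: otrunc_def\<close>)

lemma ocomp_oriental_cells:
  assumes "composable (oriental n) m k x y"
  shows "ocomp (oriental n) m k x y \<in> oriental_cells n m"
proof -
  have km: "k < m" and x: "x \<in> oriental_cells n m" and y: "y \<in> oriental_cells n m"
    and xy: "otrunc False k x = otrunc True k y"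
    using assms by (auto simp: composable_oriental)
  have low: "x d j = y d j" if "j < k" for d j
    using fun_cong[OF fun_cong[OF xy, of d], of j] that by (simp add: otrunc_def)
  have mid: "x False k = y True k"
    using fun_cong[OF fun_cong[OF xy, of False], of k] by (simp add: otrunc_def)
  let ?z = "\<lambda>d j. x d j + y d j - otrunc False k x d j"
  \<comment> \<open>The two factors agree below degree k, so subtracting the common part leaves y
    there; in degree k the result has the source of y and the target of x; above k it is the
    sum.\<close>
  have z: "?z d j = (if j < k then y d j else if j = k then (if d then x d k else y d k) else x d j + y d j)" for d j
    using mid by (cases d) (auto simp: otrunc_def low)
  have "?z \<in> oriental_cells n m"
    unfolding z
  proof (rule oriental_cellsI)
    fix d j assume "j < m"
    then show "obdry (if Suc j < k then y d (Suc j) else if Suc j = k then if d then x d k else y d k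
          else x d (Suc j) + y d (Suc j)) =
        (if j < k then y True j else if j = k then if True then x True k else y True k else x True j + y True j) -
        (if j < k then y False j else if j = k then if False then x False k else y False k else x False j + y False j)"
      using oriental_cellsD(4)[OF x, of d j] oriental_cellsD(4)[OF y, of d j] mid low[of j]
      by (cases "Suc j = k") (auto simp: obdry_add)
  qed (use km oriental_cellsD[OF x] oriental_cellsD[OF y] low in \<open>auto intro: opositive_add\<close>)
  then show ?thesis by simp
qed

section \<open>Functoriality of the orientals in monotone maps\<close>

definition push_chain :: "(nat \<Rightarrow> nat) \<Rightarrow> (nat list \<Rightarrow>\<^sub>0 int) \<Rightarrow> (nat list \<Rightarrow>\<^sub>0 int)" where
  "push_chain \<phi> = frag_extend (\<lambda>l. if sorted_wrt (<) (map \<phi> l) then frag_of (map \<phi> l) else 0)"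

lemma oriental_map_eq: "oriental_map \<phi> x = (\<lambda>e k. push_chain \<phi> (x e k))"
  by (simp add: oriental_map_def push_chain_def)

lemma push_chain_add: "push_chain \<phi> (a + b) = push_chain \<phi> a + push_chain \<phi> b"
  and push_chain_diff: "push_chain \<phi> (a - b) = push_chain \<phi> a - push_chain \<phi> b"
  and push_chain_zero [simp]: "push_chain \<phi> 0 = 0"
  and push_chain_frag_of: "push_chain \<phi> (frag_of l) = (if sorted_wrt (<) (map \<phi> l) then frag_of (map \<phi> l) else 0)"
  by (simp_all add: push_chain_def frag_extend_add frag_extend_diff)

lemma push_chain_cmul: "push_chain \<phi> (frag_cmul c a) = frag_cmul c (push_chain \<phi> a)"
  by (simp add: push_chain_def frag_extend_cmul)

lemma push_chain_sum: "finite I \<Longrightarrow> push_chain \<phi> (sum f I) = (\<Sum>i\<in>I. push_chain \<phi> (f i))"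
  by (simp add: push_chain_def frag_extend_sum o_def)

definition del :: "nat \<Rightarrow> 'b list \<Rightarrow> 'b list" where
  "del j l = take j l @ drop (Suc j) l"

lemma obdry_frag_of: "obdry (frag_of l) = (\<Sum>j<length l. frag_cmul ((-1) ^ j) (frag_of (del j l)))"
  by (simp add: obdry_def del_def)

lemma map_del: "map f (del j l) = del j (map f l)"
  by (simp add: del_def take_map drop_map)

lemma sorted_wrt_del: "sorted_wrt P l \<Longrightarrow> sorted_wrt P (del j l)"
  using sorted_wrt_append[of P "take j l" "drop j l"] set_drop_subset_set_drop[of j "Suc j" l]
  by (auto simp: del_def sorted_wrt_append sorted_wrt_drop)

lemma set_del: "distinct l \<Longrightarrow> j < length l \<Longrightarrow> set (del j l) = set l - {l ! j}"
  using id_take_nth_drop[of j l] distinct_append[of "take j l" "l ! j # drop (Suc j) l"]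
  by (auto simp: del_def) (metis Un_iff id_take_nth_drop list.set_intros set_ConsD set_append)+

text \<open>When \<open>\<phi>\<close> identifies two consecutive vertices, the two faces omitting one of them cancel and all the other faces are degenerate.\<close>

lemma obdry_push_chain_frag_of:
  assumes l: "sorted_wrt (<) l" "set l \<subseteq> {..m}" and \<phi>: "mono_on {..m} \<phi>"
  shows "obdry (push_chain \<phi> (frag_of l)) = push_chain \<phi> (obdry (frag_of l))"
proof (cases "sorted_wrt (<) (map \<phi> l)")
  case True
  then show ?thesis
    using sorted_wrt_del[OF True]
    by (simp add: push_chain_frag_of obdry_frag_of push_chain_sum push_chain_cmul map_del)
next
  case False
  have dist: "distinct l" using l(1) by (simp add: strict_sorted_iff)
  obtain i where i: "Suc i < length l" "\<not> \<phi> (l ! i) < \<phi> (l ! Suc i)"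
    using False by (auto simp: sorted_wrt_iff_nth_Suc_transp)
  have "l ! i < l ! Suc i" using l(1) i(1) by (simp add: sorted_wrt_iff_nth_Suc_transp)
  moreover have "l ! i \<in> {..m}" "l ! Suc i \<in> {..m}" by (intro subsetD[OF l(2)] nth_mem, use i(1) in simp)+
  ultimately have eq: "\<phi> (l ! i) = \<phi> (l ! Suc i)" and ne: "l ! i \<noteq> l ! Suc i"
    using i(2) mono_onD[OF \<phi>, of "l ! i" "l ! Suc i"] by auto
  let ?t = "\<lambda>j. frag_cmul ((-1) ^ j) (push_chain \<phi> (frag_of (del j l)))"
  have zero: "push_chain \<phi> (frag_of (del j l)) = 0" if j: "j < length l" "j \<noteq> i" "j \<noteq> Suc i" for j
  proof -
    have "l ! i \<in> set (del j l)" "l ! Suc i \<in> set (del j l)"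
      using i(1) j dist by (auto simp: set_del nth_eq_iff_index_eq)
    then have "\<not> inj_on \<phi> (set (del j l))"
      using eq ne by (auto simp: inj_on_def)
    then have "\<not> sorted_wrt (<) (map \<phi> (del j l))"
      by (auto simp: strict_sorted_iff distinct_map)
    then show ?thesis by (simp add: push_chain_frag_of)
  qed
  have "map \<phi> (del i l) = map \<phi> (del (Suc i) l)"
  proof -
    have "drop (Suc i) l = l ! Suc i # drop (Suc (Suc i)) l" "take (Suc i) l = take i l @ [l ! i]"
      using i(1) by (simp_all add: Cons_nth_drop_Suc take_Suc_conv_app_nth)
    then show ?thesis using eq by (simp add: del_def)
  qed
  then have "?t i + ?t (Suc i) = 0"
    by (simp add: push_chain_frag_of flip: frag_cmul_distrib)
  moreover have "(\<Sum>j<length l. ?t j) = (\<Sum>j\<in>{i, Suc i}. ?t j)"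
    by (rule sum.mono_neutral_right) (use i(1) zero in auto)
  ultimately have "push_chain \<phi> (obdry (frag_of l)) = 0"
    by (simp add: obdry_frag_of push_chain_sum push_chain_cmul)
  then show ?thesis using False by (simp add: push_chain_frag_of)
qed

lemma obdry_push_chain:
  assumes "Poly_Mapping.keys c \<subseteq> obasis m k" "mono_map m n \<phi>"
  shows "obdry (push_chain \<phi> c) = push_chain \<phi> (obdry c)"
  using assms(1)
proof (induction c rule: frag_induction)
  case (one l)
  then show ?case
    using assms(2) obdry_push_chain_frag_of by (auto simp: obasis_def mono_map_def)
qed (simp_all add: push_chain_diff obdry_diff)

lemma lookup_frag_extend:
  "Poly_Mapping.lookup (frag_extend f c) y
     = (\<Sum>x\<in>Poly_Mapping.keys c. Poly_Mapping.lookup c x * Poly_Mapping.lookup (f x) y)"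
  by (simp add: frag_extend_def lookup_sum)

text \<open>The augmentation is a homomorphism, which the sum over a varying support hides. It
  becomes visible when the integers are regarded as the free abelian group on the type
  \<open>unit\<close>.\<close>

lemma oaug_eq: "oaug c = Poly_Mapping.lookup (frag_extend (\<lambda>_. frag_of ()) c) ()"
  by (simp add: oaug_def lookup_frag_extend)

lemma oaug_push_chain:
  assumes "Poly_Mapping.keys c \<subseteq> obasis m 0" shows "oaug (push_chain \<phi> c) = oaug c"
  using assms
proof (induction c rule: frag_induction)
  case (one l)
  then obtain i where "l = [i]" by (auto simp: obasis_def length_Suc_conv)
  then show ?case by (simp add: push_chain_frag_of oaug_eq)
qed (simp_all add: push_chain_diff oaug_eq frag_extend_diff lookup_minus)

lemma push_chain_opositive:
  assumes "c \<in> opositive m k" "mono_map m n \<phi>" shows "push_chain \<phi> c \<in> opositive n k"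
proof -
  have "map \<phi> l \<in> obasis n k" if "l \<in> obasis m k" "sorted_wrt (<) (map \<phi> l)" for l
    using that assms(2) by (auto simp: obasis_def mono_map_def)
  then have "Poly_Mapping.keys (push_chain \<phi> c) \<subseteq> obasis n k"
    using assms(1) keys_frag_extend[of "\<lambda>l. if sorted_wrt (<) (map \<phi> l) then frag_of (map \<phi> l) else 0" c]
    by (fastforce simp: push_chain_def opositive_def split: if_splits)
  moreover have "0 \<le> Poly_Mapping.lookup (push_chain \<phi> c) l" for l
    using assms(1) unfolding push_chain_def lookup_frag_extend
    by (intro sum_nonneg) (auto simp: opositive_def lookup_single when_def)
  ultimately show ?thesis by (simp add: opositive_def)
qed

lemma oriental_map_cells:
  assumes "mono_map m n \<phi>" "x \<in> oriental_cells m k" shows "oriental_map \<phi> x \<in> oriental_cells n k"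
  unfolding oriental_map_eq
proof (rule oriental_cellsI)
  note x = oriental_cellsD[OF assms(2)]
  fix e j
  show "push_chain \<phi> (x e j) \<in> opositive n j" using push_chain_opositive x(1) assms(1) by blast
  have "Poly_Mapping.keys (x e (Suc j)) \<subseteq> obasis m (Suc j)" "Poly_Mapping.keys (x e 0) \<subseteq> obasis m 0"
    using x(1)[of e "Suc j"] x(1)[of e 0] by (auto simp: opositive_def)
  then show "obdry (push_chain \<phi> (x e (Suc j))) = push_chain \<phi> (x True j) - push_chain \<phi> (x False j)"
    "oaug (push_chain \<phi> (x e 0)) = 1"
    using x(4)[of e j] x(5) assms(1) by (simp_all add: obdry_push_chain oaug_push_chain push_chain_diff)
qed (use oriental_cellsD[OF assms(2)] in auto)

lemma oriental_map_otrunc: "oriental_map \<phi> (otrunc e k x) = otrunc e k (oriental_map \<phi> x)"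
  by (auto simp: oriental_map_eq otrunc_def fun_eq_iff)

text \<open>The only danger is a list that \<phi> sends to zero while the composite does not. It
  cannot occur: a monotone \<psi> does not make strictly increasing what \<phi> failed to make
  so.\<close>

lemma push_chain_comp:
  assumes "Poly_Mapping.keys c \<subseteq> obasis m k" "mono_map m n \<phi>" "mono_map n p \<psi>"
  shows "push_chain \<psi> (push_chain \<phi> c) = push_chain (\<psi> \<circ> \<phi>) c"
  using assms(1)
proof (induction c rule: frag_induction)
  case (one l)
  have "sorted_wrt (<) (map \<phi> l)" if s: "sorted_wrt (<) (map (\<psi> \<circ> \<phi>) l)"
  proof -
    have "\<phi> (l ! i) < \<phi> (l ! j)" if "i < j" "j < length l" for i j
    proof (rule ccontr)
      assume "\<not> \<phi> (l ! i) < \<phi> (l ! j)"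
      moreover have "set l \<subseteq> {..m}" using one by (simp add: obasis_def)
      then have "l ! i \<in> {..m}" "l ! j \<in> {..m}"
        by (rule subsetD, intro nth_mem, use that in simp)+
      ultimately have "\<psi> (\<phi> (l ! j)) \<le> \<psi> (\<phi> (l ! i))"
        using assms(2,3) unfolding mono_map_def by (intro mono_onD[of "{..n}" \<psi>]) auto
      moreover have "\<psi> (\<phi> (l ! i)) < \<psi> (\<phi> (l ! j))"
        using s that by (simp add: sorted_wrt_iff_nth_less)
      ultimately show False by simp
    qed
    then show ?thesis by (auto simp: sorted_wrt_iff_nth_less)
  qed
  then show ?case by (auto simp: push_chain_frag_of comp_def)
qed (simp_all add: push_chain_diff)

lemma push_chain_cong:
  assumes "Poly_Mapping.keys c \<subseteq> obasis m k" "\<And>i. i \<le> m \<Longrightarrow> \<phi> i = \<psi> i"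
  shows "push_chain \<phi> c = push_chain \<psi> c"
  unfolding push_chain_def
proof (rule frag_extend_eq)
  fix l assume "l \<in> Poly_Mapping.keys c"
  then have "map \<phi> l = map \<psi> l" using assms by (auto simp: obasis_def)
  then show "(if sorted_wrt (<) (map \<phi> l) then frag_of (map \<phi> l) else 0)
      = (if sorted_wrt (<) (map \<psi> l) then frag_of (map \<psi> l) else 0)" by (simp only:)
qed

lemma keys_oriental_cell: "x \<in> oriental_cells n m \<Longrightarrow> Poly_Mapping.keys (x e k) \<subseteq> obasis n k"
  using oriental_cellsD(1) by (fastforce simp: opositive_def)

lemma oriental_map_comp:
  assumes "x \<in> oriental_cells m k" "mono_map m n \<phi>" "mono_map n p \<psi>"
  shows "oriental_map \<psi> (oriental_map \<phi> x) = oriental_map (\<psi> \<circ> \<phi>) x"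
  unfolding oriental_map_eq
  using push_chain_comp[OF keys_oriental_cell[OF assms(1)] assms(2,3)] by auto

lemma oriental_map_cong:
  assumes "x \<in> oriental_cells m k" "\<And>i. i \<le> m \<Longrightarrow> \<phi> i = \<psi> i"
  shows "oriental_map \<phi> x = oriental_map \<psi> x"
  unfolding oriental_map_eq
  using push_chain_cong[OF keys_oriental_cell[OF assms(1)] assms(2)] by auto


section \<open>The nerve\<close>

lemma nerve_sel [simp]:
  "simps (nerve C) n = {x. omega_functor (oriental n) C x}"
  "sact (nerve C) m n \<phi> x = (\<lambda>k. restrict (x k \<circ> oriental_map \<phi>) (oriental_cells m k))"
  by (simp_all add: nerve_def)

lemma omega_functorD:
  assumes "omega_functor C D F"
  shows "x \<in> cells C n \<Longrightarrow> F n x \<in> cells D n" "x \<notin> cells C n \<Longrightarrow> F n x = undefined"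
    "x \<in> cells C (Suc n) \<Longrightarrow> F n (osrc C n x) = osrc D n (F (Suc n) x)"
    "x \<in> cells C (Suc n) \<Longrightarrow> F n (otgt C n x) = otgt D n (F (Suc n) x)"
    "x \<in> cells C n \<Longrightarrow> F (Suc n) (ounit C n x) = ounit D n (F n x)"
    "composable C n k x y \<Longrightarrow> F n (ocomp C n k x y) = ocomp D n k (F n x) (F n y)"
  using assms by (auto simp: omega_functor_def PiE_iff extensional_def)

lemma sact_nerve_simps:
  assumes "omega_functor (oriental n) C x" "mono_map m n \<phi>"
  shows "omega_functor (oriental m) C (sact (nerve C) m n \<phi> x)"
proof -
  note x = omega_functorD[OF assms(1), simplified]
  note [simp] = oriental_map_cells[OF assms(2)]
  have comp: "oriental_map \<phi> (\<lambda>d j. a d j + b d j - otrunc False k a d j)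
    = (\<lambda>d j. oriental_map \<phi> a d j + oriental_map \<phi> b d j - otrunc False k (oriental_map \<phi> a) d j)" for a b k
    by (simp add: oriental_map_eq push_chain_add push_chain_diff otrunc_def fun_eq_iff)
  show ?thesis
    unfolding omega_functor_def
  proof (intro conjI allI ballI impI)
    fix k show "sact (nerve C) m n \<phi> x k \<in> cells (oriental m) k \<rightarrow>\<^sub>E cells C k"
      using x(1) by auto
  next
    fix k c assume c: "c \<in> cells (oriental m) (Suc k)"
    then have "otrunc e k c \<in> oriental_cells m k" for e by (auto intro: otrunc_cells)
    then show "sact (nerve C) m n \<phi> x k (osrc (oriental m) k c) = osrc C k (sact (nerve C) m n \<phi> x (Suc k) c)"
      "sact (nerve C) m n \<phi> x k (otgt (oriental m) k c) = otgt C k (sact (nerve C) m n \<phi> x (Suc k) c)"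
      using c x(3,4) by (simp_all add: oriental_map_otrunc)
  next
    fix k c assume c: "c \<in> cells (oriental m) k"
    then show "sact (nerve C) m n \<phi> x (Suc k) (ounit (oriental m) k c) = ounit C k (sact (nerve C) m n \<phi> x k c)"
      using x(5) by (simp add: oriental_cells_Suc)
  next
    fix j k c d assume cd: "composable (oriental m) j k c d"
    then have "composable (oriental n) j k (oriental_map \<phi> c) (oriental_map \<phi> d)"
      by (auto simp: composable_oriental simp flip: oriental_map_otrunc)
    note eq = x(6)[OF this, folded comp]
    have "c \<in> oriental_cells m j" "d \<in> oriental_cells m j"
      "(\<lambda>e i. c e i + d e i - otrunc False k c e i) \<in> oriental_cells m j"
      using ocomp_oriental_cells[OF cd] cd by (simp_all only: composable_oriental oriental_sel)
    with eq show "sact (nerve C) m n \<phi> x j (ocomp (oriental m) j k c d)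
        = ocomp C j k (sact (nerve C) m n \<phi> x j c) (sact (nerve C) m n \<phi> x j d)"
      by simp
  qed
qed

lemma sact_sact_nerve:
  assumes "mono_map p m \<psi>" "mono_map m n \<phi>"
  shows "sact (nerve C) p m \<psi> (sact (nerve C) m n \<phi> x) = sact (nerve C) p n (\<phi> \<circ> \<psi>) x"
  by (intro ext) (auto simp: restrict_def oriental_map_cells[OF assms(1)] oriental_map_comp[OF _ assms])

lemma sact_nerve_cong:
  "(\<And>i. i \<le> m \<Longrightarrow> \<phi> i = \<psi> i) \<Longrightarrow> sact (nerve C) m n \<phi> x = sact (nerve C) m n \<psi> x"
  using oriental_map_cong[of _ m _ \<phi> \<psi>] by (intro ext) (auto simp: restrict_def)

section \<open>The cells of the oriental of dimension two\<close>

text \<open>The cells of \<open>\<O>\<^sub>2\<close> other than the principal one are the increasing paths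
  in \<open>{0, 1, 2}\<close>, and their units.\<close>

primrec path_chain :: "nat list \<Rightarrow> (nat list \<Rightarrow>\<^sub>0 int)" where
  "path_chain [] = 0"
| "path_chain (i # l) = (case l of [] \<Rightarrow> 0 | j # _ \<Rightarrow> frag_of [i, j] + path_chain l)"

text \<open>A singleton list stands for a vertex, a longer one for the composite of its edges. Units
  being identities in \<open>oriental\<close>, the same value also represents the iterated units of
  this cell in every higher dimension.\<close>

definition path_cell :: "nat list \<Rightarrow> ocell" where
  "path_cell l = (\<lambda>e k. if k = 0 then frag_of [if e then last l else hd l]
                        else if k = 1 then path_chain l else 0)"

text \<open>The principal cell of the oriental of dimension 2. Its direction, from the edge 02 to
  the composite of 01 and 12, follows the signs in the boundary 12 - 02 + 01.\<close>

definition triangle_cell :: ocell where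
  "triangle_cell = (\<lambda>e k. if k = 0 then frag_of [if e then 2 else 0]
                          else if k = 1 then path_chain (if e then [0, 1, 2] else [0, 2])
                          else if k = 2 then frag_of [0, 1, 2] else 0)"

definition paths :: "nat list set" where
  "paths = {[0], [1], [2], [0, 1], [1, 2], [0, 2], [0, 1, 2]}"

lemma obasis_2:
  "obasis 2 0 = {[0], [1], [2]}" "obasis 2 1 = {[0, 1], [0, 2], [1, 2]}" "obasis 2 2 = {[0, 1, 2]}"
  "3 \<le> k \<Longrightarrow> obasis 2 k = {}"
proof -
  show "obasis 2 0 = {[0], [1], [2]}"
    by (auto simp: obasis_def length_Suc_conv)
  show "obasis 2 1 = {[0, 1], [0, 2], [1, 2]}"
    by (auto simp: obasis_def length_Suc_conv)
  show "obasis 2 2 = {[0, 1, 2]}"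
    by (auto simp: obasis_def length_Suc_conv numeral_2_eq_2)
  show "obasis 2 k = {}" if "3 \<le> k"
  proof -
    have False if l: "length l = Suc k" "sorted_wrt (<) l" "set l \<subseteq> {..2}" for l :: "nat list"
    proof -
      have "card (set l) = Suc k" using l(1,2) by (simp add: distinct_card strict_sorted_iff)
      then show False using card_mono[OF _ l(3)] \<open>3 \<le> k\<close> by simp
    qed
    then show ?thesis by (auto simp: obasis_def)
  qed
qed

lemma frag_expand:
  assumes "Poly_Mapping.keys c \<subseteq> S" "finite S"
  shows "c = (\<Sum>l\<in>S. frag_cmul (Poly_Mapping.lookup c l) (frag_of l))"
proof -
  have "c = (\<Sum>l\<in>Poly_Mapping.keys c. frag_cmul (Poly_Mapping.lookup c l) (frag_of l))"
    using frag_expansion[of c] by (simp add: frag_extend_def)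
  also have "\<dots> = (\<Sum>l\<in>S. frag_cmul (Poly_Mapping.lookup c l) (frag_of l))"
    by (rule sum.mono_neutral_left) (use assms in \<open>auto simp: in_keys_iff\<close>)
  finally show ?thesis .
qed

lemma obdry_edge: "obdry (frag_of [i, j]) = frag_of [j] - frag_of [i]"
  by (simp add: obdry_frag_of del_def numeral_2_eq_2)

lemma obdry_triangle: "obdry (frag_of [i, j, k]) = frag_of [j, k] - frag_of [i, k] + frag_of [i, j]"
  by (simp add: obdry_frag_of del_def numeral_3_eq_3)

lemma obdry_cmul: "obdry (frag_cmul a c) = frag_cmul a (obdry c)"
  by (simp add: obdry_def frag_extend_cmul)

lemma oaug_vertices: "oaug (frag_cmul a (frag_of x) + frag_cmul b (frag_of y) + frag_cmul c (frag_of z)) = a + b + c"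
  by (simp add: oaug_eq frag_extend_add frag_extend_cmul lookup_add)

lemma unit_vector_cases:
  fixes a b c :: int
  assumes "0 \<le> a" "0 \<le> b" "0 \<le> c" "a + b + c = 1"
  obtains "a = 1" "b = 0" "c = 0" | "a = 0" "b = 1" "c = 0" | "a = 0" "b = 0" "c = 1"
proof -
  consider "a = 0" | "a = 1" using assms by linarith
  then show thesis
  proof cases
    case 1
    then consider "b = 0" | "b = 1" using assms by linarith
    then show thesis using that assms 1 by cases auto
  next
    case 2
    then show thesis using that(1) assms by linarith
  qed
qed

text \<open>A cell has nonnegative coefficients u on vertices, p on edges and q on the triangle.
  Augmentation 1 makes the 0-source and the 0-target single vertices. The boundary conditions then
  force the edges to form a path between them, and q is at most 1 because it is subtracted from the
  coefficient of the edge 02 in passing from the 1-source to the 1-target. The clause for m = 0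
  records that a cell of dimension 0 is a vertex.\<close>

lemma oriental_2_cases:
  assumes c: "c \<in> oriental_cells 2 m"
  shows "c = triangle_cell \<and> 2 \<le> m \<or> (\<exists>l\<in>paths. c = path_cell l \<and> (m = 0 \<longrightarrow> tl l = []))"
proof -
  note cD = oriental_cellsD[OF c]
  note keys = keys_oriental_cell[OF c]
  define u where "u e i = Poly_Mapping.lookup (c e 0) [i]" for e i
  define p where "p e i j = Poly_Mapping.lookup (c e 1) [i, j]" for e i j
  define q where "q e = Poly_Mapping.lookup (c e 2) [0, 1, 2]" for e
  have nonneg: "0 \<le> u e i" "0 \<le> p e i j" "0 \<le> q e" for e i j
    using cD(1)[of e 0] cD(1)[of e 1] cD(1)[of e 2] by (simp_all add: opositive_def u_def p_def q_def)
  have c0: "c e 0 = frag_cmul (u e 0) (frag_of [0]) + frag_cmul (u e 1) (frag_of [1]) + frag_cmul (u e 2) (frag_of [2])" for e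
    using frag_expand[OF keys[of e 0]] by (simp add: obasis_2 u_def add_ac)
  have c1: "c e 1 = frag_cmul (p e 0 1) (frag_of [0, 1]) + frag_cmul (p e 0 2) (frag_of [0, 2])
      + frag_cmul (p e 1 2) (frag_of [1, 2])" for e
    using frag_expand[OF keys[of e 1]] unfolding obasis_2(2) by (simp add: p_def add_ac)
  have c2: "c e 2 = frag_cmul (q e) (frag_of [0, 1, 2])" for e
    using frag_expand[OF keys[of e 2]] unfolding obasis_2(3) by (simp add: q_def)
  have c3: "c e k = 0" if "3 \<le> k" for e k
    using keys[of e k] obasis_2(4)[OF that] by simp
  have "c True 2 = c False 2"
    using cD(4)[of False 2] c3[of 3 False] by (simp add: numeral_3_eq_3)
  then have q: "q True = q False" by (simp add: q_def)
  have d1: "frag_cmul (q e) (frag_of [1, 2] - frag_of [0, 2] + frag_of [0, 1]) = c True 1 - c False 1" for e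
    using cD(4)[of e 1] c2[of e] by (simp add: numeral_2_eq_2 obdry_cmul obdry_triangle)
  have p: "p True 0 1 = p False 0 1 + q e" "p True 1 2 = p False 1 2 + q e" "p True 0 2 = p False 0 2 - q e" for e
    using arg_cong[OF d1[of e], of "\<lambda>x. Poly_Mapping.lookup x [0, 1]"]
      arg_cong[OF d1[of e], of "\<lambda>x. Poly_Mapping.lookup x [1, 2]"]
      arg_cong[OF d1[of e], of "\<lambda>x. Poly_Mapping.lookup x [0, 2]"]
    by (simp_all add: p_def lookup_minus lookup_add lookup_single when_def)
  have d0: "frag_cmul (p e 0 1) (frag_of [1] - frag_of [0]) + frag_cmul (p e 0 2) (frag_of [2] - frag_of [0])
      + frag_cmul (p e 1 2) (frag_of [2] - frag_of [1]) = c True 0 - c False 0" for e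
    using cD(4)[of e 0] c1[of e] by (simp add: obdry_add obdry_cmul obdry_edge)
  have u: "u True 0 = u False 0 - p e 0 1 - p e 0 2" "u True 1 = u False 1 + p e 0 1 - p e 1 2"
    "u True 2 = u False 2 + p e 1 2 + p e 0 2" for e
    using arg_cong[OF d0[of e], of "\<lambda>x. Poly_Mapping.lookup x [0]"]
      arg_cong[OF d0[of e], of "\<lambda>x. Poly_Mapping.lookup x [1]"]
      arg_cong[OF d0[of e], of "\<lambda>x. Poly_Mapping.lookup x [2]"]
    by (simp_all add: u_def lookup_minus lookup_add lookup_single when_def)
  have aug: "u e 0 + u e 1 + u e 2 = 1" for e
    using cD(5)[of e] unfolding c0 oaug_vertices .
  have c_eq: "c = d" if "\<And>e. c e 0 = d e 0" "\<And>e. c e 1 = d e 1" "\<And>e. c e 2 = d e 2" "\<And>e k. 3 \<le> k \<Longrightarrow> d e k = 0" for d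
  proof (intro ext)
    fix e and k :: nat
    consider "k = 0" | "k = 1" | "k = 2" | "3 \<le> k" by linarith
    then show "c e k = d e k" using that c3[of k e] by cases auto
  qed
  have path: "c = path_cell l" if "q False = 0"
    "\<And>e. c e 0 = frag_of [if e then last l else hd l]" "c False 1 = path_chain l" for l
  proof (rule c_eq)
    fix e
    show "c e 0 = path_cell l e 0" using that(2) by (simp add: path_cell_def)
    have "c True 1 = c False 1" using that(1) q p[of False] c1[of True] c1[of False] by simp
    then show "c e 1 = path_cell l e 1" using that(3) by (cases e) (simp_all add: path_cell_def)
    have "q e = 0" using that(1) q by (cases e) simp_all
    then show "c e 2 = path_cell l e 2" using c2[of e] by (simp add: path_cell_def)
  qed (simp add: path_cell_def)
  have deg0: "p e i j = 0" if "m = 0" for e i j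
    using cD(2)[of 1 e] that by (simp add: p_def)
  have deg1: "q e = 0" if "m < 2" for e
    using cD(2)[of 2 e] that by (simp add: q_def)
  note c0F = c0[of False] and c0T = c0[of True] and c1F = c1[of False]
  have nn': "0 \<le> p e 0 1" "0 \<le> p e 0 2" "0 \<le> p e 1 2" for e using nonneg by auto
  show ?thesis
  proof (cases rule: unit_vector_cases[OF nonneg(1)[of False 0] nonneg(1)[of False 1] nonneg(1)[of False 2] aug])
    case F: 1
    show ?thesis
    proof (cases rule: unit_vector_cases[OF nonneg(1)[of True 0] nonneg(1)[of True 1] nonneg(1)[of True 2] aug])
      case 1
      then have "p e 0 1 = 0" "p e 0 2 = 0" "p e 1 2 = 0" for e
        using F u[of e] nn'[of e] by linarith+
      then have "c = path_cell [0]"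
        using F 1 p[of False] c1F c0F c0T by (intro path) (auto simp: all_bool_eq)
      then show ?thesis by (auto simp: paths_def)
    next
      case 2
      then have P: "p e 0 1 = 1" "p e 0 2 = 0" "p e 1 2 = 0" for e
        using F u[of e] nn'[of e] by linarith+
      then have "c = path_cell [0, 1]"
        using F 2 p[of False] c1F c0F c0T by (intro path) (auto simp: all_bool_eq)
      then show ?thesis using P deg0[of False 0 1] by (auto simp: paths_def)
    next
      case 3
      have P: "p e 0 1 + p e 0 2 = 1" "p e 1 2 = p e 0 1" for e
        using F 3 u[of e] nn'[of e] by linarith+
      \<comment> \<open>Between 0 and 2 a nonzero q uses up the edge 02 of the 1-source, so only the
        direct edge, the broken path and the principal cell remain.\<close>
      consider "q False = 0" "p False 0 1 = 0" | "q False = 0" "p False 0 1 = 1" | "q False = 1" "p False 0 1 = 0"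
        using P[of True] P[of False] nn'[of True] nn'[of False] p[of False] nonneg(3)[of False] by linarith
      then show ?thesis
      proof cases
        case A: 1
        then have P': "p False 0 2 = 1" "p False 1 2 = 0" using P[of False] by auto
        then have "c = path_cell [0, 2]"
          using F 3 A c1F c0F c0T by (intro path) (auto simp: all_bool_eq)
        then show ?thesis using P' deg0[of False 0 2] by (auto simp: paths_def)
      next
        case A: 2
        then have P': "p False 0 2 = 0" "p False 1 2 = 1" using P[of False] by auto
        then have "c = path_cell [0, 1, 2]"
          using F 3 A c1F c0F c0T by (intro path) (auto simp: all_bool_eq)
        then show ?thesis using A deg0[of False 0 1] by (auto simp: paths_def)
      next
        case A: 3
        then have P': "p False 0 2 = 1" "p False 1 2 = 0" "p True 0 1 = 1" "p True 0 2 = 0" "p True 1 2 = 1" "q True = 1"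
          using P[of False] P[of True] p[of False] q by auto
        have "c = triangle_cell"
        proof (rule c_eq)
          show "c e 0 = triangle_cell e 0" for e
            using F 3 c0[of e] by (cases e) (auto simp: triangle_cell_def)
          show "c e 1 = triangle_cell e 1" for e
            using A P' c1[of e] by (cases e) (auto simp: triangle_cell_def)
          show "c e 2 = triangle_cell e 2" for e
            using A P' c2[of e] by (cases e) (auto simp: triangle_cell_def)
        qed (auto simp: triangle_cell_def)
        moreover have "2 \<le> m" using deg1[of False] A by (cases "m < 2") auto
        ultimately show ?thesis by blast
      qed
    qed
  next
    case F: 2
    show ?thesis
    proof (cases rule: unit_vector_cases[OF nonneg(1)[of True 0] nonneg(1)[of True 1] nonneg(1)[of True 2] aug])
      case 1
      then show ?thesis using F u[of False] nn'[of False] by linarith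
    next
      case 2
      then have "p e 0 1 = 0" "p e 0 2 = 0" "p e 1 2 = 0" for e
        using F u[of e] nn'[of e] by linarith+
      then have "c = path_cell [1]"
        using F 2 p[of False] c1F c0F c0T by (intro path) (auto simp: all_bool_eq)
      then show ?thesis by (auto simp: paths_def)
    next
      case 3
      then have P: "p e 0 1 = 0" "p e 0 2 = 0" "p e 1 2 = 1" for e
        using F u[of e] nn'[of e] by linarith+
      then have "c = path_cell [1, 2]"
        using F 3 p[of False] c1F c0F c0T by (intro path) (auto simp: all_bool_eq)
      then show ?thesis using P deg0[of False 1 2] by (auto simp: paths_def)
    qed
  next
    case F: 3
    show ?thesis
    proof (cases rule: unit_vector_cases[OF nonneg(1)[of True 0] nonneg(1)[of True 1] nonneg(1)[of True 2] aug])
      case 1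
      then show ?thesis using F u[of False] nn'[of False] by linarith
    next
      case 2
      then show ?thesis using F u[of False] nn'[of False] by linarith
    next
      case 3
      then have "p e 0 1 = 0" "p e 0 2 = 0" "p e 1 2 = 0" for e
        using F u[of e] nn'[of e] by linarith+
      then have "c = path_cell [2]"
        using F 3 p[of False] c1F c0F c0T by (intro path) (auto simp: all_bool_eq)
      then show ?thesis by (auto simp: paths_def)
    qed
  qed
qed

text \<open>The only distinct paths with the same ends are 0,2 and 0,1,2; the coefficient of the
  edge 02 separates them.\<close>

lemma path_cell_inj:
  assumes "l \<in> paths" "l' \<in> paths" "path_cell l = path_cell l'" shows "l = l'"
proof -
  have hd: "hd l = hd l'"
    using fun_cong[OF fun_cong[OF assms(3), of False], of 0] by (simp add: path_cell_def frag_of_eq)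
  have last: "last l = last l'"
    using fun_cong[OF fun_cong[OF assms(3), of True], of 0] by (simp add: path_cell_def frag_of_eq)
  have "path_chain l = path_chain l'"
    using fun_cong[OF fun_cong[OF assms(3), of True], of 1] by (simp add: path_cell_def)
  then have "Poly_Mapping.lookup (path_chain l) [0, 2] = Poly_Mapping.lookup (path_chain l') [0, 2]"
    by simp
  then show ?thesis
    using assms(1,2) hd last by (auto simp: paths_def lookup_add lookup_single when_def)
qed

lemma triangle_cell_ne_path_cell: "triangle_cell \<noteq> path_cell l"
proof
  assume "triangle_cell = path_cell l"
  from fun_cong[OF fun_cong[OF this, of True], of 2] show False
    by (simp add: path_cell_def triangle_cell_def)
qed

lemma otrunc_path_cell_0: "otrunc e 0 (path_cell l) = path_cell [if e then last l else hd l]"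
  by (auto simp: otrunc_def path_cell_def fun_eq_iff)

lemma otrunc_path_cell: "0 < k \<Longrightarrow> otrunc e k (path_cell l) = path_cell l"
  by (auto simp: otrunc_def path_cell_def fun_eq_iff)

lemma otrunc_triangle_cell:
  "otrunc e 0 triangle_cell = path_cell [if e then 2 else 0]"
  "otrunc e 1 triangle_cell = path_cell (if e then [0, 1, 2] else [0, 2])"
  "2 \<le> k \<Longrightarrow> otrunc e k triangle_cell = triangle_cell"
  by (auto simp: otrunc_def path_cell_def triangle_cell_def fun_eq_iff)

text \<open>In the first two cases one of the factors is a unit.\<close>

lemma oriental_2_composable:
  assumes "composable (oriental 2) m k c d"
  shows "c = otrunc True k d \<or> d = otrunc False k c \<or> k = 0 \<and> c = path_cell [1, 2] \<and> d = path_cell [0, 1]"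
proof -
  have cd: "c \<in> oriental_cells 2 m" "d \<in> oriental_cells 2 m" "otrunc False k c = otrunc True k d"
    using assms by (auto simp: composable_oriental)
  have single: "path_cell [i] = path_cell [j] \<Longrightarrow> i = j" for i j
    by (drule fun_cong[of _ _ True], drule fun_cong[of _ _ 0]) (simp add: path_cell_def frag_of_eq)
  have pc: "path_cell [0, 2] \<noteq> path_cell [0, 1, 2]"
    using path_cell_inj[of "[0, 2]" "[0, 1, 2]"] by (auto simp: paths_def)
  consider "k = 0" | "k = 1" | "2 \<le> k" by linarith
  then show ?thesis
  proof cases
    case 1
    from oriental_2_cases[OF cd(1)] oriental_2_cases[OF cd(2)]
    consider "c = triangle_cell" "d = triangle_cell" | l where "l \<in> paths" "c = path_cell l" "d = triangle_cell"
      | l where "l \<in> paths" "c = triangle_cell" "d = path_cell l"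
      | l l' where "l \<in> paths" "c = path_cell l" "l' \<in> paths" "d = path_cell l'"
      by blast
    then show ?thesis
    proof cases
      case A: 1
      then show ?thesis using cd(3) single[of 0 2] by (simp add: 1 otrunc_triangle_cell)
    next
      case A: 2
      then have "hd l = 2"
        using cd(3) single[of "hd l" 2] by (simp add: 1 otrunc_triangle_cell otrunc_path_cell_0)
      then show ?thesis using A 1 by (auto simp: paths_def otrunc_triangle_cell)
    next
      case A: 3
      then have "last l = 0"
        using cd(3) single[of 0 "last l"] by (simp add: 1 otrunc_triangle_cell otrunc_path_cell_0)
      then show ?thesis using A 1 by (auto simp: paths_def otrunc_triangle_cell)
    next
      case A: 4
      then have "hd l = last l'"
        using cd(3) single[of "hd l" "last l'"] by (simp add: 1 otrunc_path_cell_0)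
      then show ?thesis using A 1 by (auto simp: paths_def otrunc_path_cell_0)
    qed
  next
    case 2
    have "otrunc False 1 c = c \<or> c = triangle_cell" "otrunc True 1 d = d \<or> d = triangle_cell"
      using oriental_2_cases[OF cd(1)] oriental_2_cases[OF cd(2)] by (auto simp: otrunc_path_cell)
    \<comment> \<open>The principal cell is not 1-composable with itself, its 1-source and 1-target
      being different. So one of the two factors is its own truncation and acts as a unit.\<close>
    moreover have "\<not> (c = triangle_cell \<and> d = triangle_cell)"
      using cd(3) pc otrunc_triangle_cell(2)[of False] otrunc_triangle_cell(2)[of True]
      by (auto simp: 2 simp del: One_nat_def)
    ultimately show ?thesis using cd(3) 2 by auto
  next
    case 3
    have "otrunc False k c = c"
      using oriental_2_cases[OF cd(1)] 3 by (auto simp: otrunc_path_cell otrunc_triangle_cell)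
    then show ?thesis using cd(3) by simp
  qed
qed

lemma ocomp_oriental_unit:
  "c = otrunc True k d \<Longrightarrow> ocomp (oriental n) m k c d = d"
  "d = otrunc False k c \<Longrightarrow> ocomp (oriental n) m k c d = c"
proof -
  assume c: "c = otrunc True k d"
  then have "otrunc False k c = c" by (simp add: otrunc_otrunc_same)
  then show "ocomp (oriental n) m k c d = d" by simp
next
  assume "d = otrunc False k c"
  then show "ocomp (oriental n) m k c d = c" by (auto simp: fun_eq_iff)
qed

lemma ocomp_path_cell: "ocomp (oriental n) m 0 (path_cell [1, 2]) (path_cell [0, 1]) = path_cell [0, 1, 2]"
  by (auto simp: fun_eq_iff path_cell_def otrunc_def)

lemma principal_cell_0: "principal_cell 0 = path_cell [0]"
  by (auto simp: principal_cell_def path_cell_def fun_eq_iff)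

lemma edge_parts: "Poly_Mapping.map (\<lambda>c. max 0 (if e then c else - c)) (frag_of [1] - frag_of [0])
      = frag_of [if e then 1 else 0 :: nat]"
proof (rule poly_mapping_eqI)
  fix k :: "nat list"
  consider "k = [0]" | "k = [1]" | "k \<noteq> [0]" "k \<noteq> [1]" by blast
  then show "Poly_Mapping.lookup (Poly_Mapping.map (\<lambda>c. max 0 (if e then c else - c)) (frag_of [1] - frag_of [0])) k
    = Poly_Mapping.lookup (frag_of [if e then 1 else 0 :: nat]) k"
    by cases (cases e; simp add: Poly_Mapping.map.rep_eq lookup_minus lookup_single when_def)+
qed

lemma principal_cell_1: "principal_cell 1 = path_cell [0, 1]"
proof -
  have "[0..<Suc (Suc 0)] = [0, 1]" by simp
  then have p: "principal_part e (Suc 0) 0 = frag_of [0, 1]"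
    "principal_part e (Suc 0) (Suc 0) = frag_of [if e then 1 else 0]" for e
    by (simp_all only: principal_part.simps obdry_edge edge_parts)
  show ?thesis
  proof (intro ext)
    fix e and k :: nat
    consider "k = 0" | "k = 1" | "1 < k" by linarith
    then show "principal_cell 1 e k = path_cell [0, 1] e k"
      using p[of e] by cases (auto simp: principal_cell_def path_cell_def simp del: principal_part.simps)
  qed
qed

lemma path_cell_vertex_cells: "i \<le> n \<Longrightarrow> path_cell [i] \<in> oriental_cells n 0"
  by (rule oriental_cellsI) (auto simp: path_cell_def opositive_def obasis_def oaug_def lookup_single when_def)

lemma path_cell_edge_cells: "i < j \<Longrightarrow> j \<le> n \<Longrightarrow> path_cell [i, j] \<in> oriental_cells n 1"
  by (rule oriental_cellsI)
    (auto simp: path_cell_def opositive_def obasis_def oaug_def lookup_single when_def obdry_edge le_Suc_eq)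

lemma oriental_map_edge:
  "\<phi> i < \<phi> j \<Longrightarrow> oriental_map \<phi> (path_cell [i, j]) = path_cell [\<phi> i, \<phi> j]"
  by (auto simp: oriental_map_eq path_cell_def push_chain_frag_of fun_eq_iff)

lemma oriental_map_edge_const:
  "\<phi> i = \<phi> j \<Longrightarrow> oriental_map \<phi> (path_cell [i, j]) = path_cell [\<phi> i]"
  by (auto simp: oriental_map_eq path_cell_def push_chain_frag_of fun_eq_iff)

section \<open>Low-dimensional simplices of the nerve\<close>

lemma omega_categoryD:
  assumes "omega_category C"
  shows "x \<in> cells C (Suc n) \<Longrightarrow> osrc C n x \<in> cells C n"
    "x \<in> cells C (Suc n) \<Longrightarrow> otgt C n x \<in> cells C n"
    "x \<in> cells C (Suc (Suc n)) \<Longrightarrow> osrc C n (osrc C (Suc n) x) = osrc C n (otgt C (Suc n) x)"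
    "x \<in> cells C (Suc (Suc n)) \<Longrightarrow> otgt C n (osrc C (Suc n) x) = otgt C n (otgt C (Suc n) x)"
    "x \<in> cells C n \<Longrightarrow> ounit C n x \<in> cells C (Suc n)"
    "x \<in> cells C n \<Longrightarrow> osrc C n (ounit C n x) = x"
    "x \<in> cells C n \<Longrightarrow> otgt C n (ounit C n x) = x"
    "composable C n k x y \<Longrightarrow> ocomp C n k x y \<in> cells C n"
    "composable C (Suc n) n x y \<Longrightarrow> osrc C n (ocomp C (Suc n) n x y) = osrc C n y"
    "composable C (Suc n) n x y \<Longrightarrow> otgt C n (ocomp C (Suc n) n x y) = otgt C n x"
    "k < n \<Longrightarrow> composable C (Suc n) k x y \<Longrightarrow>
      osrc C n (ocomp C (Suc n) k x y) = ocomp C n k (osrc C n x) (osrc C n y)"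
    "k < n \<Longrightarrow> composable C (Suc n) k x y \<Longrightarrow>
      otgt C n (ocomp C (Suc n) k x y) = ocomp C n k (otgt C n x) (otgt C n y)"
    "k < n \<Longrightarrow> x \<in> cells C n \<Longrightarrow> ocomp C n k x (unit_to C k n (src_to C n k x)) = x"
    "k < n \<Longrightarrow> x \<in> cells C n \<Longrightarrow> ocomp C n k (unit_to C k n (tgt_to C n k x)) x = x"
    "composable C n k x y \<Longrightarrow> ounit C n (ocomp C n k x y) = ocomp C (Suc n) k (ounit C n x) (ounit C n y)"
  using assms unfolding omega_category_def by (elim conjE, simp)+

lemma unit_to_self [simp]: "unit_to C k k x = x"
  by (cases k) auto

lemma src_to_self [simp]: "src_to C k k x = x" and tgt_to_self [simp]: "tgt_to C k k x = x"
  by (cases k; simp)+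

lemma unit_to_cells:
  assumes "omega_category C" "x \<in> cells C k" "k \<le> n" shows "unit_to C k n x \<in> cells C n"
  using assms(3)
proof (induction n rule: dec_induct)
  case (step n)
  then show ?case using assms(1) by (simp add: omega_categoryD(5))
qed (simp add: assms(2))

lemma unit_to_src_tgt:
  assumes "omega_category C" "x \<in> cells C k" "k \<le> n"
  shows "osrc C n (unit_to C k (Suc n) x) = unit_to C k n x"
    "otgt C n (unit_to C k (Suc n) x) = unit_to C k n x"
  using unit_to_cells[OF assms] assms omega_categoryD(6,7)[OF assms(1)] by simp_all

lemma unit_to_ocomp:
  assumes C: "omega_category C" and xy: "composable C k j x y" and "k \<le> n"
  shows "composable C n j (unit_to C k n x) (unit_to C k n y) \<and>
    unit_to C k n (ocomp C k j x y) = ocomp C n j (unit_to C k n x) (unit_to C k n y)"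
  using \<open>k \<le> n\<close>
proof (induction n rule: dec_induct)
  case (step n)
  then have c: "composable C n j (unit_to C k n x) (unit_to C k n y)" by blast
  then have "composable C (Suc n) j (ounit C n (unit_to C k n x)) (ounit C n (unit_to C k n y))"
    using omega_categoryD(5,6,7)[OF C] by (auto simp: composable_def)
  then show ?case
    using step omega_categoryD(15)[OF C c] by simp
qed (simp add: xy)

text \<open>Stated for a family X compatible with units rather than for a functor, since it is also
  applied to a family under construction, before functoriality is known. The same c occurs on both
  sides because units in the orientals are identities.\<close>

lemma map_unit_to:
  assumes "\<And>m c. c \<in> oriental_cells n m \<Longrightarrow> X (Suc m) c = ounit C m (X m c)"
    and "c \<in> oriental_cells n k" "k \<le> m"
  shows "X m c = unit_to C k m (X k c)"
  using assms(3)
proof (induction m rule: dec_induct)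
  case (step m)
  then show ?case using assms(1)[of c m] oriental_cells_mono[OF step(1) assms(2)] by simp
qed simp

lemma map_src_tgt_to:
  assumes src: "\<And>m c. c \<in> oriental_cells n (Suc m) \<Longrightarrow> X m (otrunc False m c) = osrc C m (X (Suc m) c)"
    and tgt: "\<And>m c. c \<in> oriental_cells n (Suc m) \<Longrightarrow> X m (otrunc True m c) = otgt C m (X (Suc m) c)"
    and "c \<in> oriental_cells n m" "k < m"
  shows "X k (otrunc False k c) = src_to C m k (X m c) \<and> X k (otrunc True k c) = tgt_to C m k (X m c)"
  using assms(3,4)
proof (induction m arbitrary: c)
  case (Suc m)
  show ?case
  proof (cases "k = m")
    case True
    then show ?thesis using src tgt Suc.prems by simp
  next
    case False
    then have "k < m" using Suc.prems by simp
    moreover have "otrunc e m c \<in> oriental_cells n m" for e using otrunc_cells[OF Suc.prems(1)] by simp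
    ultimately show ?thesis
      using Suc.IH[of "otrunc False m c"] Suc.IH[of "otrunc True m c"] src tgt Suc.prems
      by (simp add: otrunc_otrunc)
  qed
qed simp

text \<open>The functor is defined by cases on the classification of cells. Compatibility with
  composition has a single nontrivial instance, the composite of 12 and 01, since in every other
  composable pair one factor is a unit.\<close>

lemma ex_nerve_2_simplex:
  assumes C: "omega_category C"
    and gf: "composable C 1 0 g f" and h: "h \<in> cells C 1"
    and h_src: "osrc C 0 h = osrc C 0 f" and h_tgt: "otgt C 0 h = otgt C 0 g"
    and \<alpha>: "is_arrow C 1 \<alpha> h (ocomp C 1 0 g f)"
  obtains X where "omega_functor (oriental 2) C X"
    "X 1 (path_cell [0, 1]) = f" "X 1 (path_cell [1, 2]) = g" "X 1 (path_cell [0, 2]) = h"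
    "X 0 (path_cell [0]) = osrc C 0 f"
proof -
  note Cd = omega_categoryD[OF C]
  have f: "f \<in> cells C 1" and g: "g \<in> cells C 1" and gf_eq: "osrc C 0 g = otgt C 0 f"
    using gf by (auto simp: composable_def)
  have gf_cell: "ocomp C 1 0 g f \<in> cells C 1" using Cd(8)[OF gf] .
  have gf_src: "osrc C 0 (ocomp C 1 0 g f) = osrc C 0 f" "otgt C 0 (ocomp C 1 0 g f) = otgt C 0 g"
    using Cd(9,10)[of 0 g f] gf by simp_all
  have \<alpha>_cell: "\<alpha> \<in> cells C 2" and \<alpha>_src: "osrc C 1 \<alpha> = h" "otgt C 1 \<alpha> = ocomp C 1 0 g f"
    using \<alpha> by (auto simp: is_arrow_def numeral_2_eq_2)
  define V where "V i = (if i = 0 then osrc C 0 f else if i = 1 then otgt C 0 f else otgt C 0 g)" for i :: nat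
  \<comment> \<open>Vertices receive their units here, so that \<open>unit_to C 1 m (Y l)\<close> is
    the right value on every path in every positive dimension m; dimension 0 is served by V.\<close>
  define Y where "Y l = (if l = [0, 1] then f else if l = [1, 2] then g else if l = [0, 2] then h
    else if l = [0, 1, 2] then ocomp C 1 0 g f else ounit C 0 (V (hd l)))" for l :: "nat list"
  define P where "P c = (THE l. l \<in> paths \<and> c = path_cell l)" for c
  define X where "X m c = (if c \<in> oriental_cells 2 m then if c = triangle_cell then unit_to C 2 m \<alpha>
    else if m = 0 then V (hd (P c)) else unit_to C 1 m (Y (P c)) else undefined)" for m c
  have P: "P (path_cell l) = l" if "l \<in> paths" for l
    unfolding P_def using that path_cell_inj by blast
  have V: "V i \<in> cells C 0" for i
    using f g Cd(1,2)[of _ 0] by (simp add: V_def)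
  have Y: "Y l \<in> cells C 1" "osrc C 0 (Y l) = V (hd l)" "otgt C 0 (Y l) = V (last l)" if "l \<in> paths" for l
    using that f g h gf_cell h_src h_tgt gf_src gf_eq Cd(5,6,7)[of _ 0] V unfolding paths_def
    by (auto simp: Y_def) (auto simp: V_def)
  have X_path: "X m (path_cell l) = (if m = 0 then V (hd l) else unit_to C 1 m (Y l))"
    if "path_cell l \<in> oriental_cells 2 m" "l \<in> paths" for m l
    using that P[OF that(2)] triangle_cell_ne_path_cell[of l] by (auto simp: X_def)
  have X_triangle: "X m triangle_cell = unit_to C 2 m \<alpha>" if "triangle_cell \<in> oriental_cells 2 m" for m
    using that by (simp add: X_def)
  have cases: thesis
    if "c \<in> oriental_cells 2 m" "c = triangle_cell \<Longrightarrow> 2 \<le> m \<Longrightarrow> thesis"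
      "\<And>l. l \<in> paths \<Longrightarrow> c = path_cell l \<Longrightarrow> (m = 0 \<longrightarrow> tl l = []) \<Longrightarrow> thesis" for c m thesis
    using oriental_2_cases[OF that(1)] that(2,3) by blast
  have X_cell: "X m c \<in> cells C m" if "c \<in> oriental_cells 2 m" for m c
    using that
  proof (cases rule: cases[consumes 1])
    case 1
    then show ?thesis using that unit_to_cells[OF C \<alpha>_cell] by (simp add: X_triangle)
  next
    case (2 l)
    then show ?thesis using that unit_to_cells[OF C Y(1)[OF 2(1)], of m] V by (auto simp: X_path)
  qed
  have X_boundary: "X m (otrunc e m c) = (if e then otgt C m (X (Suc m) c) else osrc C m (X (Suc m) c))"
    if c: "c \<in> oriental_cells 2 (Suc m)" for m c e
  proof -
    have ct: "otrunc e m c \<in> oriental_cells 2 m" using otrunc_cells[OF c] by simp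
    show ?thesis
      using c
    proof (cases rule: cases[consumes 1])
      case 1
      show ?thesis
      proof (cases "m = 1")
        case True
        have "[0, 2] \<in> paths" "[0, 1, 2] \<in> paths" by (auto simp: paths_def)
        then have "X 1 (path_cell (if e then [0, 1, 2] else [0, 2])) = (if e then ocomp C 1 0 g f else h)"
          using ct unfolding 1 True otrunc_triangle_cell(2) by (subst X_path) (auto simp: Y_def)
        then show ?thesis
          using c \<alpha>_src unfolding 1 True otrunc_triangle_cell(2) by (simp add: X_triangle numeral_2_eq_2)
      next
        case False
        then have "2 \<le> m" using 1 by simp
        then show ?thesis
          using ct c unit_to_src_tgt[OF C \<alpha>_cell, of m]
          by (simp add: 1 otrunc_triangle_cell X_triangle)
      qed
    next
      case (2 l)
      show ?thesis
      proof (cases "m = 0")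
        case True
        have "[if e then last l else hd l] \<in> paths" using 2(1) by (auto simp: paths_def)
        then have "X 0 (path_cell [if e then last l else hd l]) = V (if e then last l else hd l)"
          using ct unfolding 2(2) True otrunc_path_cell_0 by (subst X_path) auto
        then show ?thesis
          using c Y(2,3)[OF 2(1)] unfolding 2(2) True otrunc_path_cell_0
          by (simp add: X_path 2(1))
      next
        case False
        then show ?thesis
          using ct c 2 unit_to_src_tgt[OF C Y(1)[OF 2(1)], of m]
          by (simp add: otrunc_path_cell X_path)
      qed
    qed
  qed
  have X_unit: "X (Suc m) c = ounit C m (X m c)" if c: "c \<in> oriental_cells 2 m" for m c
  proof -
    have c': "c \<in> oriental_cells 2 (Suc m)" using oriental_cells_Suc[OF c] .
    show ?thesis
      using c
    proof (cases rule: cases[consumes 1])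
      case 1
      then show ?thesis using c c' by (simp add: X_triangle)
    next
      case (2 l)
      then show ?thesis
        using c c' by (cases "m = 0") (auto simp: X_path Y_def paths_def)
    qed
  qed
  have X_src: "X k (otrunc False k c) = src_to C m k (X m c)"
    and X_tgt: "X k (otrunc True k c) = tgt_to C m k (X m c)"
    if "c \<in> oriental_cells 2 m" "k < m" for m k c
    using map_src_tgt_to[of 2 X C, OF _ _ that] X_boundary by simp_all
  have X_unit_to: "X m c = unit_to C k m (X k c)" if "c \<in> oriental_cells 2 k" "k \<le> m" for m k c
    using map_unit_to[of 2 X C, OF X_unit that] .
  have X_comp: "X m (ocomp (oriental 2) m k c d) = ocomp C m k (X m c) (X m d)"
    if cd: "composable (oriental 2) m k c d" for m k c d
  proof -
    have km: "k < m" and c: "c \<in> oriental_cells 2 m" and d: "d \<in> oriental_cells 2 m"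
      using cd by (auto simp: composable_oriental)
    have "otrunc e k c \<in> oriental_cells 2 k" "otrunc e k d \<in> oriental_cells 2 k" for e
      using otrunc_cells[OF c] otrunc_cells[OF d] km by auto
    note trunc = this
    from oriental_2_composable[OF cd]
    consider "c = otrunc True k d" | "d = otrunc False k c" | "k = 0" "c = path_cell [1, 2]" "d = path_cell [0, 1]"
      by blast
    then show ?thesis
    proof cases
      case 1
      have "X m c = unit_to C k m (tgt_to C m k (X m d))"
        using X_unit_to[OF trunc(2)[of True], of m] X_tgt[OF d km] km 1 by simp
      then have "ocomp C m k (X m c) (X m d) = X m d"
        using Cd(14)[OF km X_cell[OF d]] by simp
      then show ?thesis unfolding ocomp_oriental_unit(1)[OF 1] by simp
    next
      case 2
      have "X m d = unit_to C k m (src_to C m k (X m c))"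
        using X_unit_to[OF trunc(1)[of False], of m] X_src[OF c km] km 2 by simp
      then have "ocomp C m k (X m c) (X m d) = X m c"
        using Cd(13)[OF km X_cell[OF c]] by simp
      then show ?thesis unfolding ocomp_oriental_unit(2)[OF 2] by simp
    next
      case 3
      have "path_cell [0, 1, 2] \<in> oriental_cells 2 m"
        using ocomp_oriental_cells[OF cd] unfolding 3 ocomp_path_cell .
      then have "X m (path_cell [0, 1, 2]) = unit_to C 1 m (ocomp C 1 0 g f)"
        using km by (simp add: X_path paths_def Y_def)
      moreover have "X m c = unit_to C 1 m g" "X m d = unit_to C 1 m f"
        using c d km by (simp_all add: X_path paths_def Y_def 3)
      ultimately show ?thesis
        using unit_to_ocomp[OF C gf, of m] km unfolding 3 ocomp_path_cell by simp
    qed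
  qed
  show thesis
  proof
    show "omega_functor (oriental 2) C X"
      unfolding omega_functor_def
    proof (intro conjI allI ballI impI)
      fix m show "X m \<in> cells (oriental 2) m \<rightarrow>\<^sub>E cells C m"
        using X_cell by (auto simp: X_def)
    next
      fix m c assume "c \<in> cells (oriental 2) (Suc m)"
      then show "X m (osrc (oriental 2) m c) = osrc C m (X (Suc m) c)"
        "X m (otgt (oriental 2) m c) = otgt C m (X (Suc m) c)"
        using X_boundary[of c m] by simp_all
    next
      fix m c assume "c \<in> cells (oriental 2) m"
      then show "X (Suc m) (ounit (oriental 2) m c) = ounit C m (X m c)" using X_unit by simp
    qed (rule X_comp)
    show "X 1 (path_cell [0, 1]) = f" "X 1 (path_cell [1, 2]) = g" "X 1 (path_cell [0, 2]) = h"
      using path_cell_edge_cells[of 0 1 2] path_cell_edge_cells[of 1 2 2] path_cell_edge_cells[of 0 2 2]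
      by (subst X_path; simp add: paths_def Y_def)+
    show "X 0 (path_cell [0]) = osrc C 0 f"
      using path_cell_vertex_cells[of 0 2] by (subst X_path) (simp_all add: paths_def V_def)
  qed
qed

text \<open>The cells of these orientals lie among those of the oriental of dimension 2, so the
  classification there applies; ending at a vertex at most n excludes the triangle and all paths
  through 2. What is left are vertices, the principal edge when n = 1, and their units; in that case
  the vertices are the ends of the edge.\<close>

lemma nerve_simplex_eqI:
  assumes x: "omega_functor (oriental n) C x" and y: "omega_functor (oriental n) C y"
    and n: "n \<le> 1" and eq: "x n (principal_cell n) = y n (principal_cell n)"
  shows "x = y"
proof (intro ext)
  fix k c
  note xD = omega_functorD[OF x, simplified] and yD = omega_functorD[OF y, simplified]
  have vertex: "x 0 (path_cell [i]) = y 0 (path_cell [i])" if "i \<le> n" for i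
  proof (cases "n = 0")
    case True
    then show ?thesis using eq that by (simp add: principal_cell_0)
  next
    case False
    then have n1: "n = 1" using n by simp
    have e: "path_cell [0, 1] \<in> oriental_cells n (Suc 0)"
      using path_cell_edge_cells[of 0 1 n] n1 by simp
    have "x 0 (otrunc True 0 (path_cell [0, 1])) = y 0 (otrunc True 0 (path_cell [0, 1]))"
      "x 0 (otrunc False 0 (path_cell [0, 1])) = y 0 (otrunc False 0 (path_cell [0, 1]))"
      using xD(3,4)[OF e] yD(3,4)[OF e] eq by (simp_all add: n1 principal_cell_1[simplified])
    moreover have "i = 0 \<or> i = 1" using that n1 by auto
    ultimately show ?thesis by (auto simp: otrunc_path_cell_0)
  qed
  show "x k c = y k c"
  proof (cases "c \<in> oriental_cells n k")
    case False
    then show ?thesis using xD(2) yD(2) by simp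
  next
    case c: True
    have xu: "x k d = unit_to C j k (x j d)" and yu: "y k d = unit_to C j k (y j d)"
      if "d \<in> oriental_cells n j" "j \<le> k" for d j
      using map_unit_to[of n x C, OF _ that] map_unit_to[of n y C, OF _ that] xD(5) yD(5) by auto
    have "Poly_Mapping.keys (c True 0) \<subseteq> obasis n 0" using keys_oriental_cell[OF c] .
    then have last: "i \<le> n" if "c True 0 = frag_of [i]" for i
      using that by (auto simp: obasis_def)
    have "c \<in> oriental_cells 2 k" using oriental_cells_subset[of n 2] n c by auto
    from oriental_2_cases[OF this] obtain l where l: "l \<in> paths" "c = path_cell l" "k = 0 \<longrightarrow> tl l = []"
    proof (elim disjE conjE bexE)
      assume "c = triangle_cell"
      then show thesis using last[of 2] n by (simp add: triangle_cell_def)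
    qed
    have "last l \<le> n" using last[of "last l"] l(2) by (simp add: path_cell_def)
    then consider i where "i \<le> n" "l = [i]" | "n = 1" "l = [0, 1]"
      using l(1) n by (auto simp: paths_def)
    then show ?thesis
    proof cases
      case (1 i)
      then show ?thesis
        using xu[OF path_cell_vertex_cells[OF 1(1)]] yu[OF path_cell_vertex_cells[OF 1(1)]] vertex[OF 1(1)] l(2)
        by simp
    next
      case 2
      have "1 \<le> k" using l(3) 2 by (cases k) auto
      then show ?thesis
        using xu[of "path_cell [0, 1]" 1] yu[of "path_cell [0, 1]" 1] path_cell_edge_cells[of 0 1 n] eq 2 l(2)
        by (simp add: principal_cell_1[simplified])
    qed
  qed
qed

section \<open>Quotients of free abelian groups\<close>

definition free_class :: "'g set \<Rightarrow> ('g \<Rightarrow>\<^sub>0 int) set \<Rightarrow> ('g \<Rightarrow>\<^sub>0 int) \<Rightarrow> ('g \<Rightarrow>\<^sub>0 int) set" where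
  "free_class S R a = generate (free_Abelian_group S) R #>\<^bsub>free_Abelian_group S\<^esub> a"

lemma subgroup_free_Abelian_groupI:
  assumes "\<And>a. a \<in> U \<Longrightarrow> Poly_Mapping.keys a \<subseteq> S" "0 \<in> U" "\<And>a b. a \<in> U \<Longrightarrow> b \<in> U \<Longrightarrow> a - b \<in> U"
  shows "subgroup U (free_Abelian_group S)"
proof -
  have neg: "- a \<in> U" if "a \<in> U" for a using assms(3)[OF assms(2) that] by simp
  have "a + b \<in> U" if "a \<in> U" "b \<in> U" for a b using assms(3)[OF that(1) neg[OF that(2)]] by simp
  then show ?thesis
    using assms neg by (auto simp: subgroup_def)
qed

lemma subgroup_free_Abelian_groupD:
  assumes "subgroup U (free_Abelian_group S)"
  shows "a \<in> U \<Longrightarrow> Poly_Mapping.keys a \<subseteq> S" "0 \<in> U" "a \<in> U \<Longrightarrow> b \<in> U \<Longrightarrow> a + b \<in> U"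
    "a \<in> U \<Longrightarrow> b \<in> U \<Longrightarrow> a - b \<in> U" "a \<in> U \<Longrightarrow> - a \<in> U"
proof -
  note U = subgroup.mem_carrier[OF assms] subgroup.one_closed[OF assms] subgroup.m_closed[OF assms]
    subgroup.m_inv_closed[OF assms]
  show keys: "a \<in> U \<Longrightarrow> Poly_Mapping.keys a \<subseteq> S" for a
    using U(1)[of a] unfolding carrier_free_Abelian_group_iff .
  show "0 \<in> U" using U(2) by simp
  show add: "a \<in> U \<Longrightarrow> b \<in> U \<Longrightarrow> a + b \<in> U" for a b using U(3)[of a b] by simp
  show neg: "a \<in> U \<Longrightarrow> - a \<in> U" for a using U(4)[of a] keys[of a] by simp
  show "a \<in> U \<Longrightarrow> b \<in> U \<Longrightarrow> a - b \<in> U" using add[OF _ neg] by simp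
qed

lemma subgroup_vimage_frag_extend:
  assumes "subgroup U (free_Abelian_group S')"
  shows "subgroup {a. Poly_Mapping.keys a \<subseteq> S \<and> frag_extend \<phi> a \<in> U} (free_Abelian_group S)"
proof (rule subgroup_free_Abelian_groupI)
  fix a b
  assume "a \<in> {a. Poly_Mapping.keys a \<subseteq> S \<and> frag_extend \<phi> a \<in> U}"
    "b \<in> {a. Poly_Mapping.keys a \<subseteq> S \<and> frag_extend \<phi> a \<in> U}"
  then show "a - b \<in> {a. Poly_Mapping.keys a \<subseteq> S \<and> frag_extend \<phi> a \<in> U}"
    using keys_diff[of a b] subgroup_free_Abelian_groupD(4)[OF assms, of "frag_extend \<phi> a" "frag_extend \<phi> b"]
    by (auto simp: frag_extend_diff)
qed (use subgroup_free_Abelian_groupD(2)[OF assms] in auto)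

lemma frag_extend_mem:
  assumes "subgroup U (free_Abelian_group S')" "\<And>s. s \<in> S \<Longrightarrow> \<phi> s \<in> U" "Poly_Mapping.keys a \<subseteq> S"
  shows "frag_extend \<phi> a \<in> U"
  using assms(3)
proof (induction a rule: frag_induction)
  case (diff a b)
  then show ?case using subgroup_free_Abelian_groupD(4)[OF assms(1)] by (simp add: frag_extend_diff)
qed (use subgroup_free_Abelian_groupD(2)[OF assms(1)] assms(2) in auto)

locale free_quotient =
  fixes S :: "'g set" and R :: "('g \<Rightarrow>\<^sub>0 int) set"
  assumes rels: "r \<in> R \<Longrightarrow> Poly_Mapping.keys r \<subseteq> S"
begin

abbreviation N where "N \<equiv> generate (free_Abelian_group S) R"

lemma subgroup_N: "subgroup N (free_Abelian_group S)"
  by (rule group.generate_is_subgroup) (auto dest: rels)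

lemma normal_N: "N \<lhd> free_Abelian_group S"
  using comm_group.subgroup_imp_normal[OF abelian_free_Abelian_group subgroup_N] .

lemma N_subset:
  assumes "subgroup U (free_Abelian_group S)" "R \<subseteq> U" shows "N \<subseteq> U"
  using group.generate_subgroup_incl[OF group_free_Abelian_group assms(2,1)] .

lemma rel_in_N: "r \<in> R \<Longrightarrow> r \<in> N"
  by (rule generate.incl)

lemma carrier_free_quot: "carrier (free_quot S R) = free_class S R ` {a. Poly_Mapping.keys a \<subseteq> S}"
  by (auto simp: free_quot_def carrier_FactGroup free_class_def)

lemma free_class_mult:
  "Poly_Mapping.keys a \<subseteq> S \<Longrightarrow> Poly_Mapping.keys b \<subseteq> S \<Longrightarrow>
   free_class S R a \<otimes>\<^bsub>free_quot S R\<^esub> free_class S R b = free_class S R (a + b)"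
  using normal.rcos_sum[OF normal_N, of a b] by (simp add: free_quot_def free_class_def)

lemma free_class_eq_iff:
  assumes "Poly_Mapping.keys a \<subseteq> S" "Poly_Mapping.keys b \<subseteq> S"
  shows "free_class S R a = free_class S R b \<longleftrightarrow> a - b \<in> N"
proof -
  interpret group "free_Abelian_group S" by simp
  have ab: "a \<in> carrier (free_Abelian_group S)" "b \<in> carrier (free_Abelian_group S)"
    using assms by simp_all
  have "N #>\<^bsub>free_Abelian_group S\<^esub> a = N #>\<^bsub>free_Abelian_group S\<^esub> b
      \<longleftrightarrow> a \<in> N #>\<^bsub>free_Abelian_group S\<^esub> b"
    using rcos_self[OF ab(1) subgroup_N] repr_independence[OF _ ab(2) subgroup_N] by blast
  also have "\<dots> \<longleftrightarrow> (\<exists>n\<in>N. a = n + b)"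
    by (simp add: r_coset_def)
  also have "\<dots> \<longleftrightarrow> a - b \<in> N"
    by (metis add_diff_cancel_right' diff_add_cancel)
  finally show ?thesis by (simp add: free_class_def)
qed

lemma free_class_zero: "free_class S R 0 = \<one>\<^bsub>free_quot S R\<^esub>"
  using group.coset_mult_one[OF group_free_Abelian_group, of N S] subgroup.subset[OF subgroup_N]
  by (simp add: free_class_def free_quot_def)

lemma free_class_self: "Poly_Mapping.keys a \<subseteq> S \<Longrightarrow> a \<in> free_class S R a"
  unfolding free_class_def using group.rcos_self[OF group_free_Abelian_group _ subgroup_N] by simp

lemma mem_free_class: "b \<in> free_class S R a \<Longrightarrow> b - a \<in> N"
  by (auto simp: free_class_def r_coset_def)

end

text \<open>The preimage of the second relation subgroup under \<open>frag_extend\<close> is a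
  subgroup containing R, hence everything generated by R. So the image of a coset lies in one coset,
  and the \<open>the_elem\<close> in \<open>free_quot_map\<close> is well defined.\<close>

lemma free_quot_map_free_class:
  assumes "free_quotient S R" "free_quotient S' R'"
    and gens: "\<And>s. s \<in> S \<Longrightarrow> Poly_Mapping.keys (\<phi> s) \<subseteq> S'"
    and rels: "\<And>r. r \<in> R \<Longrightarrow> frag_extend \<phi> r \<in> generate (free_Abelian_group S') R'"
    and a: "Poly_Mapping.keys a \<subseteq> S"
  shows "free_quot_map S R S' R' \<phi> (free_class S R a) = free_class S' R' (frag_extend \<phi> a)"
proof -
  interpret Q: free_quotient S R by fact
  interpret Q': free_quotient S' R' by fact
  have keys: "Poly_Mapping.keys (frag_extend \<phi> b) \<subseteq> S'" if "Poly_Mapping.keys b \<subseteq> S" for b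
    using keys_frag_extend[of \<phi> b] gens that by blast
  have N: "frag_extend \<phi> b \<in> Q'.N" if "b \<in> Q.N" for b
    using Q.N_subset[OF subgroup_vimage_frag_extend[OF Q'.subgroup_N], of \<phi>] Q.rels rels that by blast
  have "free_class S' R' (frag_extend \<phi> b) = free_class S' R' (frag_extend \<phi> a)"
    if b: "b \<in> free_class S R a" for b
  proof -
    have ba: "b - a \<in> Q.N" using Q.mem_free_class[OF b] .
    have "Poly_Mapping.keys ((b - a) + a) \<subseteq> S"
      using keys_add[of "b - a" a] subgroup_free_Abelian_groupD(1)[OF Q.subgroup_N ba] a by blast
    then have "Poly_Mapping.keys b \<subseteq> S" by simp
    then show ?thesis
      using N[OF ba] keys a by (simp add: Q'.free_class_eq_iff frag_extend_diff)
  qed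
  then have "(\<lambda>a. free_class S' R' (frag_extend \<phi> a)) ` free_class S R a = {free_class S' R' (frag_extend \<phi> a)}"
    using Q.free_class_self[OF a] by (intro equalityI subsetI) (blast, blast)
  moreover have "free_class S R a \<in> carrier (free_quot S R)"
    using a by (auto simp: Q.carrier_free_quot)
  ultimately show ?thesis
    by (simp add: free_quot_map_def free_class_def)
qed


section \<open>Comparison in low degrees\<close>

type_synonym 'a free_chain = "('a + 'a osimplex) \<Rightarrow>\<^sub>0 int"

lemma src_to_otgt:
  assumes "omega_category C" "x \<in> cells C (Suc n)" "k < n"
  shows "src_to C n k (otgt C n x) = src_to C n k (osrc C n x)"
    "tgt_to C n k (osrc C n x) = tgt_to C n k (otgt C n x)"
  using assms omega_categoryD(3,4)[OF assms(1)] by (cases n; simp)+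

lemma composable_src_tgt:
  assumes C: "omega_category C" and xy: "composable C (Suc n) k x y" and "k < n"
  shows "composable C n k (osrc C n x) (osrc C n y)" "composable C n k (otgt C n x) (otgt C n y)"
  using xy \<open>k < n\<close> omega_categoryD(1,2)[OF C] src_to_otgt[OF C _ \<open>k < n\<close>] by (auto simp: composable_def)

locale low_degrees =
  fixes C :: "'a ocat"
  assumes C: "omega_category C"
begin

abbreviation KG :: "nat \<Rightarrow> ('a + 'a osimplex) set" where "KG \<equiv> kappa_gens (nerve C)"
abbreviation KR :: "nat \<Rightarrow> 'a free_chain set" where "KR \<equiv> kappa_rels (nerve C)"
abbreviation LG :: "nat \<Rightarrow> ('a + 'a osimplex) set" where "LG \<equiv> lam_gens C"
abbreviation LR :: "nat \<Rightarrow> 'a free_chain set" where "LR \<equiv> lam_rels C"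
abbreviation K :: "'a chains chcx" where "K \<equiv> kappa (nerve C)"
abbreviation L :: "'a chains chcx" where "L \<equiv> lam C"

lemma degenerate_simps: "degenerate (nerve C) n \<subseteq> simps (nerve C) n"
  using sact_nerve_simps[of _ C] by (fastforce simp: degenerate_def simp del: nerve_sel(2))

sublocale KQ: free_quotient "KG n" "KR n" for n
  using degenerate_simps[of n] by unfold_locales (auto simp: kappa_rels_def kappa_gens_def)

sublocale LQ: free_quotient "LG n" "LR n" for n
proof
  fix r assume "r \<in> LR n"
  then obtain k x y where r: "r = frag_of (Inl (ocomp C n k x y)) - (frag_of (Inl x) + frag_of (Inl y))"
    and xy: "composable C n k x y"
    by (auto simp: lam_rels_def)
  have "x \<in> cells C n" "y \<in> cells C n" "ocomp C n k x y \<in> cells C n"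
    using xy omega_categoryD(8)[OF C xy] by (auto simp: composable_def)
  then show "Poly_Mapping.keys r \<subseteq> LG n"
    unfolding r lam_gens_def
    by (intro order_trans[OF keys_diff] Un_least order_trans[OF Poly_Mapping.keys_add]) auto
qed

lemma cgrp_K: "cgrp K n = free_quot (KG n) (KR n)"
  by (simp add: kappa_def)

lemma cgrp_L: "cgrp L n = free_quot (LG n) (LR n)"
  by (simp add: lam_def)

definition lam_bdry :: "nat \<Rightarrow> 'a free_chain \<Rightarrow> 'a free_chain" where
  "lam_bdry n = frag_extend (case_sum (\<lambda>x. frag_of (Inl (otgt C n x)) - frag_of (Inl (osrc C n x))) (\<lambda>_. 0))"

lemma lam_rel_mem: "composable C n k x y \<Longrightarrow>
    frag_of (Inl (ocomp C n k x y)) - (frag_of (Inl x) + frag_of (Inl y)) \<in> LQ.N n"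
  by (rule LQ.rel_in_N) (auto simp: lam_rels_def)

text \<open>What needs proof is that the boundary of a relation x *_k y ~ x + y follows from the
  relations one degree lower. For k = n it vanishes outright, the source of x cancelling the target
  of y; for k < n it is the difference of the relation for the targets and the one for the
  sources.\<close>

lemma cdiff_L:
  assumes "Poly_Mapping.keys a \<subseteq> LG (Suc n)"
  shows "cdiff L n (free_class (LG (Suc n)) (LR (Suc n)) a) = free_class (LG n) (LR n) (lam_bdry n a)"
  unfolding lam_def ocat.simps chcx.simps lam_bdry_def
proof (rule free_quot_map_free_class[OF LQ.free_quotient_axioms LQ.free_quotient_axioms _ _ assms])
  fix s assume "s \<in> LG (Suc n)"
  then show "Poly_Mapping.keys (case s of Inl x \<Rightarrow> frag_of (Inl (otgt C n x)) - frag_of (Inl (osrc C n x)) | Inr _ \<Rightarrow> 0) \<subseteq> LG n"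
    using omega_categoryD(1,2)[OF C, of _ n] by (auto simp: lam_gens_def dest!: subsetD[OF keys_diff])
next
  note N = subgroup_free_Abelian_groupD[OF LQ.subgroup_N[of n]]
  fix r assume "r \<in> LR (Suc n)"
  then obtain k x y where r: "r = frag_of (Inl (ocomp C (Suc n) k x y)) - (frag_of (Inl x) + frag_of (Inl y))"
    and xy: "composable C (Suc n) k x y"
    by (auto simp: lam_rels_def)
  let ?b = "\<lambda>x. frag_of (Inl (otgt C n x)) - frag_of (Inl (osrc C n x)) :: 'a free_chain"
  have "?b (ocomp C (Suc n) k x y) - (?b x + ?b y) \<in> LQ.N n"
  proof (cases "k = n")
    case True
    have "osrc C n x = otgt C n y" using xy True by (simp add: composable_def)
    then show ?thesis
      using omega_categoryD(9,10)[OF C xy[unfolded True]] N(2) by (simp add: True)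
  next
    case False
    then have k: "k < n" using xy by (simp add: composable_def)
    have "(frag_of (Inl (ocomp C n k (otgt C n x) (otgt C n y))) - (frag_of (Inl (otgt C n x)) + frag_of (Inl (otgt C n y))))
        - (frag_of (Inl (ocomp C n k (osrc C n x) (osrc C n y))) - (frag_of (Inl (osrc C n x)) + frag_of (Inl (osrc C n y)))) \<in> LQ.N n"
      using composable_src_tgt[OF C xy k] by (intro N(4) lam_rel_mem)
    then show ?thesis
      using omega_categoryD(11,12)[OF C k xy] by (simp add: algebra_simps)
  qed
  then show "frag_extend (case_sum ?b (\<lambda>_. 0)) r \<in> LQ.N n"
    by (simp add: r frag_extend_diff frag_extend_add)
qed

section \<open>Faces of triangles and degenerate simplices in the nerve\<close>

definition kap_bdry :: "nat \<Rightarrow> 'a free_chain \<Rightarrow> 'a free_chain" where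
  "kap_bdry n = frag_extend (case_sum (\<lambda>_. 0) (\<lambda>x. \<Sum>i\<le>Suc n. frag_cmul ((-1) ^ i)
      (frag_of (Inr (sact (nerve C) n (Suc n) (coface i) x)))))"

lemma mono_coface: "mono_map n (Suc n) (coface i)"
  by (auto simp: mono_map_def coface_def monotone_on_def)

text \<open>A map [1] -> [m] with equal end values factors through [0].\<close>

lemma const_edge_degenerate:
  assumes y: "y \<in> simps (nerve C) m" and \<tau>: "\<tau> 0 = \<tau> 1" "\<tau> 0 \<le> m"
  shows "sact (nerve C) 1 m \<tau> y \<in> degenerate (nerve C) 1"
proof -
  have m: "mono_map 1 0 (\<lambda>_. 0)" "mono_map 0 m (\<lambda>_. \<tau> 0)"
    using \<tau> by (auto simp: mono_map_def monotone_on_def)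
  have "sact (nerve C) 1 m \<tau> y = sact (nerve C) 1 m ((\<lambda>_. \<tau> 0) \<circ> (\<lambda>_. 0 :: nat)) y"
    by (rule sact_nerve_cong) (use \<tau> in \<open>auto simp: le_Suc_eq\<close>)
  also have "\<dots> = sact (nerve C) 1 0 (\<lambda>_. 0) (sact (nerve C) 0 m (\<lambda>_. \<tau> 0) y)"
    by (rule sact_sact_nerve[OF m, symmetric])
  finally show ?thesis
    using m y sact_nerve_simps[OF _ m(2), of C y] unfolding degenerate_def nerve_sel(1) by blast
qed

lemma degenerate_edge_mem: "x \<in> degenerate (nerve C) n \<Longrightarrow> frag_of (Inr x) \<in> KQ.N n"
  by (rule KQ.rel_in_N) (auto simp: kappa_rels_def)

text \<open>A degenerate triangle has two equal edges, which cancel in the boundary, and a degenerate one.\<close>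

lemma cdiff_K_1:
  assumes "Poly_Mapping.keys a \<subseteq> KG 2"
  shows "cdiff K 1 (free_class (KG 2) (KR 2) a) = free_class (KG 1) (KR 1) (kap_bdry 1 a)"
proof -
  let ?f = "\<lambda>i x. frag_of (Inr (sact (nerve C) 1 2 (coface i) x)) :: 'a free_chain"
  have sum: "(\<Sum>i\<le>Suc 1. frag_cmul ((-1) ^ i) (?f i x)) = ?f 0 x - ?f 1 x + ?f 2 x" for x
    by (simp add: numeral_2_eq_2)
  have "free_quot_map (KG (Suc 1)) (KR (Suc 1)) (KG 1) (KR 1) (case_sum (\<lambda>_. 0) (\<lambda>x. \<Sum>i\<le>Suc 1. frag_cmul ((-1) ^ i)
      (frag_of (Inr (sact (nerve C) 1 (Suc 1) (coface i) x))))) (free_class (KG (Suc 1)) (KR (Suc 1)) a)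
    = free_class (KG 1) (KR 1) (kap_bdry 1 a)"
    unfolding kap_bdry_def
  proof (rule free_quot_map_free_class[OF KQ.free_quotient_axioms KQ.free_quotient_axioms])
    show "Poly_Mapping.keys a \<subseteq> KG (Suc 1)" using assms by (simp add: numeral_2_eq_2)
  next
    fix s :: "'a + 'a osimplex" assume "s \<in> KG (Suc 1)"
    then obtain x where s: "s = Inr x" and x: "omega_functor (oriental (Suc 1)) C x"
      by (auto simp: kappa_gens_def)
    have "sact (nerve C) 1 (Suc 1) (coface i) x \<in> simps (nerve C) 1" for i
      using sact_nerve_simps[OF x mono_coface] by simp
    then show "Poly_Mapping.keys (case s of Inl _ \<Rightarrow> 0 | Inr x \<Rightarrow> \<Sum>i\<le>Suc 1. frag_cmul ((-1) ^ i)
        (frag_of (Inr (sact (nerve C) 1 (Suc 1) (coface i) x)))) \<subseteq> KG 1"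
      unfolding s kappa_gens_def sum.case
      by (intro order_trans[OF Poly_Mapping.keys_sum] UN_least order_trans[OF keys_cmul]) auto
  next
    fix r :: "'a free_chain" assume "r \<in> KR (Suc 1)"
    then obtain m \<sigma> y where m: "m < 2" and \<sigma>: "mono_map 2 m \<sigma>" and y: "y \<in> simps (nerve C) m"
      and r: "r = frag_of (Inr (sact (nerve C) 2 m \<sigma> y))"
      by (auto simp: kappa_rels_def degenerate_def numeral_2_eq_2 simp del: nerve_sel)
    have face: "sact (nerve C) 1 2 (coface i) (sact (nerve C) 2 m \<sigma> y) = sact (nerve C) 1 m (\<sigma> \<circ> coface i) y" for i
      using mono_coface[of 1 i] by (intro sact_sact_nerve \<sigma>) (simp add: numeral_2_eq_2)
    have le: "\<sigma> 0 \<le> m" "\<sigma> 1 \<le> m" "\<sigma> 2 \<le> m" "\<sigma> 0 \<le> \<sigma> 1" "\<sigma> 1 \<le> \<sigma> 2"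
      using \<sigma> by (auto simp: mono_map_def monotone_on_def image_subset_iff)
    have deg: "?f i (sact (nerve C) 2 m \<sigma> y) \<in> KQ.N 1"
      if "\<sigma> (coface i 0) = \<sigma> (coface i 1)" "\<sigma> (coface i 0) \<le> m" for i
      unfolding face by (rule degenerate_edge_mem, rule const_edge_degenerate[OF y]) (use that in auto)
    have cong: "?f i (sact (nerve C) 2 m \<sigma> y) = ?f j (sact (nerve C) 2 m \<sigma> y)"
      if "\<sigma> (coface i 0) = \<sigma> (coface j 0)" "\<sigma> (coface i 1) = \<sigma> (coface j 1)" for i j
    proof -
      have "sact (nerve C) 1 m (\<sigma> \<circ> coface i) y = sact (nerve C) 1 m (\<sigma> \<circ> coface j) y"
        by (rule sact_nerve_cong) (use that in \<open>auto simp: le_Suc_eq\<close>)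
      then show ?thesis unfolding face by simp
    qed
    \<comment> \<open>A monotone map from three vertices to at most two repeats a value on
      neighbours. Faces 0, 1, 2 are the edges 12, 02, 01: if 0 and 1 are identified, faces 0 and 1
      agree and face 2 is degenerate; if 1 and 2 are, faces 1 and 2 agree and face 0 is
      degenerate.\<close>
    consider "\<sigma> 0 = \<sigma> 1" | "\<sigma> 1 = \<sigma> 2" using le m by linarith
    then have "?f 0 (sact (nerve C) 2 m \<sigma> y) - ?f 1 (sact (nerve C) 2 m \<sigma> y) + ?f 2 (sact (nerve C) 2 m \<sigma> y) \<in> KQ.N 1"
    proof cases
      case 1
      then show ?thesis
        using cong[of 0 1] deg[of 2] le by (simp add: coface_def numeral_2_eq_2)
    next
      case 2
      then show ?thesis
        using cong[of 1 2] deg[of 0] le by (simp add: coface_def numeral_2_eq_2)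
    qed
    then show "frag_extend (case_sum (\<lambda>_. 0) (\<lambda>x. \<Sum>i\<le>Suc 1. frag_cmul ((-1) ^ i)
        (frag_of (Inr (sact (nerve C) 1 (Suc 1) (coface i) x))))) r \<in> KQ.N 1"
      unfolding r using sum by (simp add: numeral_2_eq_2 del: nerve_sel)
  qed
  then show ?thesis by (simp add: kappa_def numeral_2_eq_2)
qed

definition to_lam :: "nat \<Rightarrow> 'a free_chain \<Rightarrow> 'a free_chain" where
  "to_lam n = frag_extend (case_sum (\<lambda>_. 0) (\<lambda>x. frag_of (Inl (x n (principal_cell n)))))"

lemma principal_cell_cells: "n \<le> 1 \<Longrightarrow> principal_cell n \<in> oriental_cells n n"
  using path_cell_vertex_cells[of 0 0] path_cell_edge_cells[of 0 1 1]
  by (cases n) (auto simp: principal_cell_0 principal_cell_1[simplified])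

text \<open>The principal edge is collapsed to the vertex 0, taken as a 1-cell of the oriental of
  dimension 0, where it is a unit; y preserves units.\<close>

lemma edge_of_vertex:
  assumes "omega_functor (oriental 0) C y" "mono_map 1 0 \<sigma>"
  shows "sact (nerve C) 1 0 \<sigma> y 1 (principal_cell 1) = ounit C 0 (y 0 (principal_cell 0))"
proof -
  have \<sigma>: "\<sigma> 0 = 0" "\<sigma> 1 = 0" using assms(2) by (auto simp: mono_map_def image_subset_iff)
  have "sact (nerve C) 1 0 \<sigma> y 1 (principal_cell 1) = y 1 (oriental_map \<sigma> (principal_cell 1))"
    using principal_cell_cells[of 1] by simp
  also have "oriental_map \<sigma> (principal_cell 1) = path_cell [0]"
    unfolding principal_cell_1 using oriental_map_edge_const[of \<sigma> 0 1] \<sigma> by simp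
  also have "y 1 (path_cell [0]) = ounit C 0 (y 0 (path_cell [0]))"
    using omega_functorD(5)[OF assms(1), of "path_cell [0]" 0] path_cell_vertex_cells[of 0 0] by simp
  finally show ?thesis by (simp add: principal_cell_0)
qed

text \<open>A unit u satisfies u *_0 u = u, so its relation reads u ~ u + u.\<close>

lemma unit_edge_mem:
  assumes "a \<in> cells C 0" shows "frag_of (Inl (ounit C 0 a)) \<in> LQ.N 1"
proof -
  note u = omega_categoryD(5,6,7)[OF C assms]
  have c: "composable C 1 0 (ounit C 0 a) (ounit C 0 a)"
    using u by (simp add: composable_def)
  have "ocomp C 1 0 (ounit C 0 a) (ounit C 0 a) = ounit C 0 a"
    using omega_categoryD(13)[OF C, of 0 1 "ounit C 0 a"] u by simp
  then have "- (frag_of (Inl (ounit C 0 a)) :: 'a free_chain) \<in> LQ.N 1"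
    using lam_rel_mem[OF c] by simp
  then show ?thesis using subgroup_free_Abelian_groupD(5)[OF LQ.subgroup_N] by fastforce
qed

lemma alpha_sing_map_free_class:
  assumes n: "n \<le> 1" and a: "Poly_Mapping.keys a \<subseteq> KG n"
  shows "alpha_sing_map C n (free_class (KG n) (KR n) a) = free_class (LG n) (LR n) (to_lam n a)"
  unfolding alpha_sing_map_def kappa_to_lam_def to_lam_def
proof (rule free_quot_map_free_class[OF KQ.free_quotient_axioms LQ.free_quotient_axioms _ _ a])
  fix s :: "'a + 'a osimplex" assume "s \<in> KG n"
  then show "Poly_Mapping.keys (case s of Inl _ \<Rightarrow> 0 | Inr x \<Rightarrow> frag_of (Inl (x n (principal_cell n)))) \<subseteq> LG n"
    using principal_cell_cells[OF n] omega_functorD(1)[of "oriental n" C] by (auto simp: kappa_gens_def lam_gens_def)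
next
  fix r :: "'a free_chain" assume "r \<in> KR n"
  then obtain m \<sigma> y where m: "m < n" and \<sigma>: "mono_map n m \<sigma>" and y: "y \<in> simps (nerve C) m"
    and r: "r = frag_of (Inr (sact (nerve C) n m \<sigma> y))"
    by (auto simp: kappa_rels_def degenerate_def simp del: nerve_sel)
  have nm: "n = 1" "m = 0" using n m by auto
  have "y 0 (principal_cell 0) \<in> cells C 0"
    using y nm principal_cell_cells[of 0] omega_functorD(1)[of "oriental 0" C y "principal_cell 0" 0] by simp
  then show "frag_extend (case_sum (\<lambda>_. 0) (\<lambda>x. frag_of (Inl (x n (principal_cell n))))) r \<in> LQ.N n"
    using unit_edge_mem edge_of_vertex[of y \<sigma>] y \<sigma> by (simp add: r nm del: nerve_sel(2))
qed

text \<open>The functors constructed so far live on the oriental of dimension 2. An edge f is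
  realized as the initial edge of the triangle filled by 1_f : f -> 1 *_0 f, a vertex as the origin
  of the edge on its unit, and both are then restricted along the inclusion of [n] into [2].\<close>

lemma ex_simplex:
  assumes "n \<le> 1" "f \<in> cells C n"
  shows "\<exists>x. omega_functor (oriental n) C x \<and> x n (principal_cell n) = f"
proof -
  have edge: "\<exists>X. omega_functor (oriental 2) C X \<and> X 1 (path_cell [0, 1]) = f \<and> X 0 (path_cell [0]) = osrc C 0 f"
    if f: "f \<in> cells C 1" for f
  proof -
    have t: "otgt C 0 f \<in> cells C 0" using omega_categoryD(2)[OF C, of f 0] f by simp
    note u = omega_categoryD(5,6,7)[OF C t]
    have gf: "composable C 1 0 (ounit C 0 (otgt C 0 f)) f" using u f by (simp add: composable_def)
    have "ocomp C 1 0 (ounit C 0 (otgt C 0 f)) f = f"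
      using omega_categoryD(14)[OF C, of 0 1 f] f by simp
    then have arr: "is_arrow C 1 (ounit C 1 f) f (ocomp C 1 0 (ounit C 0 (otgt C 0 f)) f)"
      using omega_categoryD(5,6,7)[OF C f] by (simp add: is_arrow_def)
    show ?thesis
      by (rule ex_nerve_2_simplex[OF C gf f refl _ arr]) (use u in auto)
  qed
  have sub: "\<exists>x. omega_functor (oriental n) C x \<and> x n (principal_cell n) = X n (principal_cell n)"
    if X: "omega_functor (oriental 2) C X" for X
  proof -
    have m: "mono_map n 2 id" using assms(1) by (auto simp: mono_map_def monotone_on_def)
    have "oriental_map id (principal_cell n) = principal_cell n"
      using assms(1) oriental_map_edge[of id 0 1] by (cases n)
        (auto simp: principal_cell_0 principal_cell_1[simplified] oriental_map_eq path_cell_def push_chain_frag_of fun_eq_iff)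
    then show ?thesis
      using sact_nerve_simps[OF X m] principal_cell_cells[OF assms(1)] by (intro exI[of _ "sact (nerve C) n 2 id X"]) simp
  qed
  show ?thesis
  proof (cases n)
    case 0
    note u = omega_categoryD(5,6,7)[OF C, of f 0]
    obtain X where X: "omega_functor (oriental 2) C X" "X 0 (path_cell [0]) = osrc C 0 (ounit C 0 f)"
      using edge[of "ounit C 0 f"] u assms(2) 0 by auto
    then show ?thesis using sub[OF X(1)] u assms(2) by (simp add: 0 principal_cell_0)
  next
    case (Suc m)
    then have "n = 1" using assms(1) by simp
    then show ?thesis using edge[of f] sub assms(2) by (auto simp: principal_cell_1[simplified])
  qed
qed

section \<open>The inverse of the comparison on free chains of degrees 0 and 1\<close>

definition simplex :: "nat \<Rightarrow> 'a \<Rightarrow> 'a osimplex" where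
  "simplex n f = (SOME x. omega_functor (oriental n) C x \<and> x n (principal_cell n) = f)"

lemma simplex:
  assumes "n \<le> 1" "f \<in> cells C n"
  shows "omega_functor (oriental n) C (simplex n f)" "simplex n f n (principal_cell n) = f"
  using someI_ex[OF ex_simplex[OF assms]] unfolding simplex_def by auto

lemma simplex_eqI:
  assumes "n \<le> 1" "omega_functor (oriental n) C x" "x n (principal_cell n) = f"
  shows "simplex n f = x"
proof -
  have "f \<in> cells C n"
    using assms principal_cell_cells[OF assms(1)] omega_functorD(1)[OF assms(2), of "principal_cell n" n] by simp
  then show ?thesis
    using nerve_simplex_eqI[OF simplex(1)[OF assms(1)] assms(2,1)] simplex(2)[OF assms(1)] assms(3) by simp
qed

definition of_lam :: "nat \<Rightarrow> 'a free_chain \<Rightarrow> 'a free_chain" where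
  "of_lam n = frag_extend (case_sum (\<lambda>f. frag_of (Inr (simplex n f))) (\<lambda>_. 0))"

lemma of_lam_to_lam: "n \<le> 1 \<Longrightarrow> Poly_Mapping.keys a \<subseteq> KG n \<Longrightarrow> of_lam n (to_lam n a) = a"
proof -
  assume n: "n \<le> 1" and "Poly_Mapping.keys a \<subseteq> KG n"
  from this(2) show ?thesis
  proof (induction a rule: frag_induction)
    case (one s)
    then show ?case using simplex_eqI[OF n] by (auto simp: kappa_gens_def of_lam_def to_lam_def)
  qed (simp_all add: of_lam_def to_lam_def frag_extend_diff)
qed

lemma to_lam_of_lam: "n \<le> 1 \<Longrightarrow> Poly_Mapping.keys a \<subseteq> LG n \<Longrightarrow> to_lam n (of_lam n a) = a"
proof -
  assume n: "n \<le> 1" and "Poly_Mapping.keys a \<subseteq> LG n"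
  from this(2) show ?thesis
  proof (induction a rule: frag_induction)
    case (one s)
    then show ?case using simplex(2)[OF n] by (auto simp: lam_gens_def of_lam_def to_lam_def)
  qed (simp_all add: of_lam_def to_lam_def frag_extend_diff)
qed

lemma keys_of_lam:
  assumes "n \<le> 1" "Poly_Mapping.keys a \<subseteq> LG n" shows "Poly_Mapping.keys (of_lam n a) \<subseteq> KG n"
proof -
  have "subgroup {a. Poly_Mapping.keys a \<subseteq> KG n} (free_Abelian_group (KG n))"
    using keys_diff by (intro subgroup_free_Abelian_groupI) fastforce+
  then have "of_lam n a \<in> {a. Poly_Mapping.keys a \<subseteq> KG n}"
    unfolding of_lam_def
    by (rule frag_extend_mem[OF _ _ assms(2)])
      (use simplex(1)[OF assms(1)] in \<open>auto simp: lam_gens_def kappa_gens_def\<close>)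
  then show ?thesis by simp
qed

lemma keys_to_lam:
  assumes "n \<le> 1" "Poly_Mapping.keys a \<subseteq> KG n" shows "Poly_Mapping.keys (to_lam n a) \<subseteq> LG n"
proof -
  have "subgroup {a. Poly_Mapping.keys a \<subseteq> LG n} (free_Abelian_group (LG n))"
    using keys_diff by (intro subgroup_free_Abelian_groupI) fastforce+
  then have "to_lam n a \<in> {a. Poly_Mapping.keys a \<subseteq> LG n}"
    unfolding to_lam_def
    by (rule frag_extend_mem[OF _ _ assms(2)])
      (use principal_cell_cells[OF assms(1)] omega_functorD(1)[of "oriental n" C] in
        \<open>auto simp: lam_gens_def kappa_gens_def\<close>)
  then show ?thesis by simp
qed

lemma alpha_sing_map_surj:
  assumes "n \<le> 1" shows "carrier (cgrp L n) \<subseteq> alpha_sing_map C n ` carrier (cgrp K n)"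
proof
  fix z assume "z \<in> carrier (cgrp L n)"
  then obtain a where a: "Poly_Mapping.keys a \<subseteq> LG n" "z = free_class (LG n) (LR n) a"
    by (auto simp: cgrp_L LQ.carrier_free_quot)
  have "alpha_sing_map C n (free_class (KG n) (KR n) (of_lam n a)) = z"
    using alpha_sing_map_free_class[OF assms keys_of_lam[OF assms a(1)]] to_lam_of_lam[OF assms a(1)] a(2) by simp
  then show "z \<in> alpha_sing_map C n ` carrier (cgrp K n)"
    using keys_of_lam[OF assms a(1)] by (force simp: cgrp_K KQ.carrier_free_quot)
qed

text \<open>Compositions of n-cells are along dimensions k < n, so there are no relations in degree
  0, and \<open>of_lam\<close> already inverts the map on free groups.\<close>

lemma alpha_sing_map_0_inj: "inj_on (alpha_sing_map C 0) (carrier (cgrp K 0))"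
proof
  fix z z' assume "z \<in> carrier (cgrp K 0)" "z' \<in> carrier (cgrp K 0)" and eq: "alpha_sing_map C 0 z = alpha_sing_map C 0 z'"
  then obtain a a' where a: "Poly_Mapping.keys a \<subseteq> KG 0" "z = free_class (KG 0) (KR 0) a"
    "Poly_Mapping.keys a' \<subseteq> KG 0" "z' = free_class (KG 0) (KR 0) a'"
    by (auto simp: cgrp_K KQ.carrier_free_quot)
  have "to_lam 0 a - to_lam 0 a' \<in> LQ.N 0"
    using eq a keys_to_lam[of 0] by (simp add: alpha_sing_map_free_class LQ.free_class_eq_iff)
  moreover have "LR 0 = {}" by (auto simp: lam_rels_def composable_def)
  ultimately have "to_lam 0 a = to_lam 0 a'"
    using group.generate_empty[OF group_free_Abelian_group, of "LG 0"] by simp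
  then have "a = a'" using of_lam_to_lam[of 0] a by (metis le0)
  then show "z = z'" by (simp add: a)
qed

lemma face_eq_simplex:
  assumes X: "omega_functor (oriental 2) C X"
  shows "sact (nerve C) 1 2 (coface i) X = simplex 1 (X 1 (path_cell [coface i 0, coface i 1]))"
proof (rule simplex_eqI[symmetric])
  have m: "mono_map 1 2 (coface i)" using mono_coface[of 1 i] by (simp add: numeral_2_eq_2)
  show "omega_functor (oriental 1) C (sact (nerve C) 1 2 (coface i) X)" by (rule sact_nerve_simps[OF X m])
  show "sact (nerve C) 1 2 (coface i) X 1 (principal_cell 1) = X 1 (path_cell [coface i 0, coface i 1])"
    using principal_cell_cells[of 1] oriental_map_edge[of "coface i" 0 1]
    by (simp add: principal_cell_1[simplified] coface_def split: if_splits)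
qed simp

lemma unit_simplex_degenerate:
  assumes "a \<in> cells C 0" shows "simplex 1 (ounit C 0 a) \<in> degenerate (nerve C) 1"
proof -
  have m: "mono_map 1 0 (\<lambda>_. 0)" by (auto simp: mono_map_def monotone_on_def)
  note v = simplex[OF le0 assms]
  have "simplex 1 (ounit C 0 a) = sact (nerve C) 1 0 (\<lambda>_. 0) (simplex 0 a)"
    by (rule simplex_eqI) (use edge_of_vertex[OF v(1) m] v(2) sact_nerve_simps[OF v(1) m] in auto)
  then show ?thesis using m v(1) unfolding degenerate_def nerve_sel(1) by blast
qed

text \<open>Injectivity on \<open>H\<^sub>1\<close>: every relation imposed in \<open>\<lambda>(C)\<close> on a sum of edges comes from a
  2-simplex of the nerve, a composite from one filled by a unit and a 2-cell from one with a unit edge.\<close>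

lemma boundaries_of_alpha_sing_map:
  assumes K: "chain_complex K" and z: "z \<in> carrier (cgrp K 1)" "alpha_sing_map C 1 z \<in> boundaries L 1"
  shows "z \<in> boundaries K 1"
proof -
  \<comment> \<open>Working with the preimage of the boundaries in the free group lets the relations
    of \<lambda>(C) be tested one generator at a time, although \<open>of_lam\<close> need not send
    cosets into cosets.\<close>
  define U where "U = {b. Poly_Mapping.keys b \<subseteq> KG 1 \<and> free_class (KG 1) (KR 1) b \<in> boundaries K 1}"
  note B = subgroup_boundaries[OF K, of 1, unfolded cgrp_K]
  note grp = chain_complexD(2)[OF K, of 1, unfolded cgrp_K]
  have U: "subgroup U (free_Abelian_group (KG 1))"
  proof (rule subgroup_free_Abelian_groupI)
    show "0 \<in> U" using subgroup.one_closed[OF B] KQ.free_class_zero[of 1] by (simp add: U_def)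
  next
    fix a b assume ab: "a \<in> U" "b \<in> U"
    let ?c = "free_class (KG 1) (KR 1)"
    have k: "Poly_Mapping.keys (a - b) \<subseteq> KG 1" using ab keys_diff[of a b] by (auto simp: U_def)
    have c: "?c a \<in> boundaries K 1" "?c b \<in> boundaries K 1" using ab by (auto simp: U_def)
    have cc: "?c (a - b) \<in> carrier (free_quot (KG 1) (KR 1))" using k by (auto simp: KQ.carrier_free_quot)
    have "?c (a - b) \<otimes>\<^bsub>free_quot (KG 1) (KR 1)\<^esub> ?c b = ?c a"
      using KQ.free_class_mult[OF k, of b] ab by (simp add: U_def)
    then have "?c (a - b) = ?c a \<otimes>\<^bsub>free_quot (KG 1) (KR 1)\<^esub> inv\<^bsub>free_quot (KG 1) (KR 1)\<^esub> ?c b"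
      using group.inv_solve_right[OF grp cc] subgroup.mem_carrier[OF B] c by metis
    then show "a - b \<in> U"
      using k c subgroup.m_closed[OF B] subgroup.m_inv_closed[OF B] by (simp add: U_def)
  qed (simp add: U_def)
  note UD = subgroup_free_Abelian_groupD[OF U]
  have degen: "frag_of (Inr x) \<in> U" if x: "x \<in> degenerate (nerve C) 1" for x
  proof -
    have k: "Poly_Mapping.keys (frag_of (Inr x) :: 'a free_chain) \<subseteq> KG 1"
      using degenerate_simps[of 1] x by (auto simp: kappa_gens_def)
    then have "free_class (KG 1) (KR 1) (frag_of (Inr x)) = free_class (KG 1) (KR 1) 0"
      using degenerate_edge_mem[OF x] by (simp add: KQ.free_class_eq_iff)
    then show ?thesis
      using k subgroup.one_closed[OF B] KQ.free_class_zero[of 1] by (simp add: U_def)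
  qed
  have triangle: "frag_of (Inr (simplex 1 g)) - frag_of (Inr (simplex 1 h)) + frag_of (Inr (simplex 1 f)) \<in> U"
    if gf: "composable C 1 0 g f" and h: "h \<in> cells C 1" "osrc C 0 h = osrc C 0 f" "otgt C 0 h = otgt C 0 g"
      and \<alpha>: "is_arrow C 1 \<alpha> h (ocomp C 1 0 g f)" for f g h \<alpha>
  proof -
    obtain X where X: "omega_functor (oriental 2) C X"
      "X 1 (path_cell [0, 1]) = f" "X 1 (path_cell [1, 2]) = g" "X 1 (path_cell [0, 2]) = h"
      by (rule ex_nerve_2_simplex[OF C gf h \<alpha>])
    let ?x = "frag_of (Inr X) :: 'a free_chain"
    let ?f = "\<lambda>i. frag_of (Inr (sact (nerve C) 1 2 (coface i) X)) :: 'a free_chain"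
    have x: "Poly_Mapping.keys ?x \<subseteq> KG 2" using X(1) by (simp add: kappa_gens_def)
    have "kap_bdry 1 ?x = ?f 0 - ?f 1 + ?f 2"
      by (simp add: kap_bdry_def numeral_2_eq_2 del: nerve_sel)
    also have "\<dots> = frag_of (Inr (simplex 1 g)) - frag_of (Inr (simplex 1 h)) + frag_of (Inr (simplex 1 f))"
      using X(2-4) unfolding face_eq_simplex[OF X(1)] by (simp add: coface_def numeral_2_eq_2)
    finally have eq: "kap_bdry 1 ?x = frag_of (Inr (simplex 1 g)) - frag_of (Inr (simplex 1 h)) + frag_of (Inr (simplex 1 f))" .
    have "cdiff K 1 (free_class (KG 2) (KR 2) ?x) \<in> boundaries K 1"
      using x unfolding boundaries_def by (auto simp: cgrp_K KQ.carrier_free_quot numeral_2_eq_2)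
    moreover have "Poly_Mapping.keys (kap_bdry 1 ?x) \<subseteq> KG 1"
    proof -
      have "f \<in> cells C 1" "g \<in> cells C 1" using gf by (auto simp: composable_def)
      then have "frag_of (Inr (simplex 1 i)) \<in> carrier (free_Abelian_group (KG 1))" if "i \<in> {f, g, h}" for i
        using simplex(1)[of 1 i] h(1) that by (auto simp: kappa_gens_def)
      then show ?thesis
        unfolding eq by (intro order_trans[OF Poly_Mapping.keys_add] Un_least order_trans[OF keys_diff]) auto
    qed
    ultimately have "kap_bdry 1 ?x \<in> U" using cdiff_K_1[OF x] by (simp add: U_def)
    then show ?thesis unfolding eq .
  qed
  have rel: "of_lam 1 r \<in> U" if r: "r \<in> LR 1" for r
  proof -
    obtain x y where r: "r = frag_of (Inl (ocomp C 1 0 x y)) - (frag_of (Inl x) + frag_of (Inl y))"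
      and xy: "composable C 1 0 x y"
      using r by (auto simp: lam_rels_def composable_def)
    let ?h = "ocomp C 1 0 x y"
    have h: "?h \<in> cells C 1" "osrc C 0 ?h = osrc C 0 y" "otgt C 0 ?h = otgt C 0 x"
      using omega_categoryD(8)[OF C xy] omega_categoryD(9,10)[OF C, of 0 x y] xy by auto
    have "is_arrow C 1 (ounit C 1 ?h) ?h ?h"
      using omega_categoryD(5,6,7)[OF C h(1)] by (simp add: is_arrow_def)
    \<comment> \<open>The triangle filled by the unit of the composite has boundary x - x *_0 y + y,
      the negative of the relation.\<close>
    from UD(5)[OF triangle[OF xy h this]] show ?thesis
      by (simp add: r of_lam_def frag_extend_diff frag_extend_add algebra_simps)
  qed
  have bdry: "of_lam 1 (lam_bdry 1 (frag_of s)) \<in> U" if s: "s \<in> LG 2" for s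
  proof -
    obtain w where w: "w \<in> cells C (Suc 1)" "s = Inl w" using s by (auto simp: lam_gens_def numeral_2_eq_2)
    let ?s = "osrc C 1 w" and ?t = "otgt C 1 w" and ?u = "ounit C 0 (otgt C 0 (otgt C 1 w))"
    have st: "?s \<in> cells C 1" "?t \<in> cells C 1" using omega_categoryD(1,2)[OF C w(1)] by auto
    have par: "osrc C 0 ?s = osrc C 0 ?t" "otgt C 0 ?s = otgt C 0 ?t"
      using omega_categoryD(3,4)[OF C, of w 0] w(1) by auto
    have t0: "otgt C 0 ?t \<in> cells C 0" using omega_categoryD(2)[OF C, of ?t 0] st by simp
    note u = omega_categoryD(5,6,7)[OF C t0]
    have ut: "composable C 1 0 ?u ?t" using u st by (simp add: composable_def)
    have "ocomp C 1 0 ?u ?t = ?t" using omega_categoryD(14)[OF C, of 0 1 ?t] st by simp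
    then have "is_arrow C 1 w ?s (ocomp C 1 0 ?u ?t)" using w by (simp add: is_arrow_def)
    \<comment> \<open>Taking the second edge of the triangle to be the unit \<open>?u\<close> makes
      w itself a filler, with boundary \<open>?u - ?s + ?t\<close>. The edge \<open>?u\<close> is
      degenerate and is subtracted, leaving the boundary of w.\<close>
    then have "frag_of (Inr (simplex 1 ?u)) - frag_of (Inr (simplex 1 ?s)) + frag_of (Inr (simplex 1 ?t)) \<in> U"
      using par u by (intro triangle[OF ut st(1)]) auto
    from UD(4)[OF this degen[OF unit_simplex_degenerate[OF t0]]] show ?thesis
      by (simp add: w(2) of_lam_def lam_bdry_def frag_extend_diff)
  qed
  have bdrys: "of_lam 1 (lam_bdry 1 w) \<in> U" if "Poly_Mapping.keys w \<subseteq> LG 2" for w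
    using that
  proof (induction w rule: frag_induction)
    case zero
    then show ?case using UD(2) by (simp add: of_lam_def lam_bdry_def)
  next
    case (one s)
    then show ?case by (rule bdry)
  next
    case (diff a b)
    then show ?case using UD(4) by (simp add: of_lam_def lam_bdry_def frag_extend_diff)
  qed
  obtain a where a: "Poly_Mapping.keys a \<subseteq> KG 1" "z = free_class (KG 1) (KR 1) a"
    using z(1) by (auto simp: cgrp_K KQ.carrier_free_quot)
  obtain w where w: "Poly_Mapping.keys w \<subseteq> LG 2" "alpha_sing_map C 1 z = cdiff L 1 (free_class (LG (Suc 1)) (LR (Suc 1)) w)"
    using z(2) by (auto simp: boundaries_def cgrp_L LQ.carrier_free_quot numeral_2_eq_2)
  have w': "Poly_Mapping.keys w \<subseteq> LG (Suc 1)" using w(1) by (simp add: numeral_2_eq_2)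
  have lw: "Poly_Mapping.keys (lam_bdry 1 w) \<subseteq> LG 1"
    unfolding lam_bdry_def
  proof (rule order_trans[OF keys_frag_extend], rule UN_least)
    fix s assume "s \<in> Poly_Mapping.keys w"
    then obtain v where "v \<in> cells C (Suc 1)" "s = Inl v" using w' by (auto simp: lam_gens_def)
    then show "Poly_Mapping.keys (case s of Inl x \<Rightarrow> frag_of (Inl (otgt C 1 x)) - frag_of (Inl (osrc C 1 x)) | Inr _ \<Rightarrow> 0) \<subseteq> LG 1"
      using omega_categoryD(1,2)[OF C, of v 1] by (auto simp: lam_gens_def dest!: subsetD[OF keys_diff])
  qed
  have la: "Poly_Mapping.keys (to_lam 1 a) \<subseteq> LG 1" using keys_to_lam[OF _ a(1)] by simp
  have "free_class (LG 1) (LR 1) (to_lam 1 a) = free_class (LG 1) (LR 1) (lam_bdry 1 w)"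
    using w(2) cdiff_L[OF w'] alpha_sing_map_free_class[OF _ a(1)] by (simp add: a(2))
  then have "to_lam 1 a - lam_bdry 1 w \<in> LQ.N 1" using la lw by (simp add: LQ.free_class_eq_iff)
  moreover have "LQ.N 1 \<subseteq> {b. Poly_Mapping.keys b \<subseteq> LG 1 \<and> of_lam 1 b \<in> U}"
    unfolding of_lam_def
    by (rule LQ.N_subset[OF subgroup_vimage_frag_extend[OF U]]) (use rel LQ.rels in \<open>auto simp: of_lam_def\<close>)
  \<comment> \<open>The chain \<open>to_lam 1 a\<close> is a combination of relations plus the
    boundary of w, and \<open>of_lam\<close> sends each summand into U.\<close>
  ultimately have "of_lam 1 (to_lam 1 a - lam_bdry 1 w) \<in> U" by blast
  from UD(3)[OF this bdrys[OF w(1)]] have "of_lam 1 (to_lam 1 a) \<in> U"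
    by (simp add: of_lam_def frag_extend_diff)
  then have "a \<in> U" using of_lam_to_lam[OF _ a(1)] by simp
  then show ?thesis by (simp add: a(2) U_def)
qed

text \<open>The chain map is onto in degrees 0 and 1 and injective in degree 0. For k = 0, a
  boundary is lifted by surjectivity in degree 1 and recognized by injectivity in degree 0. The same
  injectivity makes any preimage of a 1-cycle a cycle.\<close>

lemma alpha_sing_map_homology_iso:
  assumes K: "chain_complex K" and L: "chain_complex L" and f: "chain_map K L (alpha_sing_map C)"
    and k: "k \<in> {0, 1}"
  shows "homology_map k K L (alpha_sing_map C) \<in> Group.iso (homology k K) (homology k L)"
proof -
  have k1: "k \<le> 1" using k by auto
  interpret h: group_hom "homology k K" "homology k L" "homology_map k K L (alpha_sing_map C)"
    by (simp add: group_hom_def group_hom_axioms_def homology_group K L homology_map_hom f)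
  interpret f0: group_hom "cgrp K 0" "cgrp L 0" "alpha_sing_map C 0"
    using K L f by (rule chain_map_group_hom)
  have comm: "alpha_sing_map C 0 (cdiff K 0 v) = cdiff L 0 (alpha_sing_map C (Suc 0) v)"
    if "v \<in> carrier (cgrp K (Suc 0))" for v
    using f that unfolding chain_map_def by blast
  have bd: "z \<in> boundaries K k" if z: "z \<in> cycles K k" "alpha_sing_map C k z \<in> boundaries L k" for z
  proof (cases "k = 0")
    case True
    obtain w where w: "w \<in> carrier (cgrp L (Suc 0))" "alpha_sing_map C 0 z = cdiff L 0 w"
      using z(2) unfolding boundaries_def True by blast
    obtain v where v: "v \<in> carrier (cgrp K (Suc 0))" "w = alpha_sing_map C (Suc 0) v"
      using w(1) alpha_sing_map_surj[of "Suc 0"] by auto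
    have "alpha_sing_map C 0 z = alpha_sing_map C 0 (cdiff K 0 v)"
      using comm[OF v(1)] v(2) w(2) by simp
    then have "z = cdiff K 0 v"
      using cycles_carrier[OF z(1)] unfolding True
      by (rule inj_onD[OF alpha_sing_map_0_inj _ _ chain_complexD(5)[OF K v(1)]])
    then show ?thesis using v(1) unfolding boundaries_def True by blast
  next
    case False
    then have "k = 1" using k by simp
    with z cycles_carrier[OF z(1)] show ?thesis
      by (simp only: boundaries_of_alpha_sing_map[OF K])
  qed
  have onto: "\<exists>z\<in>cycles K k. alpha_sing_map C k z = y" if y: "y \<in> cycles L k" for y
  proof -
    obtain z where z: "z \<in> carrier (cgrp K k)" "y = alpha_sing_map C k z"
      using alpha_sing_map_surj[OF k1] cycles_carrier[OF y] by blast
    have "z \<in> cycles K k"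
    proof (cases "k = 0")
      case True
      then show ?thesis using z(1) by (simp add: cycles_def)
    next
      case False
      then have k: "k = Suc 0" using k by simp
      have zk: "z \<in> carrier (cgrp K (Suc 0))" using z(1) k by simp
      have "alpha_sing_map C 0 (cdiff K 0 z) = cdiff L 0 y"
        using comm[OF zk] z(2) k by simp
      also have "\<dots> = alpha_sing_map C 0 \<one>\<^bsub>cgrp K 0\<^esub>"
        using y by (simp add: cycles_def k)
      finally have "cdiff K 0 z = \<one>\<^bsub>cgrp K 0\<^esub>"
        by (rule inj_onD[OF alpha_sing_map_0_inj _ chain_complexD(5)[OF K zk]]) simp
      then show ?thesis using zk by (simp add: cycles_def k)
    qed
    then show ?thesis using z(2) by blast
  qed
  have "carrier (homology k L) \<subseteq> homology_map k K L (alpha_sing_map C) ` carrier (homology k K)"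
  proof
    fix x assume "x \<in> carrier (homology k L)"
    then obtain y where y: "y \<in> cycles L k" "x = hclass L k y" by (auto simp: carrier_homology)
    obtain z where z: "z \<in> cycles K k" "alpha_sing_map C k z = y" using onto[OF y(1)] by blast
    then have "x = homology_map k K L (alpha_sing_map C) (hclass K k z)"
      using homology_map_hclass[OF K L f z(1)] y(2) by simp
    then show "x \<in> homology_map k K L (alpha_sing_map C) ` carrier (homology k K)"
      using z(1) by (auto simp: carrier_homology)
  qed
  moreover have "x = \<one>\<^bsub>homology k K\<^esub>"
    if x: "x \<in> carrier (homology k K)" "homology_map k K L (alpha_sing_map C) x = \<one>\<^bsub>homology k L\<^esub>" for x
  proof -
    obtain z where z: "z \<in> cycles K k" "x = hclass K k z" using x(1) by (auto simp: carrier_homology)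
    then have "alpha_sing_map C k z \<in> boundaries L k"
      using x(2) homology_map_hclass[OF K L f z(1)] hclass_eq_one_iff[OF L chain_map_cycles[OF K L f z(1)]] by simp
    then show ?thesis using bd[OF z(1)] hclass_eq_one_iff[OF K z(1)] z(2) by simp
  qed
  ultimately show ?thesis unfolding h.iso_iff by blast
qed

end

text \<open>Gives room in the type of chains for the free groups and coded pairs from which the test
  complexes and their cylinders are made.\<close>

lemma infinite_chains:
  assumes "infinite (UNIV :: 'a set)" shows "infinite (UNIV :: 'a chains set)"
proof -
  have "inj (\<lambda>a :: 'a. {frag_of (Inl a)} :: 'a chains)"
    by (auto simp: inj_def frag_of_eq)
  then show ?thesis
    using assms by (metis finite_imageD finite_subset subset_UNIV)
qed

section \<open>The comparison map in the homotopy categories\<close>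

lemma is_functor_comp:
  assumes F: "is_functor A B F" and G: "is_functor B D G" shows "is_functor A D (G \<odot> F)"
  using is_functorD[OF F] is_functorD[OF G] unfolding is_functor_def by simp

text \<open>The hypothesis on \<open>alpha_sing\<close> contains the chain-level facts: the class of
  one forward step is an arrow of \<open>ho_Ch\<close> only if both ends are complexes and
  \<open>alpha_sing_map C\<close> is a chain map.\<close>

lemma alpha_sing_homology:
  fixes C :: "'a ocat" and \<phi> :: "'a hochmor"
  assumes C: "omega_category C" and k: "k \<in> {0, 1}"
    and \<alpha>: "alpha_sing C \<in> Hom ho_Ch (kappa (nerve C)) (lam C)"
  shows "bij_betw (ho_homology k (alpha_sing C)) (carrier (homology k (kappa (nerve C) :: 'a chains chcx)))
    (carrier (homology k (lam C)))"
proof -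
  interpret low_degrees C by unfold_locales (rule C)
  have f: "chain_complex K" "chain_complex L" "chain_map K L (alpha_sing_map C)"
    using Hom_of_Fwd_in_localization[OF Ch_composition_closed, of quasi_iso K L "alpha_sing_map C"] \<alpha>
    by (simp_all add: alpha_sing_def gamma_Ch_def ho_Ch_def del: localization_sel)
  have "bij_betw (homology_map k K L (alpha_sing_map C)) (carrier (homology k K)) (carrier (homology k L))"
    using alpha_sing_map_homology_iso[OF f k] by (simp add: iso_def)
  then show ?thesis
    using ho_homology_gamma_Ch[OF f] by (subst bij_betw_cong) (auto simp: alpha_sing_def)
qed

theorem proposition4p6p23:
  fixes C :: "'a ocat"
    and Hsing :: "('a ocat, 'a homor, 'a chains chcx, 'a hochmor) fun_data"
    and J :: "('a ocat, 'a homor, 'a ocat, 'a homor) fun_data"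
    and Hpol :: "('a ocat, 'a homor, 'a chains chcx, 'a hochmor) fun_data"
    and \<alpha>pol \<pi> :: "'a ocat \<Rightarrow> 'a hochmor"
    and k :: nat
  assumes "infinite (UNIV :: 'a set)"
    and "is_singular_homology Hsing"
    and "is_induced_J J"
    and "is_polygraphic_homology Hpol \<alpha>pol"
    and "is_comparison_map Hsing J Hpol \<alpha>pol \<pi>"
    and "omega_category C"
    and "k \<in> {0, 1}"
  shows "ho_homology k (\<pi> C) \<in> iso (homology k (kappa (nerve C))) (homology k (fob Hpol C))"
proof -
  have Ob: "C \<in> Ob omega_Cat \<longleftrightarrow> omega_category C" for C :: "'a ocat" by (simp add: omega_Cat_def)
  \<comment> \<open>Localization functors are the identity on objects, so the defining equations of
    J and Hsing fix the value at C itself and not only up to isomorphism.\<close>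
  have G_Ob: "fob (Hsing \<odot> J) C = kappa (nerve C)" if "omega_category C" for C
    using assms(2,3) that
    by (simp add: is_singular_homology_def is_induced_J_def functor_eq_def Ob gamma_folk_def gamma_Th_def
        gamma_Ch_def Kappa_nerve_def)
  have kan: "right_kan_extension omega_Cat (localization omega_Cat folk_equivalence) ho_Ch
      (loc_functor omega_Cat folk_equivalence) (gamma_Ch \<odot> Lam) Hpol \<alpha>pol"
    using assms(4) by (simp add: is_polygraphic_homology_def ho_folk_def gamma_folk_def)
  have G: "is_functor (localization omega_Cat folk_equivalence) ho_Ch (Hsing \<odot> J)"
    using assms(2,3) unfolding is_singular_homology_def is_induced_J_def ho_folk_def
    by (blast intro: is_functor_comp)
  have \<pi>: "nat_trans (localization omega_Cat folk_equivalence) ho_Ch (Hsing \<odot> J) Hpol \<pi>"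
    and fac: "factors_through omega_Cat ho_Ch (loc_functor omega_Cat folk_equivalence) (gamma_Ch \<odot> Lam)
      Hpol \<alpha>pol (Hsing \<odot> J) alpha_sing \<pi>"
    using assms(5) by (simp_all add: is_comparison_map_def ho_folk_def gamma_folk_def)
  have bij: "bij_betw (ho_homology k (alpha_sing D)) (carrier (homology k (fob (Hsing \<odot> J) D)))
      (carrier (homology k (fob Lam D)))" if D: "D \<in> Ob omega_Cat" for D
  proof -
    have oD: "omega_category D" using D Ob by blast
    \<comment> \<open>\<open>alpha_sing\<close> is defined as a class, with no claim that it is an
      arrow. It is one because the factorization identifies it with the composite of \<pi> and
      \<alpha>pol, whose components are arrows.\<close>
    have "\<alpha>pol D \<in> Hom ho_Ch (fob Hpol D) (lam D)"
      using kan D unfolding right_kan_extension_def nat_trans_def by (simp add: gamma_Ch_def Lam_def)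
    moreover have "\<pi> D \<in> Hom ho_Ch (kappa (nerve D)) (fob Hpol D)"
      using \<pi> D unfolding nat_trans_def localization_sel(1) G_Ob[OF oD, symmetric] by blast
    ultimately have "Comp ho_Ch (kappa (nerve D)) (fob Hpol D) (lam D) (\<alpha>pol D) (\<pi> D)
        \<in> Hom ho_Ch (kappa (nerve D)) (lam D)"
      by (intro ho_Ch_Comp_closed)
    then have "alpha_sing D \<in> Hom ho_Ch (kappa (nerve D)) (lam D)"
      using fac D G_Ob[OF oD] by (simp add: factors_through_def gamma_Ch_def Lam_def)
    from alpha_sing_homology[OF oD assms(7) this] show ?thesis
      unfolding G_Ob[OF oD] by (simp add: Lam_def)
  qed
  show ?thesis
    using right_kan_extension_homology_iso[OF infinite_chains[OF assms(1)] kan G \<pi> fac bij, of C]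
      assms(6) unfolding Ob G_Ob[OF assms(6)] by simp
qed

end
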